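(* Let $X$ be a metric space with curvature bounded above. For every point $o\in X$ there is a number $\varepsilon>0$ such that the punctured ball $B_\varepsilon(o)\setminus\{o\}$ is homotopy equivalent to the space of directions $\Sigma_oX$.
   Context: For $\kappa\in\mathbb{R}$, let $M_\kappa$ be the complete simply connected surface of constant sectional curvature $\kappa$, and put $D_\kappa=\pi/\sqrt{\kappa}$ if $\kappa>0$ and $D_\kappa=\infty$ if $\kappa\le 0$. A metric space is a CAT$(\kappa)$ space if any two points at distance less than $D_\kappa$ are joined by a geodesic (an isometric embedding of a closed interval) and geodesic triangles of perimeter less than $2D_\kappa$ are not thicker than their comparison triangles in $M_\kappa$. CAT$(\kappa)$ spaces are not assumed complete. A metric space has curvature bounded above if every point has a neighborhood which is a CAT$(\kappa)$ space for some $\kappa$ (which may depend on the point). $B_r(o)=\{x\in X\mid d(x,o)<r\}$ is the open ball. Space of directions: let $c:[0,a]\to X$, $c':[0,a']\to X$ ($a,a'>0$) be geodesics starting at $o$. Their Alexandrov angle is $\angle(c,c')=2\lim_{s\to 0}\arcsin\big(d(c(s),c'(s))/2s\big)$. Inside a sufficiently small CAT$(\kappa)$ ball $B$ around $o$ every point $x\ne o$ is joined to $o$ by a unique geodesic, and for $u,v\in B\setminus\{o\}$ one puts $\angle_o(u,v)=\angle(c,c')$, where $c,c'$ are the geodesics from $o$ to $u$ and from $o$ to $v$. This is a pseudometric on $B\setminus\{o\}$; the space of directions $(\Sigma_oX,\angle_o)$ is the metric completion of $B\setminus\{o\}$ with respect to $\angle_o$, where points $u,v$ with $\angle_o(u,v)=0$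 are identified. It carries the topology of the metric $\angle_o$ and does not depend on the choice of $B$. *)

theory Defs
  imports "HOL-Analysis.Analysis"
begin

section \<open>The model surfaces\<close>

definition minkowski :: "real^3 \<Rightarrow> real^3 \<Rightarrow> real" where
  "minkowski x y = x$1 * y$1 + x$2 * y$2 - x$3 * y$3"

text \<open>
  The simply connected complete surface of constant curvature \<open>\<kappa>\<close> with its length metric, in
  the usual models: round sphere, Euclidean plane, upper sheet of the hyperboloid. The unit
  sphere and the unit hyperboloid carry the rescaled metric. All three live in the same type.
\<close>

definition model_points :: "real \<Rightarrow> (real^3) set" where
  "model_points \<kappa> =
     (if \<kappa> > 0 then {x. x \<bullet> x = 1}
      else if \<kappa> = 0 then {x. x$3 = 0}
      else {x. minkowski x x = - 1 \<and> x$3 > 0})"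

text \<open>
  The type of metrics demands non-negativity and symmetry also outside the carrier, hence the
  value 0 there (likewise for the completion below).
\<close>

definition model_dist :: "real \<Rightarrow> real^3 \<Rightarrow> real^3 \<Rightarrow> real" where
  "model_dist \<kappa> x y =
     (if x \<notin> model_points \<kappa> \<or> y \<notin> model_points \<kappa> then 0
      else if \<kappa> > 0 then arccos (x \<bullet> y) / sqrt \<kappa>
      else if \<kappa> = 0 then dist x y
      else arcosh (- minkowski x y) / sqrt (- \<kappa>))"

definition model_surface :: "real \<Rightarrow> (real^3) metric" where
  "model_surface \<kappa> = metric (model_points \<kappa>, model_dist \<kappa>)"

definition model_diam :: "real \<Rightarrow> ereal" where
  "model_diam \<kappa> = (if \<kappa> > 0 then ereal (pi / sqrt \<kappa>) else \<infinity>)"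

lemma minkowski_linear:
  "minkowski (a *\<^sub>R x + b *\<^sub>R y) z = a * minkowski x z + b * minkowski y z"
  "minkowski z (a *\<^sub>R x + b *\<^sub>R y) = a * minkowski z x + b * minkowski z y"
  by (simp_all add: minkowski_def algebra_simps)

lemma minkowski_commute: "minkowski x y = minkowski y x"
  by (simp add: minkowski_def mult.commute)

lemma spacelike:
  assumes y: "minkowski y y = - 1" and v: "minkowski v y = 0"
  shows "minkowski v v \<ge> 0" and "minkowski v v = 0 \<Longrightarrow> v = 0"
proof -
  define p q where "p = (v$1)\<^sup>2 + (v$2)\<^sup>2" and "q = (y$1)\<^sup>2 + (y$2)\<^sup>2"
  have y3: "(y$3)\<^sup>2 = q + 1" using y by (simp add: minkowski_def q_def power2_eq_square)
  have v3: "v$3 * y$3 = v$1 * y$1 + v$2 * y$2" using v by (simp add: minkowski_def)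
  have "(v$1 * y$1 + v$2 * y$2)\<^sup>2 + (v$1 * y$2 - v$2 * y$1)\<^sup>2 = p * q"
    unfolding p_def q_def by algebra
  then have le: "(v$3)\<^sup>2 * (q + 1) \<le> p * q"
    by (metis y3 v3 power_mult_distrib le_add_same_cancel1 zero_le_power2)
  have p0: "p \<ge> 0" and q0: "q \<ge> 0" by (simp_all add: p_def q_def)
  have mv: "minkowski v v = p - (v$3)\<^sup>2" by (simp add: minkowski_def p_def power2_eq_square)
  have *: "minkowski v v * (q + 1) \<ge> p" using le by (simp add: mv algebra_simps)
  then show "minkowski v v \<ge> 0"
    using p0 q0 by (smt (verit) mult_neg_pos)
  assume 0: "minkowski v v = 0"
  with * p0 have "p = 0" by simp
  moreover from this 0 mv have "v$3 = 0" by simp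
  ultimately show "v = 0"
    by (simp add: p_def vec_eq_iff forall_3 sum_power2_eq_zero_iff)
qed

lemma minkowski_Cauchy_Schwarz:
  assumes y: "minkowski y y = - 1" and u: "minkowski u y = 0" and w: "minkowski w y = 0"
  shows "\<bar>minkowski u w\<bar> \<le> sqrt (minkowski u u) * sqrt (minkowski w w)"
proof (cases "minkowski w w = 0")
  case True
  then have "w = 0" using spacelike[OF y w] by simp
  then show ?thesis by (simp add: minkowski_def)
next
  case False
  then have pos: "minkowski w w > 0" using spacelike(1)[OF y w] by simp
  define v where "v = minkowski w w *\<^sub>R u + (- minkowski u w) *\<^sub>R w"
  have "minkowski v y = 0" by (simp only: v_def minkowski_linear u w)
  then have "minkowski v v \<ge> 0" by (rule spacelike(1)[OF y])
  moreover have "minkowski v v = minkowski w w * (minkowski u u * minkowski w w - (minkowski u w)\<^sup>2)"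
    unfolding v_def minkowski_linear
    by (simp add: minkowski_commute[of w u] power2_eq_square algebra_simps)
  ultimately have "(minkowski u w)\<^sup>2 \<le> minkowski u u * minkowski w w"
    using pos by (simp add: zero_le_mult_iff)
  then show ?thesis
    by (metis real_sqrt_abs real_sqrt_le_mono real_sqrt_mult)
qed

lemma hyperboloid_product:
  assumes x: "minkowski x x = - 1" "x$3 > 0" and y: "minkowski y y = - 1" "y$3 > 0"
  shows "- minkowski x y \<ge> 1" and "minkowski x y = - 1 \<Longrightarrow> x = y"
proof -
  define u where "u = 1 *\<^sub>R x + minkowski x y *\<^sub>R y"
  have uy: "minkowski u y = 0" by (simp only: u_def minkowski_linear y)
  have uu: "minkowski u u = (minkowski x y)\<^sup>2 - 1"
    unfolding u_def minkowski_linear x(1) y(1) minkowski_commute[of y x] by algebra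
  have "(x$3 * y$3)\<^sup>2 > (x$1 * y$1 + x$2 * y$2)\<^sup>2"
  proof -
    define p q where "p = (x$1)\<^sup>2 + (x$2)\<^sup>2" and "q = (y$1)\<^sup>2 + (y$2)\<^sup>2"
    have "(x$1 * y$1 + x$2 * y$2)\<^sup>2 + (x$1 * y$2 - x$2 * y$1)\<^sup>2 = p * q"
      unfolding p_def q_def by algebra
    moreover have "(x$3)\<^sup>2 = p + 1" "(y$3)\<^sup>2 = q + 1"
      using x y by (simp_all add: minkowski_def p_def q_def power2_eq_square)
    then have "(x$3 * y$3)\<^sup>2 = p * q + p + q + 1"
      by (simp add: power_mult_distrib algebra_simps)
    moreover have "p \<ge> 0" "q \<ge> 0" by (simp_all add: p_def q_def)
    ultimately show ?thesis by (smt (verit) zero_le_power2)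
  qed
  then have "\<bar>x$1 * y$1 + x$2 * y$2\<bar> < \<bar>x$3 * y$3\<bar>"
    by (metis abs_le_square_iff linorder_not_le)
  then have neg: "minkowski x y < 0"
    using x(2) y(2) by (simp add: minkowski_def)
  have "(- minkowski x y)\<^sup>2 \<ge> 1\<^sup>2" using spacelike(1)[OF y(1) uy] uu by simp
  then show "- minkowski x y \<ge> 1"
    using neg by (smt (verit) power2_le_imp_le)
  assume "minkowski x y = - 1"
  then have "u = 0" using spacelike(2)[OF y(1) uy] uu by simp
  then show "x = y" using \<open>minkowski x y = - 1\<close> by (simp add: u_def)
qed

lemma sphere_triangle:
  fixes x y z :: "'v::real_inner"
  assumes "x \<bullet> x = 1" "y \<bullet> y = 1" "z \<bullet> z = 1"
  shows "arccos (x \<bullet> z) \<le> arccos (x \<bullet> y) + arccos (y \<bullet> z)"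
proof -
  have n: "norm x = 1" "norm y = 1" "norm z = 1"
    using assms by (simp_all add: norm_eq_sqrt_inner)
  have b: "\<bar>x \<bullet> y\<bar> \<le> 1" "\<bar>y \<bullet> z\<bar> \<le> 1" "\<bar>x \<bullet> z\<bar> \<le> 1"
    using Cauchy_Schwarz_ineq2 n by (metis mult_1)+
  define a c where "a = x \<bullet> y" and "c = y \<bullet> z"
  define u w where "u = x - a *\<^sub>R y" and "w = z - c *\<^sub>R y"
  have "u \<bullet> w = x \<bullet> z - a * c" "u \<bullet> u = 1 - a\<^sup>2" "w \<bullet> w = 1 - c\<^sup>2"
    using assms unfolding u_def w_def a_def c_def
    by (simp_all add: inner_diff_left inner_diff_right inner_commute power2_eq_square algebra_simps)
  then have "a * c - sqrt (1 - a\<^sup>2) * sqrt (1 - c\<^sup>2) \<le> x \<bullet> z"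
    using Cauchy_Schwarz_ineq2[of u w] by (simp add: norm_eq_sqrt_inner abs_le_iff)
  moreover have "cos (arccos a + arccos c) = a * c - sqrt (1 - a\<^sup>2) * sqrt (1 - c\<^sup>2)"
    using b by (simp add: cos_add a_def c_def sin_arccos_abs abs_le_iff)
  ultimately have cos: "cos (arccos a + arccos c) \<le> cos (arccos (x \<bullet> z))"
    using b by (simp add: abs_le_iff)
  show ?thesis
  proof (cases "arccos a + arccos c \<le> pi")
    case True
    have "0 \<le> arccos a" "0 \<le> arccos c" "0 \<le> arccos (x \<bullet> z)" "arccos (x \<bullet> z) \<le> pi"
      using b by (simp_all add: arccos_lbound arccos_ubound a_def c_def abs_le_iff)
    with cos True show ?thesis
      using cos_mono_le_eq[of "arccos a + arccos c" "arccos (x \<bullet> z)"] by (simp add: a_def c_def)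
  next
    case False
    then show ?thesis using b arccos_ubound[of "x \<bullet> z"] by (simp add: a_def c_def abs_le_iff)
  qed
qed

lemma hyperboloid_triangle:
  assumes x: "minkowski x x = - 1" "x$3 > 0" and y: "minkowski y y = - 1" "y$3 > 0"
    and z: "minkowski z z = - 1" "z$3 > 0"
  shows "arcosh (- minkowski x z) \<le> arcosh (- minkowski x y) + arcosh (- minkowski y z)"
proof -
  define a b where "a = - minkowski x y" and "b = - minkowski y z"
  have a: "a \<ge> 1" and b: "b \<ge> 1" and xz: "- minkowski x z \<ge> 1"
    using hyperboloid_product(1) x y z by (auto simp: a_def b_def)
  define u w where "u = 1 *\<^sub>R x + (- a) *\<^sub>R y" and "w = 1 *\<^sub>R z + (- b) *\<^sub>R y"
  have yz: "minkowski z y = - b" and xy: "minkowski x y = - a" "minkowski y x = - a"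
    and zy: "minkowski y z = - b"
    using minkowski_commute by (simp_all add: a_def b_def)
  have u: "minkowski u y = 0" and w: "minkowski w y = 0"
    by (simp_all only: u_def w_def minkowski_linear y xy yz)
  have "minkowski u u = a\<^sup>2 - 1" "minkowski w w = b\<^sup>2 - 1" "minkowski u w = minkowski x z + a * b"
    unfolding u_def w_def minkowski_linear x(1) y(1) z(1) xy yz zy by algebra+
  then have le: "- minkowski x z \<le> a * b + sqrt (a\<^sup>2 - 1) * sqrt (b\<^sup>2 - 1)"
    using minkowski_Cauchy_Schwarz[OF y(1) u w] by (simp add: abs_le_iff)
  have "cosh (arcosh a + arcosh b) = a * b + sqrt (a\<^sup>2 - 1) * sqrt (b\<^sup>2 - 1)"
    using a b by (simp add: cosh_add sinh_arcosh_real)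
  with le have "cosh (arcosh (- minkowski x z)) \<le> cosh (arcosh a + arcosh b)"
    using xz by simp
  then show ?thesis
    using a b xz cosh_real_nonneg_le_iff[of "arcosh (- minkowski x z)" "arcosh a + arcosh b"]
    by (simp add: arcosh_nonneg_real a_def b_def)
qed

lemma Metric_space_model: "Metric_space (model_points \<kappa>) (model_dist \<kappa>)"
proof -
  consider "\<kappa> > 0" | "\<kappa> = 0" | "\<kappa> < 0" by linarith
  then show ?thesis
  proof cases
    case 1
    have b: "\<bar>x \<bullet> y\<bar> \<le> 1" if "x \<bullet> x = 1" "y \<bullet> y = 1" for x y :: "real^3"
      using Cauchy_Schwarz_ineq2[of x y] that by (simp add: norm_eq_sqrt_inner)
    have z: "arccos (x \<bullet> y) = 0 \<longleftrightarrow> x = y" if "x \<bullet> x = 1" "y \<bullet> y = 1" for x y :: "real^3"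
    proof
      assume "arccos (x \<bullet> y) = 0"
      then have "x \<bullet> y = 1" using b[OF that] by (metis cos_arccos_abs cos_zero)
      then have "(x - y) \<bullet> (x - y) = 0"
        using that by (simp add: inner_diff_left inner_diff_right inner_commute)
      then show "x = y" by simp
    qed (use that in simp)
    show ?thesis
    proof
      fix x y z :: "real^3"
      show "model_dist \<kappa> x y \<ge> 0"
        using 1 b by (auto simp: model_dist_def model_points_def abs_le_iff
            intro!: divide_nonneg_nonneg arccos_lbound)
      show "model_dist \<kappa> x y = model_dist \<kappa> y x"
        by (simp add: model_dist_def inner_commute minkowski_commute dist_commute)
      show "model_dist \<kappa> x y = 0 \<longleftrightarrow> x = y"
        if "x \<in> model_points \<kappa>" "y \<in> model_points \<kappa>"
        using that 1 z by (simp add: model_dist_def model_points_def)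
      show "model_dist \<kappa> x z \<le> model_dist \<kappa> x y + model_dist \<kappa> y z"
        if "x \<in> model_points \<kappa>" "y \<in> model_points \<kappa>" "z \<in> model_points \<kappa>"
        using that 1 sphere_triangle[of x y z]
        by (simp add: model_dist_def model_points_def add_divide_distrib[symmetric] divide_right_mono)
    qed
  next
    case 2
    show ?thesis
      by standard (auto simp: 2 model_dist_def model_points_def dist_commute dist_triangle)
  next
    case 3
    have z: "arcosh (- minkowski x y) = 0 \<longleftrightarrow> x = y"
      if "minkowski x x = - 1" "x$3 > 0" "minkowski y y = - 1" "y$3 > 0" for x y
    proof
      assume "arcosh (- minkowski x y) = 0"
      then have "- minkowski x y = 1"
        using hyperboloid_product(1)[OF that] by (metis cosh_arcosh_real cosh_0)
      then show "x = y" using hyperboloid_product(2)[OF that] by simp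
    qed (use that in simp)
    show ?thesis
    proof
      fix x y z :: "real^3"
      show "model_dist \<kappa> x y \<ge> 0"
        using 3 hyperboloid_product(1) by (auto simp: model_dist_def model_points_def
            intro!: divide_nonneg_nonneg arcosh_nonneg_real)
      show "model_dist \<kappa> x y = model_dist \<kappa> y x"
        by (simp add: model_dist_def inner_commute minkowski_commute dist_commute)
      show "model_dist \<kappa> x y = 0 \<longleftrightarrow> x = y"
        if "x \<in> model_points \<kappa>" "y \<in> model_points \<kappa>"
        using that 3 z by (simp add: model_dist_def model_points_def)
      show "model_dist \<kappa> x z \<le> model_dist \<kappa> x y + model_dist \<kappa> y z"
        if "x \<in> model_points \<kappa>" "y \<in> model_points \<kappa>" "z \<in> model_points \<kappa>"
        using that 3 hyperboloid_triangle[of x y z]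
        by (simp add: model_dist_def model_points_def add_divide_distrib[symmetric] divide_right_mono
            del: minus_divide_left)
    qed
  qed
qed

lemma mspace_model_surface [simp]: "mspace (model_surface \<kappa>) = model_points \<kappa>"
  and mdist_model_surface [simp]: "mdist (model_surface \<kappa>) = model_dist \<kappa>"
  by (simp_all add: model_surface_def Metric_space.mspace_metric Metric_space.mdist_metric
      Metric_space_model)

section \<open>Upper curvature bounds\<close>

text \<open>
  A geodesic from \<open>x\<close> to \<open>y\<close>, parametrised on \<open>[0, d(x,y)]\<close>. The values outside this interval
  are pinned to \<open>undefined\<close>, so that equality of geodesics is equality of functions.
\<close>

definition geodesic :: "'a metric \<Rightarrow> 'a \<Rightarrow> 'a \<Rightarrow> (real \<Rightarrow> 'a) \<Rightarrow> bool" where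
  "geodesic X x y c \<longleftrightarrow>
     c \<in> {0..mdist X x y} \<rightarrow>\<^sub>E mspace X \<and>
     (\<forall>s\<in>{0..mdist X x y}. \<forall>t\<in>{0..mdist X x y}. mdist X (c s) (c t) = \<bar>s - t\<bar>) \<and>
     c 0 = x \<and> c (mdist X x y) = y"

text \<open>Vertices and sides are indexed by 0, 1, 2; side \<open>i\<close> runs from vertex \<open>i\<close> to the next one.\<close>

definition side_length :: "'a metric \<Rightarrow> (nat \<Rightarrow> 'a) \<Rightarrow> nat \<Rightarrow> real" where
  "side_length X v i = mdist X (v i) (v (Suc i mod 3))"

definition geodesic_triangle :: "'a metric \<Rightarrow> (nat \<Rightarrow> 'a) \<Rightarrow> (nat \<Rightarrow> real \<Rightarrow> 'a) \<Rightarrow> bool" where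
  "geodesic_triangle X v c \<longleftrightarrow> (\<forall>i<3. geodesic X (v i) (v (Suc i mod 3)) (c i))"

definition comparison_triangle ::
    "real \<Rightarrow> 'a metric \<Rightarrow> (nat \<Rightarrow> 'a) \<Rightarrow> (nat \<Rightarrow> real^3) \<Rightarrow> (nat \<Rightarrow> real \<Rightarrow> real^3) \<Rightarrow> bool" where
  "comparison_triangle \<kappa> X v v' c' \<longleftrightarrow>
     geodesic_triangle (model_surface \<kappa>) v' c' \<and>
     (\<forall>i<3. side_length (model_surface \<kappa>) v' i = side_length X v i)"

text \<open>
  Comparison triangles exist, and are unique up to isometry, when the perimeter is below twice
  \<open>model_diam \<kappa>\<close>. The CAT condition compares points on any two sides with the points at the same
  parameters on the corresponding sides. Completeness is not assumed.
\<close>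

definition CAT :: "real \<Rightarrow> 'a metric \<Rightarrow> bool" where
  "CAT \<kappa> X \<longleftrightarrow>
     (\<forall>x\<in>mspace X. \<forall>y\<in>mspace X. ereal (mdist X x y) < model_diam \<kappa> \<longrightarrow> (\<exists>c. geodesic X x y c)) \<and>
     (\<forall>v c v' c'. geodesic_triangle X v c \<and> ereal (\<Sum>i<3. side_length X v i) < 2 * model_diam \<kappa> \<and>
        comparison_triangle \<kappa> X v v' c' \<longrightarrow>
        (\<forall>i<3. \<forall>j<3. \<forall>s\<in>{0..side_length X v i}. \<forall>t\<in>{0..side_length X v j}.
           mdist X (c i s) (c j t) \<le> mdist (model_surface \<kappa>) (c' i s) (c' j t)))"

definition curvature_bounded_above :: "'a metric \<Rightarrow> bool" where
  "curvature_bounded_above X \<longleftrightarrow>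
     (\<forall>x\<in>mspace X. \<exists>\<kappa> U. x \<in> mtopology_of X interior_of U \<and> CAT \<kappa> (submetric X U))"

section \<open>Completion of a pseudometric\<close>

definition pseudometric_on :: "'a set \<Rightarrow> ('a \<Rightarrow> 'a \<Rightarrow> real) \<Rightarrow> bool" where
  "pseudometric_on A \<rho> \<longleftrightarrow>
     (\<forall>x\<in>A. \<rho> x x = 0) \<and> (\<forall>x\<in>A. \<forall>y\<in>A. 0 \<le> \<rho> x y \<and> \<rho> x y = \<rho> y x) \<and>
     (\<forall>x\<in>A. \<forall>y\<in>A. \<forall>z\<in>A. \<rho> x z \<le> \<rho> x y + \<rho> y z)"

definition Cauchy_seqs :: "'a set \<Rightarrow> ('a \<Rightarrow> 'a \<Rightarrow> real) \<Rightarrow> (nat \<Rightarrow> 'a) set" where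
  "Cauchy_seqs A \<rho> =
     {s. range s \<subseteq> A \<and> (\<forall>e>0. \<exists>N. \<forall>m\<ge>N. \<forall>n\<ge>N. \<rho> (s m) (s n) < e)}"

definition null_rel :: "'a set \<Rightarrow> ('a \<Rightarrow> 'a \<Rightarrow> real) \<Rightarrow> ((nat \<Rightarrow> 'a) \<times> (nat \<Rightarrow> 'a)) set" where
  "null_rel A \<rho> =
     {(s, t) \<in> Cauchy_seqs A \<rho> \<times> Cauchy_seqs A \<rho>. (\<lambda>n. \<rho> (s n) (t n)) \<longlonglongrightarrow> 0}"

definition completion_points :: "'a set \<Rightarrow> ('a \<Rightarrow> 'a \<Rightarrow> real) \<Rightarrow> (nat \<Rightarrow> 'a) set set" where
  "completion_points A \<rho> = Cauchy_seqs A \<rho> // null_rel A \<rho>"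

definition completion_dist ::
    "'a set \<Rightarrow> ('a \<Rightarrow> 'a \<Rightarrow> real) \<Rightarrow> (nat \<Rightarrow> 'a) set \<Rightarrow> (nat \<Rightarrow> 'a) set \<Rightarrow> real" where
  "completion_dist A \<rho> S T =
     (if S \<in> completion_points A \<rho> \<and> T \<in> completion_points A \<rho>
      then THE l. \<exists>s\<in>S. \<exists>t\<in>T. (\<lambda>n. \<rho> (s n) (t n)) \<longlonglongrightarrow> l else 0)"

text \<open>
  For a pseudometric this identifies points at distance 0 and completes: constant sequences at
  points of distance 0 are equivalent.
\<close>

definition Cauchy_completion :: "'a set \<Rightarrow> ('a \<Rightarrow> 'a \<Rightarrow> real) \<Rightarrow> (nat \<Rightarrow> 'a) set metric" where
  "Cauchy_completion A \<rho> = metric (completion_points A \<rho>, completion_dist A \<rho>)"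

context
  fixes A :: "'a set" and \<rho> :: "'a \<Rightarrow> 'a \<Rightarrow> real"
  assumes pm: "pseudometric_on A \<rho>"
begin

lemma pseudometric:
  "x \<in> A \<Longrightarrow> \<rho> x x = 0"
  "\<lbrakk>x \<in> A; y \<in> A\<rbrakk> \<Longrightarrow> 0 \<le> \<rho> x y"
  "\<lbrakk>x \<in> A; y \<in> A\<rbrakk> \<Longrightarrow> \<rho> x y = \<rho> y x"
  "\<lbrakk>x \<in> A; y \<in> A; z \<in> A\<rbrakk> \<Longrightarrow> \<rho> x z \<le> \<rho> x y + \<rho> y z"
  using pm unfolding pseudometric_on_def by meson+

lemma Cauchy_seqs_in: "s \<in> Cauchy_seqs A \<rho> \<Longrightarrow> s n \<in> A"
  by (auto simp: Cauchy_seqs_def)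

lemma Cauchy_seqsD:
  "\<lbrakk>s \<in> Cauchy_seqs A \<rho>; e > 0\<rbrakk> \<Longrightarrow> \<exists>N. \<forall>m\<ge>N. \<forall>n\<ge>N. \<rho> (s m) (s n) < e"
  by (simp add: Cauchy_seqs_def)

lemma Cauchy_seqs_dist_convergent:
  assumes s: "s \<in> Cauchy_seqs A \<rho>" and t: "t \<in> Cauchy_seqs A \<rho>"
  shows "convergent (\<lambda>n. \<rho> (s n) (t n))"
proof -
  have "Cauchy (\<lambda>n. \<rho> (s n) (t n))"
  proof (rule metric_CauchyI)
    fix e :: real assume "e > 0"
    then have e: "e / 2 > 0" by simp
    obtain N1 where N1: "\<And>m n. \<lbrakk>m \<ge> N1; n \<ge> N1\<rbrakk> \<Longrightarrow> \<rho> (s m) (s n) < e / 2"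
      using Cauchy_seqsD[OF s e] by blast
    obtain N2 where N2: "\<And>m n. \<lbrakk>m \<ge> N2; n \<ge> N2\<rbrakk> \<Longrightarrow> \<rho> (t m) (t n) < e / 2"
      using Cauchy_seqsD[OF t e] by blast
    have one: "\<rho> (s m) (t m) - \<rho> (s n) (t n) < e" if "m \<ge> max N1 N2" "n \<ge> max N1 N2" for m n
    proof -
      have "\<rho> (s m) (t m) \<le> \<rho> (s m) (s n) + \<rho> (s n) (t m)"
        "\<rho> (s n) (t m) \<le> \<rho> (s n) (t n) + \<rho> (t n) (t m)"
        by (rule pseudometric(4); rule Cauchy_seqs_in[OF s] Cauchy_seqs_in[OF t])+
      moreover have "\<rho> (s m) (s n) < e / 2" "\<rho> (t n) (t m) < e / 2"
        using N1[of m n] N2[of n m] that by simp_all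
      ultimately show ?thesis by linarith
    qed
    show "\<exists>M. \<forall>m\<ge>M. \<forall>n\<ge>M. dist (\<rho> (s m) (t m)) (\<rho> (s n) (t n)) < e"
    proof (intro exI[of _ "max N1 N2"] allI impI)
      fix m n assume mn: "m \<ge> max N1 N2" "n \<ge> max N1 N2"
      show "dist (\<rho> (s m) (t m)) (\<rho> (s n) (t n)) < e"
        using one[OF mn] one[OF mn(2,1)] unfolding dist_real_def by linarith
    qed
  qed
  then show ?thesis by (simp add: Cauchy_convergent_iff)
qed

lemma equiv_null_rel: "equiv (Cauchy_seqs A \<rho>) (null_rel A \<rho>)"
proof (rule equivI)
  show "null_rel A \<rho> \<subseteq> Cauchy_seqs A \<rho> \<times> Cauchy_seqs A \<rho>"
    by (auto simp: null_rel_def)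
  show "refl_on (Cauchy_seqs A \<rho>) (null_rel A \<rho>)"
    by (auto simp: refl_on_def null_rel_def pseudometric(1)[OF Cauchy_seqs_in])
  show "sym (null_rel A \<rho>)"
  proof (rule symI)
    fix s t assume "(s, t) \<in> null_rel A \<rho>"
    then have st: "s \<in> Cauchy_seqs A \<rho>" "t \<in> Cauchy_seqs A \<rho>" "(\<lambda>n. \<rho> (s n) (t n)) \<longlonglongrightarrow> 0"
      by (auto simp: null_rel_def)
    moreover have "(\<lambda>n. \<rho> (t n) (s n)) = (\<lambda>n. \<rho> (s n) (t n))"
      using pseudometric(3)[OF Cauchy_seqs_in[OF st(2)] Cauchy_seqs_in[OF st(1)]] by blast
    ultimately show "(t, s) \<in> null_rel A \<rho>" by (simp add: null_rel_def)
  qed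
  show "trans (null_rel A \<rho>)"
  proof (rule transI)
    fix s t u assume "(s, t) \<in> null_rel A \<rho>" "(t, u) \<in> null_rel A \<rho>"
    then have C: "s \<in> Cauchy_seqs A \<rho>" "t \<in> Cauchy_seqs A \<rho>" "u \<in> Cauchy_seqs A \<rho>"
      and lim: "(\<lambda>n. \<rho> (s n) (t n)) \<longlonglongrightarrow> 0" "(\<lambda>n. \<rho> (t n) (u n)) \<longlonglongrightarrow> 0"
      by (auto simp: null_rel_def)
    have "(\<lambda>n. \<rho> (s n) (t n) + \<rho> (t n) (u n)) \<longlonglongrightarrow> 0"
      using tendsto_add[OF lim] by simp
    moreover have "0 \<le> \<rho> (s n) (u n)" "\<rho> (s n) (u n) \<le> \<rho> (s n) (t n) + \<rho> (t n) (u n)" for n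
      using C by (simp_all add: Cauchy_seqs_in pseudometric(2,4))
    ultimately have "(\<lambda>n. \<rho> (s n) (u n)) \<longlonglongrightarrow> 0"
      using tendsto_sandwich[of "\<lambda>_. 0" "\<lambda>n. \<rho> (s n) (u n)" sequentially
          "\<lambda>n. \<rho> (s n) (t n) + \<rho> (t n) (u n)" 0] by simp
    with C show "(s, u) \<in> null_rel A \<rho>" by (simp add: null_rel_def)
  qed
qed

lemma completion_points_nonempty: "S \<in> completion_points A \<rho> \<Longrightarrow> \<exists>s. s \<in> S"
  unfolding completion_points_def by (metis equiv_null_rel in_quotient_imp_non_empty ex_in_conv)

lemma completion_points_Cauchy:
  "\<lbrakk>S \<in> completion_points A \<rho>; s \<in> S\<rbrakk> \<Longrightarrow> s \<in> Cauchy_seqs A \<rho>"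
  unfolding completion_points_def by (meson equiv_null_rel in_quotient_imp_subset subsetD)

lemma completion_points_null:
  "\<lbrakk>S \<in> completion_points A \<rho>; s \<in> S; s' \<in> S\<rbrakk> \<Longrightarrow> (\<lambda>n. \<rho> (s n) (s' n)) \<longlonglongrightarrow> 0"
  using quotient_eq_iff[OF equiv_null_rel, of S S s s']
  by (auto simp: completion_points_def null_rel_def)

lemma completion_dist_eqI:
  assumes S: "S \<in> completion_points A \<rho>" "s \<in> S" and T: "T \<in> completion_points A \<rho>" "t \<in> T"
    and l: "(\<lambda>n. \<rho> (s n) (t n)) \<longlonglongrightarrow> l"
  shows "completion_dist A \<rho> S T = l"
proof -
  have "(\<lambda>n. \<rho> (s' n) (t' n)) \<longlonglongrightarrow> l" if s': "s' \<in> S" and t': "t' \<in> T" for s' t'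
  proof -
    have in_A: "s n \<in> A" "t n \<in> A" "s' n \<in> A" "t' n \<in> A" for n
      by (rule Cauchy_seqs_in[OF completion_points_Cauchy], fact, fact)+
    have lim: "(\<lambda>n. \<rho> (s n) (s' n) + \<rho> (t n) (t' n)) \<longlonglongrightarrow> 0"
      using tendsto_add[OF completion_points_null[OF S s'] completion_points_null[OF T t']] by simp
    have "norm (\<rho> (s' n) (t' n) - \<rho> (s n) (t n)) \<le> \<rho> (s n) (s' n) + \<rho> (t n) (t' n)" for n
      using pseudometric(4)[of "s' n" "s n" "t' n"] pseudometric(4)[of "s n" "t n" "t' n"]
        pseudometric(4)[of "s n" "s' n" "t n"] pseudometric(4)[of "s' n" "t' n" "t n"]
        pseudometric(3)[of "s' n" "s n"] pseudometric(3)[of "t' n" "t n"] in_A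
      by (simp add: abs_le_iff)
    then have "(\<lambda>n. \<rho> (s' n) (t' n) - \<rho> (s n) (t n)) \<longlonglongrightarrow> 0"
      by (intro Lim_null_comparison[OF _ lim] always_eventually allI)
    from tendsto_add[OF this l] show ?thesis by simp
  qed
  then have "(THE l. \<exists>s\<in>S. \<exists>t\<in>T. (\<lambda>n. \<rho> (s n) (t n)) \<longlonglongrightarrow> l) = l"
    using S T l by (intro the_equality) (auto intro: LIMSEQ_unique)
  then show ?thesis using S T by (simp add: completion_dist_def)
qed

lemma completion_dist_tendsto:
  assumes S: "S \<in> completion_points A \<rho>" "s \<in> S" and T: "T \<in> completion_points A \<rho>" "t \<in> T"
  shows "(\<lambda>n. \<rho> (s n) (t n)) \<longlonglongrightarrow> completion_dist A \<rho> S T"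
proof -
  have "convergent (\<lambda>n. \<rho> (s n) (t n))"
    using S T completion_points_Cauchy Cauchy_seqs_dist_convergent by blast
  then obtain l where l: "(\<lambda>n. \<rho> (s n) (t n)) \<longlonglongrightarrow> l" by (auto simp: convergent_def)
  show ?thesis unfolding completion_dist_eqI[OF S T l] by (rule l)
qed

lemma Metric_space_completion: "Metric_space (completion_points A \<rho>) (completion_dist A \<rho>)"
proof
  let ?P = "completion_points A \<rho>" and ?D = "completion_dist A \<rho>"
  have in_A: "s n \<in> A" if "S \<in> ?P" "s \<in> S" for S s n
    by (rule Cauchy_seqs_in[OF completion_points_Cauchy[OF that]])
  fix S T U
  show "0 \<le> ?D S T"
  proof (cases "S \<in> ?P \<and> T \<in> ?P")
    case True
    then obtain s t where st: "s \<in> S" "t \<in> T" using completion_points_nonempty by blast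
    have "0 \<le> \<rho> (s n) (t n)" for n
      using in_A[of S s n] in_A[of T t n] True st pseudometric(2) by simp
    then show ?thesis
      using completion_dist_tendsto[of S s T t] True st LIMSEQ_le_const[of "\<lambda>n. \<rho> (s n) (t n)"]
      by simp
  qed (auto simp: completion_dist_def)
  show "?D S T = ?D T S"
  proof (cases "S \<in> ?P \<and> T \<in> ?P")
    case True
    then obtain s t where st: "s \<in> S" "t \<in> T" using completion_points_nonempty by blast
    have "\<rho> (s n) (t n) = \<rho> (t n) (s n)" for n
      using in_A[of S s n] in_A[of T t n] True st pseudometric(3) by simp
    then show ?thesis
      using completion_dist_tendsto[of S s T t] completion_dist_eqI[of T t S s] True st by simp
  qed (auto simp: completion_dist_def)
  show "?D S T = 0 \<longleftrightarrow> S = T" if ST: "S \<in> ?P" "T \<in> ?P"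
  proof -
    obtain s t where st: "s \<in> S" "t \<in> T" using completion_points_nonempty ST by blast
    have C: "s \<in> Cauchy_seqs A \<rho>" "t \<in> Cauchy_seqs A \<rho>"
      using ST st completion_points_Cauchy by blast+
    have "?D S T = 0 \<longleftrightarrow> (\<lambda>n. \<rho> (s n) (t n)) \<longlonglongrightarrow> 0"
      using completion_dist_tendsto[OF ST(1) st(1) ST(2) st(2)] by (auto intro: LIMSEQ_unique)
    also have "\<dots> \<longleftrightarrow> (s, t) \<in> null_rel A \<rho>" using C by (simp add: null_rel_def)
    also have "\<dots> \<longleftrightarrow> S = T"
      using quotient_eq_iff[OF equiv_null_rel] ST st by (auto simp: completion_points_def)
    finally show ?thesis .
  qed
  show "?D S U \<le> ?D S T + ?D T U" if P: "S \<in> ?P" "T \<in> ?P" "U \<in> ?P"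
  proof -
    obtain s t u where stu: "s \<in> S" "t \<in> T" "u \<in> U" using completion_points_nonempty P by metis
    have le: "\<rho> (s n) (u n) \<le> \<rho> (s n) (t n) + \<rho> (t n) (u n)" for n
      using in_A[OF P(1) stu(1)] in_A[OF P(2) stu(2)] in_A[OF P(3) stu(3)] pseudometric(4) by simp
    show ?thesis
      by (rule LIMSEQ_le[OF completion_dist_tendsto[OF P(1) stu(1) P(3) stu(3)]
            tendsto_add[OF completion_dist_tendsto[OF P(1) stu(1) P(2) stu(2)]
              completion_dist_tendsto[OF P(2) stu(2) P(3) stu(3)]]])
        (use le in blast)
  qed
qed

lemma mspace_Cauchy_completion: "mspace (Cauchy_completion A \<rho>) = completion_points A \<rho>"
  and mdist_Cauchy_completion: "mdist (Cauchy_completion A \<rho>) = completion_dist A \<rho>"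
  unfolding Cauchy_completion_def
  by (rule Metric_space.mspace_metric[OF Metric_space_completion]
      Metric_space.mdist_metric[OF Metric_space_completion])+

definition completion_embed :: "'a \<Rightarrow> (nat \<Rightarrow> 'a) set" where
  "completion_embed a = null_rel A \<rho> `` {\<lambda>_. a}"

lemma const_Cauchy_seqs: "a \<in> A \<Longrightarrow> (\<lambda>_. a) \<in> Cauchy_seqs A \<rho>"
  by (auto simp: Cauchy_seqs_def pseudometric(1))

lemma class_in_completion:
  assumes "s \<in> Cauchy_seqs A \<rho>"
  shows "null_rel A \<rho> `` {s} \<in> completion_points A \<rho>" "s \<in> null_rel A \<rho> `` {s}"
  unfolding completion_points_def
  by (rule quotientI[OF assms], rule equiv_class_self[OF equiv_null_rel assms])

lemma completion_embed_in: "a \<in> A \<Longrightarrow> completion_embed a \<in> mspace (Cauchy_completion A \<rho>)"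
  unfolding completion_embed_def mspace_Cauchy_completion
  by (rule class_in_completion(1)[OF const_Cauchy_seqs])

lemma mdist_completion_embed:
  "\<lbrakk>a \<in> A; b \<in> A\<rbrakk> \<Longrightarrow> mdist (Cauchy_completion A \<rho>) (completion_embed a) (completion_embed b) = \<rho> a b"
  unfolding mdist_Cauchy_completion completion_embed_def
  by (rule completion_dist_eqI[OF class_in_completion class_in_completion tendsto_const];
      rule const_Cauchy_seqs)

lemma completion_embed_tendsto:
  assumes s: "s \<in> Cauchy_seqs A \<rho>" and e: "e > 0"
  shows "\<exists>N. \<forall>n\<ge>N. mdist (Cauchy_completion A \<rho>) (completion_embed (s n)) (null_rel A \<rho> `` {s}) < e"
proof -
  have e2: "e / 2 > 0" using e by simp
  obtain N where N: "\<And>m n. \<lbrakk>m \<ge> N; n \<ge> N\<rbrakk> \<Longrightarrow> \<rho> (s m) (s n) < e / 2"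
    using Cauchy_seqsD[OF s e2] by blast
  have "mdist (Cauchy_completion A \<rho>) (completion_embed (s n)) (null_rel A \<rho> `` {s}) < e" if "n \<ge> N" for n
  proof -
    have c: "(\<lambda>_. s n) \<in> Cauchy_seqs A \<rho>" by (rule const_Cauchy_seqs[OF Cauchy_seqs_in[OF s]])
    have "(\<lambda>m. \<rho> (s n) (s m)) \<longlonglongrightarrow>
        mdist (Cauchy_completion A \<rho>) (completion_embed (s n)) (null_rel A \<rho> `` {s})"
      unfolding mdist_Cauchy_completion completion_embed_def
      by (rule completion_dist_tendsto[OF class_in_completion(1)[OF c] class_in_completion(2)[OF c]
            class_in_completion(1)[OF s] class_in_completion(2)[OF s]])
    then have "mdist (Cauchy_completion A \<rho>) (completion_embed (s n)) (null_rel A \<rho> `` {s}) \<le> e / 2"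
    proof (rule LIMSEQ_le_const2, intro exI[of _ N] allI impI)
      fix m assume "m \<ge> N"
      with N[OF that, of m] show "\<rho> (s n) (s m) \<le> e / 2" by simp
    qed
    then show ?thesis using e by simp
  qed
  then show ?thesis by blast
qed

lemma completion_embed_dense:
  assumes S: "S \<in> mspace (Cauchy_completion A \<rho>)" and e: "e > 0"
  shows "\<exists>a\<in>A. mdist (Cauchy_completion A \<rho>) (completion_embed a) S < e"
proof -
  obtain s where s: "s \<in> Cauchy_seqs A \<rho>" "S = null_rel A \<rho> `` {s}"
    using S unfolding mspace_Cauchy_completion completion_points_def by (rule quotientE)
  obtain N where "mdist (Cauchy_completion A \<rho>) (completion_embed (s N)) S < e"
    using completion_embed_tendsto[OF s(1) e] unfolding s(2) by blast
  then show ?thesis using Cauchy_seqs_in[OF s(1), of N] by (rule bexI)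
qed

lemma mcomplete_of_Cauchy_completion: "mcomplete_of (Cauchy_completion A \<rho>)"
proof -
  let ?K = "Cauchy_completion A \<rho>"
  interpret K: Metric_space "mspace ?K" "mdist ?K" by simp
  have "\<exists>S. limitin K.mtopology \<sigma> S sequentially" if \<sigma>: "K.MCauchy \<sigma>" for \<sigma>
  proof -
    have \<sigma>K: "\<sigma> n \<in> mspace ?K" for n using \<sigma> by (auto simp: K.MCauchy_def)
    have "\<exists>a\<in>A. mdist ?K (completion_embed a) (\<sigma> n) < inverse (Suc n)" for n
      by (rule completion_embed_dense[OF \<sigma>K]) simp
    then obtain a where a: "\<And>n. a n \<in> A"
      "\<And>n. mdist ?K (completion_embed (a n)) (\<sigma> n) < inverse (Suc n)" by metis
    have aK: "completion_embed (a n) \<in> mspace ?K" for n by (rule completion_embed_in[OF a(1)])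
    have small: "\<exists>N. \<forall>n\<ge>N. mdist ?K (completion_embed (a n)) (\<sigma> n) < e" if e: "e > 0" for e
    proof -
      obtain N where N: "inverse (real (Suc N)) < e" using reals_Archimedean[OF e] by blast
      have "mdist ?K (completion_embed (a n)) (\<sigma> n) < e" if "n \<ge> N" for n
      proof -
        have "inverse (real (Suc n)) \<le> inverse (real (Suc N))"
          using that by (intro le_imp_inverse_le) auto
        then show ?thesis using a(2)[of n] N by linarith
      qed
      then show ?thesis by blast
    qed
    have "a \<in> Cauchy_seqs A \<rho>"
    proof -
      have "\<exists>N. \<forall>m\<ge>N. \<forall>n\<ge>N. \<rho> (a m) (a n) < e" if "e > 0" for e
      proof -
        have e3: "e / 3 > 0" using that by simp
        obtain N1 where N1: "\<And>n. n \<ge> N1 \<Longrightarrow> mdist ?K (completion_embed (a n)) (\<sigma> n) < e / 3"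
          using small[OF e3] by blast
        obtain N2 where N2: "\<And>m n. \<lbrakk>m \<ge> N2; n \<ge> N2\<rbrakk> \<Longrightarrow> mdist ?K (\<sigma> m) (\<sigma> n) < e / 3"
          using \<sigma> e3 unfolding K.MCauchy_def by meson
        have "\<rho> (a m) (a n) < e" if "m \<ge> max N1 N2" "n \<ge> max N1 N2" for m n
        proof -
          have "\<rho> (a m) (a n) = mdist ?K (completion_embed (a m)) (completion_embed (a n))"
            by (rule mdist_completion_embed[OF a(1) a(1), symmetric])
          also have "\<dots> \<le> mdist ?K (completion_embed (a m)) (\<sigma> m) + mdist ?K (\<sigma> m) (\<sigma> n)
              + mdist ?K (completion_embed (a n)) (\<sigma> n)"
            using K.triangle[OF aK[of m] \<sigma>K[of m] aK[of n]]
              K.triangle[OF \<sigma>K[of m] \<sigma>K[of n] aK[of n]]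
              K.commute[of "\<sigma> n" "completion_embed (a n)"] by linarith
          also have "\<dots> < e" using N1[of m] N1[of n] N2[of m n] that by simp
          finally show ?thesis .
        qed
        then show ?thesis by blast
      qed
      moreover have "range a \<subseteq> A" using a(1) by (rule image_subsetI)
      ultimately show ?thesis by (simp add: Cauchy_seqs_def)
    qed
    define S where "S = null_rel A \<rho> `` {a}"
    have SK: "S \<in> mspace ?K"
      using class_in_completion(1)[OF \<open>a \<in> Cauchy_seqs A \<rho>\<close>] by (simp add: S_def mspace_Cauchy_completion)
    have "\<exists>N. \<forall>n\<ge>N. \<sigma> n \<in> mspace ?K \<and> mdist ?K (\<sigma> n) S < e" if "e > 0" for e
    proof -
      have e2: "e / 2 > 0" using that by simp
      obtain N1 where N1: "\<And>n. n \<ge> N1 \<Longrightarrow> mdist ?K (completion_embed (a n)) (\<sigma> n) < e / 2"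
        using small[OF e2] by blast
      obtain N2 where N2: "\<And>n. n \<ge> N2 \<Longrightarrow> mdist ?K (completion_embed (a n)) S < e / 2"
        using completion_embed_tendsto[OF \<open>a \<in> Cauchy_seqs A \<rho>\<close> e2] unfolding S_def by blast
      have "mdist ?K (\<sigma> n) S < e" if "n \<ge> max N1 N2" for n
        using K.triangle[OF \<sigma>K[of n] aK[of n] SK] K.commute[of "\<sigma> n" "completion_embed (a n)"]
          N1[of n] N2[of n] that by simp
      then show ?thesis using \<sigma>K by blast
    qed
    then have "limitin K.mtopology \<sigma> S sequentially"
      using SK by (simp add: K.limitin_metric eventually_sequentially)
    then show ?thesis by blast
  qed
  then show ?thesis by (auto simp: mcomplete_of_def K.mcomplete_def)
qed

end

section \<open>The space of directions\<close>

definition alexandrov_angle :: "'a metric \<Rightarrow> (real \<Rightarrow> 'a) \<Rightarrow> (real \<Rightarrow> 'a) \<Rightarrow> real" where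
  "alexandrov_angle X c c' = 2 * Lim (at_right 0) (\<lambda>s. arcsin (mdist X (c s) (c' s) / (2 * s)))"

text \<open>
  A geodesic of \<open>X\<close> from \<open>p\<close> to a point of a ball around \<open>p\<close> stays in that ball; so below it
  makes no difference whether geodesics from \<open>p\<close> are taken in \<open>X\<close> or in the ball.
\<close>

definition direction_radius :: "'a metric \<Rightarrow> 'a \<Rightarrow> real \<Rightarrow> bool" where
  "direction_radius X p r \<longleftrightarrow>
     r > 0 \<and> (\<exists>\<kappa>. CAT \<kappa> (submetric X (mball_of X p r))) \<and>
     (\<forall>x\<in>mball_of X p r - {p}. \<exists>!c. geodesic X p x c)"

definition angle_at :: "'a metric \<Rightarrow> 'a \<Rightarrow> 'a \<Rightarrow> 'a \<Rightarrow> real" where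
  "angle_at X p u v = alexandrov_angle X (THE c. geodesic X p u c) (THE c. geodesic X p v c)"

text \<open>
  The result does not depend, up to isometry, on the ball; we choose one. Under an upper
  curvature bound, all sufficiently small radii are eligible.
\<close>

definition space_of_directions :: "'a metric \<Rightarrow> 'a \<Rightarrow> (nat \<Rightarrow> 'a) set metric" where
  "space_of_directions X p =
     Cauchy_completion (mball_of X p (SOME r. direction_radius X p r) - {p}) (angle_at X p)"

end

theory Submission
  imports Defs
begin

text \<open>
  Let \<open>B\<close> be a small ball around \<open>p\<close>. Sending a point \<open>u \<noteq> p\<close> of \<open>B\<close> to the direction \<open>\<rho>(u)\<close> of
  the geodesic from \<open>p\<close> to \<open>u\<close> is a continuous map \<open>\<rho>\<close> into the space of directions \<open>\<Sigma>\<close> with dense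
  image. The theorem says that \<open>\<rho>\<close> is a homotopy equivalence. Everything rests on an approximate
  inverse (\<open>angle_approximation\<close>): there is a continuous map \<open>G\<close> from \<open>\<Sigma> \<times> [0, 1)\<close> to
  \<open>B - {p}\<close> such that the direction of \<open>G(S, t)\<close> has distance at most \<open>1 - t\<close> from \<open>S\<close>. Put
  \<open>g(S) = G(S, 0)\<close>.

  \<^item> As \<open>t\<close> tends to \<open>1\<close>, the maps \<open>S \<mapsto> \<rho>(G(S, t))\<close> converge uniformly to the identity, so
    they form a homotopy from \<open>\<rho> \<circ> g\<close> to the identity of \<open>\<Sigma>\<close>.
  \<^item> The points \<open>u\<close> and \<open>g(\<rho>(u))\<close> are seen from \<open>p\<close> under an angle of at most \<open>1 < \<pi>\<close>. A geodesic
    through \<open>p\<close> has angle \<open>\<pi>\<close> at \<open>p\<close>, so the geodesic between the two points avoids \<open>p\<close>; moving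
    along it is a homotopy from \<open>g \<circ> \<rho>\<close> to the identity of \<open>B - {p}\<close>.

  To construct \<open>G\<close>, cover \<open>\<Sigma> \<times> [0, 1)\<close> by the sets of all \<open>(S, t)\<close> for which the direction of a given
  point \<open>v\<close> is close to \<open>S\<close>, compared with \<open>1 - t\<close>. A. H. Stone's argument for the paracompactness
  of metric spaces (\<open>discrete_layers\<close>) refines such a cover to a sequence of families of disjoint
  sets, with continuous weights. The finitely many points \<open>v\<close> selected near \<open>(S, t)\<close> have pairwise
  small angles; moved along their geodesics to a common and sufficiently small distance \<open>s\<close> from \<open>p\<close>,
  they have mutual distances which are small multiples of \<open>s\<close>. Mixing them successively along
  geodesics, with the given weights, stays in a small ball by convexity of balls, and a point at
  distance \<open>r * s\<close> from a point at distance \<open>s\<close> from \<open>p\<close> differs from it in direction by an angle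
  of order \<open>r\<close> (\<open>angle_close\<close>). The scale \<open>s\<close> can be chosen as a Lipschitz function on
  \<open>\<Sigma> \<times> [0, 1)\<close> (\<open>lipschitz_scale\<close>).

  The curvature bound enters through two inequalities for the distance from a vertex of a small
  triangle to a point of the opposite side, valid in all three kinds of model surfaces
  (\<open>comparison_bounds\<close>). The first is the Euclidean formula up to an error of fourth order. It gives
  the existence of angles, their law of cosines and their triangle inequality. The second is a
  uniform convexity of balls. It gives the uniqueness of short geodesics and their continuous
  dependence on the end points.
\<close>

section \<open>Triangles in the model surfaces\<close>

text \<open>
  This turns \<open>f'' = - f\<close> or \<open>f'' = f\<close>, which hold along a unit speed geodesic for the cosine and the
  hyperbolic cosine of the distance to a fixed point, into an inequality for the sides of a triangle.
\<close>

lemma chord_above_parabola: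
  fixes h h' h'' :: "real \<Rightarrow> real"
  assumes "0 \<le> b" "0 \<le> t" "t \<le> 1"
    and h: "\<And>s. (h has_real_derivative h' s) (at s)"
    and h': "\<And>s. (h' has_real_derivative h'' s) (at s)"
    and m: "\<And>s. 0 \<le> s \<Longrightarrow> s \<le> b \<Longrightarrow> m \<le> h'' s"
  shows "h (t * b) \<le> (1 - t) * h 0 + t * h b - m / 2 * (t * (1 - t) * b\<^sup>2)"
proof -
  define g where "g s = h s - m / 2 * s\<^sup>2" for s
  have "convex_on {0..b} g"
  proof (rule f''_ge0_imp_convex)
    show "(g has_real_derivative h' s - m * s) (at s)" for s
      unfolding g_def by (rule derivative_eq_intros h refl | simp)+
    show "((\<lambda>s. h' s - m * s) has_real_derivative h'' s - m) (at s)" for s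
      by (rule derivative_eq_intros h' refl | simp)+
  qed (use m in auto)
  from convex_onD[OF this, of t 0 b] assms
  have "g (t * b) \<le> (1 - t) * g 0 + t * g b" by simp
  then show ?thesis by (simp add: g_def algebra_simps power2_eq_square)
qed

lemma one_minus_cos_upper: "1 - cos x \<le> x\<^sup>2 / 2" for x :: real
proof -
  have "1 - cos x = 2 * (sin (x / 2))\<^sup>2" using cos_double_sin[of "x/2"] by simp
  moreover have "(sin (x / 2))\<^sup>2 \<le> (x / 2)\<^sup>2"
    using abs_sin_x_le_abs_x[of "x/2"] abs_le_square_iff by blast
  ultimately show ?thesis by (simp add: power_divide)
qed

lemma one_minus_cos_lower: "x\<^sup>2 / 2 - x ^ 4 / 24 \<le> 1 - cos x" for x :: real
proof -
  obtain t where "cos x = (\<Sum>m<4. cos_coeff m * x ^ m) + (cos (t + 1/2 * real 4 * pi) / fact 4) * x ^ 4"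
    using Maclaurin_cos_expansion by blast
  moreover have "(\<Sum>m<4. cos_coeff m * x ^ m) = 1 - x\<^sup>2 / 2"
  proof -
    have "{..<4::nat} = {0, 1, 2, 3}" by auto
    then show ?thesis by (simp add: cos_coeff_def fact_numeral)
  qed
  moreover have "cos (t + 1/2 * real 4 * pi) / fact 4 * x ^ 4 \<le> x ^ 4 / 24"
  proof -
    have "cos (t + 1/2 * real 4 * pi) * x ^ 4 \<le> 1 * x ^ 4"
      by (rule mult_right_mono) auto
    then show ?thesis by (simp add: fact_numeral)
  qed
  ultimately show ?thesis by linarith
qed

lemma cosh_minus_one_lower: "x\<^sup>2 / 2 \<le> cosh x - 1" if "0 \<le> x" for x :: real
proof (cases "x = 0")
  case False
  then have "x > 0" using that by simp
  have der: "\<forall>m t. m < 2 \<and> 0 \<le> t \<and> t \<le> x \<longrightarrow>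
      ((if even m then cosh else sinh) has_real_derivative (if even (Suc m) then cosh else sinh) t) (at t)"
    by (auto intro!: derivative_eq_intros)
  obtain t where "0 < t" "t < x" "cosh x = (\<Sum>m<2. ((if even m then cosh else sinh) 0 / fact m) * x ^ m)
      + ((if even (2::nat) then cosh else sinh) t / fact 2) * x ^ 2"
    using Maclaurin[OF \<open>x > 0\<close> _ _ der, of cosh] by auto
  moreover from this have "cosh t \<ge> 1" using cosh_real_ge_1 by blast
  then have "1 * x\<^sup>2 \<le> cosh t * x\<^sup>2" by (intro mult_right_mono) auto
  ultimately show ?thesis by (simp add: eval_nat_numeral)
qed simp

lemma cosh_minus_one_upper: "cosh x - 1 \<le> x\<^sup>2 / 2 + x ^ 4 / 12" if "0 \<le> x" "x \<le> 1" for x :: real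
proof (cases "x = 0")
  case False
  then have "x > 0" using that by simp
  have der: "\<forall>m t. m < 4 \<and> 0 \<le> t \<and> t \<le> x \<longrightarrow>
      ((if even m then cosh else sinh) has_real_derivative (if even (Suc m) then cosh else sinh) t) (at t)"
    by (auto intro!: derivative_eq_intros)
  obtain t where t: "0 < t" "t < x" "cosh x = (\<Sum>m<4. ((if even m then cosh else sinh) 0 / fact m) * x ^ m)
      + ((if even (4::nat) then cosh else sinh) t / fact 4) * x ^ 4"
    using Maclaurin[OF \<open>x > 0\<close> _ _ der, of cosh] by auto
  have "exp t \<le> 3"
    using exp_bound[of t] t that power_le_one[of t 2] by simp
  moreover have "exp (- t) \<le> 1" using t by simp
  ultimately have "exp t + exp (- t) \<le> 4" by linarith
  then have "cosh t \<le> 2" by (simp add: cosh_def)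
  then have "cosh t * x ^ 4 \<le> 2 * x ^ 4" by (intro mult_right_mono) auto
  moreover have "{..<4::nat} = {0, 1, 2, 3}" by auto
  ultimately show ?thesis using t(3) by (simp add: fact_numeral)
qed simp

lemma sinh_upper: "sinh x \<le> 2 * x" if "0 \<le> x" "x \<le> 1" for x :: real
proof -
  have "exp x \<le> 1 + x + x\<^sup>2" using exp_bound that by simp
  moreover have "1 - x \<le> exp (- x)" using exp_ge_add_one_self[of "-x"] by simp
  moreover have "x\<^sup>2 \<le> x" using that by (simp add: power2_eq_square mult_left_le)
  ultimately show ?thesis using that by (simp add: sinh_def)
qed

text \<open>
  In a triangle with sides \<open>a\<close>, \<open>b\<close>, \<open>c\<close>, all at most \<open>\<rho>\<close>, let \<open>D\<close> be the distance from the common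
  vertex of \<open>a\<close> and \<open>c\<close> to the point that divides \<open>b\<close> in the ratio \<open>t : 1 - t\<close>. For \<open>k = 0\<close> the first
  bound is Stewart's theorem, as an inequality. The second bound has no error term, unlike the
  first, and so survives when \<open>b\<close> is much smaller than \<open>a\<close> and \<open>c\<close>.
\<close>

definition comparison_bounds :: "real \<Rightarrow> real \<Rightarrow> real \<Rightarrow> real \<Rightarrow> real \<Rightarrow> real \<Rightarrow> real \<Rightarrow> bool" where
  "comparison_bounds k \<rho> a b c t D \<longleftrightarrow>
     D\<^sup>2 \<le> (1 - t) * a\<^sup>2 + t * c\<^sup>2 - t * (1 - t) * b\<^sup>2 + 4 * k * \<rho> ^ 4 \<and>
     D\<^sup>2 \<le> (max a c)\<^sup>2 - t * (1 - t) * b\<^sup>2 / 4"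

text \<open>
  The function \<open>h = 1 - cos D\<close> satisfies \<open>h'' = cos D\<close>, which is at least \<open>1 - 2 \<rho>\<^sup>2\<close> as long as
  \<open>D \<le> 2 \<rho>\<close>. Replacing \<open>h\<close> by \<open>D\<^sup>2 / 2\<close> costs terms of fourth order, which gives the first bound. For
  the second one, differences of cosines are compared with differences of squares.
\<close>

lemma sphere_bounds:
  fixes x y w :: "'v::real_inner"
  assumes x: "x \<bullet> x = 1" and y: "y \<bullet> y = 1" and w: "w \<bullet> w = 1" and yw: "y \<bullet> w = 0"
    and b: "0 \<le> b" "b \<le> \<rho>" and \<rho>: "\<rho> \<le> 1 / 2" and t: "0 \<le> t" "t \<le> 1"
    and a: "arccos (x \<bullet> y) \<le> \<rho>" and c: "arccos (x \<bullet> (cos b *\<^sub>R y + sin b *\<^sub>R w)) \<le> \<rho>"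
  shows "comparison_bounds 1 \<rho> (arccos (x \<bullet> y)) b (arccos (x \<bullet> (cos b *\<^sub>R y + sin b *\<^sub>R w))) t
           (arccos (x \<bullet> (cos (t * b) *\<^sub>R y + sin (t * b) *\<^sub>R w)))"
proof -
  define P where "P s = cos s *\<^sub>R y + sin s *\<^sub>R w" for s
  define D where "D s = arccos (x \<bullet> P s)" for s
  have wy: "w \<bullet> y = 0" using yw by (simp add: inner_commute)
  have P1: "P s \<bullet> P s = 1" for s
    unfolding P_def using y w yw wy
    by (simp add: inner_add_left inner_add_right power2_eq_square[symmetric])
  have yP: "y \<bullet> P s = cos s" for s
    unfolding P_def using y yw by (simp add: inner_add_right)
  have nx: "\<bar>x \<bullet> P s\<bar> \<le> 1" for s
    using Cauchy_Schwarz_ineq2[of x "P s"] x P1 by (simp add: norm_eq_sqrt_inner)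
  have cosD: "cos (D s) = x \<bullet> P s" for s unfolding D_def using nx by (simp add: cos_arccos_abs)
  have D0: "0 \<le> D s" "D s \<le> pi" for s
    using nx[of s] by (simp_all add: D_def arccos_lbound arccos_ubound abs_le_iff)
  have a': "arccos (x \<bullet> y) = D 0" and c': "arccos (x \<bullet> (cos b *\<^sub>R y + sin b *\<^sub>R w)) = D b"
    by (simp_all add: D_def P_def)
  have \<rho>0: "0 \<le> \<rho>" using b by simp
  have D2: "D s \<le> 2 * \<rho>" if s: "0 \<le> s" "s \<le> b" for s
  proof -
    have "arccos (y \<bullet> P s) = s" using s b \<rho> pi_gt3 by (simp add: yP arccos_cos)
    then show ?thesis using sphere_triangle[OF x y P1, of s] a s b by (simp add: D_def)
  qed
  have low: "1 - 2 * \<rho>\<^sup>2 \<le> cos (D s)" if s: "0 \<le> s" "s \<le> b" for s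
  proof -
    have "(D s)\<^sup>2 \<le> (2 * \<rho>)\<^sup>2" using D0[of s] D2[OF s] by (intro power_mono) auto
    then show ?thesis using one_minus_cos_upper[of "D s"] by (simp add: power_mult_distrib)
  qed
  have tb: "0 \<le> t * b" "t * b \<le> b" using t b by (auto simp: mult_left_le_one_le)
  have main: "1 - cos (D (t * b)) \<le> (1 - t) * (1 - cos (D 0)) + t * (1 - cos (D b))
       - (1 - 2 * \<rho>\<^sup>2) / 2 * (t * (1 - t) * b\<^sup>2)"
  proof (rule chord_above_parabola[OF b(1) t])
    show "((\<lambda>s. 1 - cos (D s)) has_real_derivative sin s * (x \<bullet> y) - cos s * (x \<bullet> w)) (at s)" for s
      unfolding cosD P_def inner_add_right inner_scaleR_right
      by (rule derivative_eq_intros refl | simp)+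
    show "((\<lambda>s. sin s * (x \<bullet> y) - cos s * (x \<bullet> w)) has_real_derivative cos (D s)) (at s)" for s
      unfolding cosD P_def inner_add_right inner_scaleR_right
      by (rule derivative_eq_intros refl | simp)+
  qed (rule low)
  define T where "T = t * (1 - t) * b\<^sup>2"
  have T: "0 \<le> T" "T \<le> \<rho>\<^sup>2"
  proof -
    show "0 \<le> T" unfolding T_def using t by simp
    have "t * (1 - t) \<le> 1" using t by (intro mult_le_one) auto
    then have "T \<le> 1 * b\<^sup>2" unfolding T_def by (intro mult_right_mono) auto
    also have "\<dots> \<le> \<rho>\<^sup>2" using b by (simp add: power_mono)
    finally show "T \<le> \<rho>\<^sup>2" .
  qed
  have \<rho>2: "\<rho>\<^sup>2 \<le> 1 / 4" using power_mono[OF \<rho> \<rho>0, of 2] by (simp add: power_divide)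
  have "(D (t * b)) ^ 4 \<le> (2 * \<rho>) ^ 4"
    using D0 D2[OF tb] by (intro power_mono) auto
  then have e1: "(D (t * b))\<^sup>2 / 2 \<le> 1 - cos (D (t * b)) + 16 * \<rho> ^ 4 / 24"
    using one_minus_cos_lower[of "D (t*b)"] by (simp add: power_mult_distrib)
  have e2: "\<rho>\<^sup>2 * T \<le> \<rho> ^ 4"
    using mult_left_mono[OF T(2), of "\<rho>\<^sup>2"] by (simp add: power2_eq_square eval_nat_numeral)
  have "(1 - t) * (1 - cos (D 0)) \<le> (1 - t) * ((D 0)\<^sup>2 / 2)" "t * (1 - cos (D b)) \<le> t * ((D b)\<^sup>2 / 2)"
    using t by (auto intro!: mult_left_mono one_minus_cos_upper simp del: times_divide_eq_right)
  moreover have "(1 - 2 * \<rho>\<^sup>2) / 2 * T = T / 2 - \<rho>\<^sup>2 * T" by (simp add: field_simps)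
  ultimately have A: "(D (t * b))\<^sup>2 \<le> (1 - t) * (D 0)\<^sup>2 + t * (D b)\<^sup>2 - T + 2 * \<rho> ^ 4 + 4/3 * \<rho> ^ 4"
    using main[folded T_def] e1 e2 by linarith
  have A': "(D (t * b))\<^sup>2 \<le> (1 - t) * (D 0)\<^sup>2 + t * (D b)\<^sup>2 - T + 4 * \<rho> ^ 4"
    using A zero_le_power[OF \<rho>0, of 4] by linarith
  define R where "R = max (D 0) (D b)"
  have R: "0 \<le> R" "R \<le> 1/2" "D 0 \<le> R" "D b \<le> R" using D0[of 0] a c a' c' \<rho> by (auto simp: R_def)
  have "cos R \<le> cos (D 0)" "cos R \<le> cos (D b)"
    using D0 R pi_gt3 by (auto intro!: cos_monotone_0_pi_le)
  then have "(1 - t) * cos R + t * cos R \<le> (1 - t) * cos (D 0) + t * cos (D b)"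
    using t by (intro add_mono mult_left_mono) auto
  moreover have "(1 / 4) * T \<le> (1 - 2 * \<rho>\<^sup>2) / 2 * T" using \<rho>2 T by (intro mult_right_mono) auto
  moreover have "(1 - t) * (1 - cos (D 0)) + t * (1 - cos (D b)) = 1 - ((1 - t) * cos (D 0) + t * cos (D b))"
    "(1 - t) * cos R + t * cos R = cos R"
    by (simp_all add: algebra_simps)
  ultimately have M: "T / 4 \<le> cos (D (t * b)) - cos R"
    using main[folded T_def] by linarith
  have DR: "D (t * b) \<le> R"
  proof (rule ccontr)
    assume "\<not> ?thesis"
    then have "cos (D (t * b)) < cos R" using R D0 by (intro cos_monotone_0_pi) auto
    then show False using M T by simp
  qed
  have "cos (D (t * b)) - cos R \<le> (R\<^sup>2 - (D (t * b))\<^sup>2) / 2"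
  proof -
    define u v where "u = (D (t * b) + R) / 2" and "v = (R - D (t * b)) / 2"
    have "cos (D (t * b)) - cos R = 2 * sin u * sin v" unfolding u_def v_def by (rule cos_diff_cos)
    also have "\<dots> \<le> 2 * (u * v)"
    proof -
      have "0 \<le> v" "0 \<le> u" "v \<le> pi" using DR D0[of "t*b"] R pi_gt3 by (auto simp: u_def v_def)
      then have "sin u * sin v \<le> u * v" by (intro mult_mono sin_x_le_x sin_ge_zero) auto
      then show ?thesis by simp
    qed
    also have "\<dots> = (R\<^sup>2 - (D (t * b))\<^sup>2) / 2" by (simp add: u_def v_def field_simps power2_eq_square)
    finally show ?thesis .
  qed
  then have "2 * (cos (D (t * b)) - cos R) \<le> R\<^sup>2 - (D (t * b))\<^sup>2" by simp
  with M T(1) have B: "(D (t * b))\<^sup>2 \<le> R\<^sup>2 - T / 4" by argo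
  show ?thesis
    unfolding comparison_bounds_def a' c' P_def[symmetric] D_def[symmetric]
    using A' B unfolding T_def R_def by simp
qed


text \<open>As on the sphere, with \<open>h = cosh D - 1\<close> and \<open>h'' = cosh D \<ge> 1\<close>.\<close>

lemma hyperboloid_bounds:
  assumes x: "minkowski x x = - 1" "x $ 3 > 0" and P: "\<And>s. minkowski (P s) (P s) = - 1" "\<And>s. P s $ 3 > 0"
    and P_def: "\<And>s. P s = cosh s *\<^sub>R y + sinh s *\<^sub>R w"
    and b: "0 \<le> b" "b \<le> \<rho>" and \<rho>: "\<rho> \<le> 1 / 2" and t: "0 \<le> t" "t \<le> 1"
    and a: "arcosh (- minkowski x (P 0)) \<le> \<rho>" and c: "arcosh (- minkowski x (P b)) \<le> \<rho>"
  shows "comparison_bounds 1 \<rho> (arcosh (- minkowski x (P 0))) b (arcosh (- minkowski x (P b))) t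
           (arcosh (- minkowski x (P (t * b))))"
proof -
  define D where "D s = arcosh (- minkowski x (P s))" for s
  have ge1: "- minkowski x (P s) \<ge> 1" for s
    by (rule hyperboloid_product(1)[OF x P])
  have coshD: "cosh (D s) = - minkowski x (P s)" for s
    unfolding D_def using ge1 by (rule cosh_arcosh_real)
  have D0: "0 \<le> D s" for s unfolding D_def using ge1 by (rule arcosh_nonneg_real)
  have \<rho>0: "0 \<le> \<rho>" using b by simp
  have aD: "D 0 \<le> \<rho>" and cD: "D b \<le> \<rho>" using a c by (simp_all add: D_def)
  have main: "(cosh (D (t * b)) - 1) \<le> (1 - t) * (cosh (D 0) - 1) + t * (cosh (D b) - 1)
       - 1 / 2 * (t * (1 - t) * b\<^sup>2)"
  proof (rule chord_above_parabola[OF b(1) t])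
    show "((\<lambda>s. cosh (D s) - 1) has_real_derivative - (sinh s * minkowski x y + cosh s * minkowski x w)) (at s)" for s
      unfolding coshD P_def minkowski_linear
      by (rule derivative_eq_intros refl | simp)+
    show "((\<lambda>s. - (sinh s * minkowski x y + cosh s * minkowski x w)) has_real_derivative cosh (D s)) (at s)" for s
      unfolding coshD P_def minkowski_linear
      by (rule derivative_eq_intros refl | simp)+
  qed (simp add: cosh_real_ge_1)
  define T where "T = t * (1 - t) * b\<^sup>2"
  have T: "0 \<le> T" unfolding T_def using t by simp
  have up: "cosh (D s) - 1 \<le> (D s)\<^sup>2 / 2 + \<rho> ^ 4 / 12" if "D s \<le> \<rho>" for s
  proof -
    have "D s ^ 4 \<le> \<rho> ^ 4" using that D0 by (intro power_mono) auto
    moreover have "cosh (D s) - 1 \<le> (D s)\<^sup>2 / 2 + D s ^ 4 / 12"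
      using D0[of s] that \<rho> by (intro cosh_minus_one_upper) auto
    ultimately show ?thesis by linarith
  qed
  have "(1 - t) * (cosh (D 0) - 1) \<le> (1 - t) * ((D 0)\<^sup>2 / 2 + \<rho> ^ 4 / 12)"
    "t * (cosh (D b) - 1) \<le> t * ((D b)\<^sup>2 / 2 + \<rho> ^ 4 / 12)"
    using t up aD cD by (auto intro!: mult_left_mono simp del: times_divide_eq_right)
  then have "(D (t * b))\<^sup>2 / 2 \<le> (1 - t) * ((D 0)\<^sup>2 / 2 + \<rho> ^ 4 / 12) + t * ((D b)\<^sup>2 / 2 + \<rho> ^ 4 / 12) - T / 2"
    using main[folded T_def] cosh_minus_one_lower[OF D0, of "t * b"] by linarith
  then have "(D (t * b))\<^sup>2 \<le> (1 - t) * (D 0)\<^sup>2 + t * (D b)\<^sup>2 - T + \<rho> ^ 4 / 6"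
    by (simp add: field_simps)
  then have A: "(D (t * b))\<^sup>2 \<le> (1 - t) * (D 0)\<^sup>2 + t * (D b)\<^sup>2 - T + 4 * \<rho> ^ 4"
    using zero_le_power[OF \<rho>0, of 4] by linarith
  define R where "R = max (D 0) (D b)"
  have R: "0 \<le> R" "R \<le> 1/2" "D 0 \<le> R" "D b \<le> R" using D0[of 0] aD cD \<rho> by (auto simp: R_def)
  have "cosh (D 0) \<le> cosh R" "cosh (D b) \<le> cosh R"
    using D0 R by (auto simp: cosh_real_nonneg_le_iff)
  then have "(1 - t) * cosh (D 0) + t * cosh (D b) \<le> (1 - t) * cosh R + t * cosh R"
    using t by (intro add_mono mult_left_mono) auto
  moreover have "(1 - t) * (cosh (D 0) - 1) + t * (cosh (D b) - 1) = (1 - t) * cosh (D 0) + t * cosh (D b) - 1"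
    "(1 - t) * cosh R + t * cosh R = cosh R"
    by (simp_all add: algebra_simps)
  ultimately have M: "T / 2 \<le> cosh R - cosh (D (t * b))"
    using main[folded T_def] by linarith
  then have "cosh (D (t * b)) \<le> cosh R" using T by linarith
  then have DR: "D (t * b) \<le> R" using D0 R cosh_real_nonneg_le_iff by blast
  have "cosh R - cosh (D (t * b)) \<le> 2 * (R\<^sup>2 - (D (t * b))\<^sup>2)"
  proof -
    define u v where "u = (R + D (t * b)) / 2" and "v = (R - D (t * b)) / 2"
    have uv: "R = u + v" "D (t * b) = u - v" by (simp_all add: u_def v_def field_simps)
    have "cosh R - cosh (D (t * b)) = 2 * (sinh u * sinh v)"
      unfolding uv cosh_add cosh_diff by simp
    also have "\<dots> \<le> 2 * ((2 * u) * (2 * v))"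
    proof -
      have "0 \<le> v" "0 \<le> u" "v \<le> 1" "u \<le> 1" using DR D0[of "t*b"] R by (auto simp: u_def v_def)
      then have "sinh u * sinh v \<le> (2 * u) * (2 * v)" by (intro mult_mono sinh_upper) auto
      then show ?thesis by simp
    qed
    also have "\<dots> = 2 * (R\<^sup>2 - (D (t * b))\<^sup>2)" by (simp add: u_def v_def field_simps power2_eq_square)
    finally show ?thesis .
  qed
  with M T have B: "(D (t * b))\<^sup>2 \<le> R\<^sup>2 - T / 4" by argo
  show ?thesis
    unfolding comparison_bounds_def D_def[symmetric]
    using A B unfolding T_def R_def by simp
qed

lemma plane_bounds:
  fixes x y w :: "'v::real_inner"
  assumes w: "w \<bullet> w = 1" and t: "0 \<le> t" "t \<le> 1"
  shows "comparison_bounds 0 \<rho> (dist x y) b (dist x (y + b *\<^sub>R w)) t (dist x (y + (t * b) *\<^sub>R w))"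
proof -
  have sq: "(dist x (y + s *\<^sub>R w))\<^sup>2 = (dist x y)\<^sup>2 - 2 * s * ((x - y) \<bullet> w) + s\<^sup>2" for s
  proof -
    define v where "v = x - y"
    have eq: "x - (y + s *\<^sub>R w) = v - s *\<^sub>R w" by (simp add: v_def algebra_simps)
    have "(v - s *\<^sub>R w) \<bullet> (v - s *\<^sub>R w) = v \<bullet> v - 2 * s * (v \<bullet> w) + s\<^sup>2"
      using w by (simp add: inner_diff_left inner_diff_right inner_commute power2_eq_square)
    then show ?thesis
      unfolding dist_norm power2_norm_eq_inner eq v_def[symmetric] .
  qed
  have eq: "(dist x (y + (t * b) *\<^sub>R w))\<^sup>2 = (1 - t) * (dist x y)\<^sup>2 + t * (dist x (y + b *\<^sub>R w))\<^sup>2 - t * (1 - t) * b\<^sup>2"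
    unfolding sq by (simp add: algebra_simps power2_eq_square)
  define R where "R = max (dist x y) (dist x (y + b *\<^sub>R w))"
  have "(dist x y)\<^sup>2 \<le> R\<^sup>2" "(dist x (y + b *\<^sub>R w))\<^sup>2 \<le> R\<^sup>2"
    unfolding R_def by (auto intro!: power_mono)
  then have "(1 - t) * (dist x y)\<^sup>2 + t * (dist x (y + b *\<^sub>R w))\<^sup>2 \<le> (1 - t) * R\<^sup>2 + t * R\<^sup>2"
    using t by (intro add_mono mult_left_mono) auto
  then have "(1 - t) * (dist x y)\<^sup>2 + t * (dist x (y + b *\<^sub>R w))\<^sup>2 \<le> R\<^sup>2" by (simp add: algebra_simps)
  moreover have "0 \<le> t * (1 - t) * b\<^sup>2" using t by simp
  ultimately show ?thesis unfolding comparison_bounds_def R_def[symmetric] eq by simp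
qed

lemma comparison_bounds_scale:
  assumes "comparison_bounds 1 (q * \<rho>) (q * a) (q * b) (q * c) t (q * D)" "q > 0"
  shows "comparison_bounds (q\<^sup>2) \<rho> a b c t D"
proof -
  have "max (q * a) (q * c) = q * max a c" using assms(2) by (simp add: max_def)
  then have 1: "q\<^sup>2 * D\<^sup>2 \<le> q\<^sup>2 * ((1 - t) * a\<^sup>2 + t * c\<^sup>2 - t * (1 - t) * b\<^sup>2 + 4 * q\<^sup>2 * \<rho> ^ 4)"
    and 2: "q\<^sup>2 * D\<^sup>2 \<le> q\<^sup>2 * ((max a c)\<^sup>2 - t * (1 - t) * b\<^sup>2 / 4)"
    using assms(1) unfolding comparison_bounds_def
    by (simp_all add: power_mult_distrib algebra_simps flip: power_add)
  have "q\<^sup>2 > 0" using assms(2) by simp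
  then show ?thesis
    unfolding comparison_bounds_def using mult_left_le_imp_le[OF 1] mult_left_le_imp_le[OF 2] by blast
qed

lemma ex_orthogonal_unit: "\<exists>w::real^3. w \<bullet> w = 1 \<and> y \<bullet> w = 0"
proof -
  have "\<exists>v::real^3. v \<noteq> 0 \<and> y \<bullet> v = 0"
  proof (cases "y $ 1 = 0")
    case True
    then show ?thesis by (intro exI[of _ "axis 1 1"]) (simp add: inner_axis)
  next
    case False
    then show ?thesis
      by (intro exI[of _ "vector [- y $ 2, y $ 1, 0]"])
        (auto simp: inner_vec_def sum_3 vec_eq_iff forall_3)
  qed
  then obtain v where v: "v \<noteq> 0" "y \<bullet> v = 0" by blast
  then show ?thesis
    by (intro exI[of _ "v /\<^sub>R norm v"]) (simp add: power2_norm_eq_inner[symmetric] power2_eq_square)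
qed

lemma sphere_join:
  fixes y z :: "real^3"
  assumes y: "y \<bullet> y = 1" and z: "z \<bullet> z = 1" and lt: "arccos (y \<bullet> z) < pi"
  shows "\<exists>w. w \<bullet> w = 1 \<and> y \<bullet> w = 0 \<and> z = cos (arccos (y \<bullet> z)) *\<^sub>R y + sin (arccos (y \<bullet> z)) *\<^sub>R w"
proof -
  define \<theta> where "\<theta> = arccos (y \<bullet> z)"
  have b: "\<bar>y \<bullet> z\<bar> \<le> 1"
    using Cauchy_Schwarz_ineq2[of y z] y z by (simp add: norm_eq_sqrt_inner)
  have c: "cos \<theta> = y \<bullet> z" unfolding \<theta>_def using b by (simp add: cos_arccos_abs)
  have \<theta>: "0 \<le> \<theta>" "\<theta> < pi" using lt b by (auto simp: \<theta>_def abs_le_iff intro: arccos_lbound)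
  show ?thesis unfolding \<theta>_def[symmetric]
  proof (cases "\<theta> = 0")
    case True
    then have "(y - z) \<bullet> (y - z) = 0"
      using c y z by (simp add: inner_diff_left inner_diff_right inner_commute)
    then have "z = y" by simp
    then show "\<exists>w. w \<bullet> w = 1 \<and> y \<bullet> w = 0 \<and> z = cos \<theta> *\<^sub>R y + sin \<theta> *\<^sub>R w"
      using ex_orthogonal_unit[of y] True by simp
  next
    case False
    then have s: "sin \<theta> > 0" using \<theta> by (intro sin_gt_zero) auto
    define w where "w = (z - cos \<theta> *\<^sub>R y) /\<^sub>R sin \<theta>"
    have "(z - cos \<theta> *\<^sub>R y) \<bullet> (z - cos \<theta> *\<^sub>R y) = (sin \<theta>)\<^sup>2"
      using y z c by (simp add: inner_diff_left inner_diff_right inner_commute sin_squared_eq)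
          (simp add: power2_eq_square)
    then have "w \<bullet> w = 1" using s unfolding w_def inner_scaleR_left inner_scaleR_right
      by (simp add: power2_eq_square field_simps)
    moreover have "y \<bullet> w = 0" using y c by (simp add: w_def inner_diff_right)
    moreover have "z = cos \<theta> *\<^sub>R y + sin \<theta> *\<^sub>R w" using s by (simp add: w_def)
    ultimately show "\<exists>w. w \<bullet> w = 1 \<and> y \<bullet> w = 0 \<and> z = cos \<theta> *\<^sub>R y + sin \<theta> *\<^sub>R w" by blast
  qed
qed

lemma hyperboloid_join:
  assumes y: "minkowski y y = - 1" "y $ 3 > 0" and z: "minkowski z z = - 1" "z $ 3 > 0"
  shows "\<exists>w. minkowski w w = 1 \<and> minkowski y w = 0 \<and>
           z = cosh (arcosh (- minkowski y z)) *\<^sub>R y + sinh (arcosh (- minkowski y z)) *\<^sub>R w"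
proof -
  define \<theta> where "\<theta> = arcosh (- minkowski y z)"
  have ge: "- minkowski y z \<ge> 1" by (rule hyperboloid_product(1)[OF y z])
  have c: "cosh \<theta> = - minkowski y z" unfolding \<theta>_def using ge by (rule cosh_arcosh_real)
  have \<theta>: "0 \<le> \<theta>" unfolding \<theta>_def using ge by (rule arcosh_nonneg_real)
  show ?thesis unfolding \<theta>_def[symmetric]
  proof (cases "\<theta> = 0")
    case True
    then have "z = y" using c hyperboloid_product(2)[OF y z] by simp
    define v :: "real^3" where "v = vector [y $ 3, 0, y $ 1]"
    have "minkowski v v = 1 + (y $ 2)\<^sup>2" "minkowski y v = 0"
      using y by (simp_all add: minkowski_def v_def power2_eq_square)
    moreover have "1 + (y $ 2)\<^sup>2 > 0" by (simp add: add_pos_nonneg)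
    ultimately have "minkowski (v /\<^sub>R sqrt (1 + (y $ 2)\<^sup>2)) (v /\<^sub>R sqrt (1 + (y $ 2)\<^sup>2)) = 1"
      "minkowski y (v /\<^sub>R sqrt (1 + (y $ 2)\<^sup>2)) = 0"
      using minkowski_linear(1)[of _ v 0 0] minkowski_linear(2)[of _ _ v 0 0]
      by (simp_all add: field_simps)
    then show "\<exists>w. minkowski w w = 1 \<and> minkowski y w = 0 \<and> z = cosh \<theta> *\<^sub>R y + sinh \<theta> *\<^sub>R w"
      using True \<open>z = y\<close> by auto
  next
    case False
    then have s: "sinh \<theta> > 0" using \<theta> by simp
    define u where "u = 1 *\<^sub>R z + (- cosh \<theta>) *\<^sub>R y"
    define w where "w = (1 / sinh \<theta>) *\<^sub>R u + 0 *\<^sub>R y"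
    have zy: "minkowski z y = - cosh \<theta>" "minkowski y z = - cosh \<theta>"
      using c by (simp_all add: minkowski_commute)
    have "minkowski u u = (sinh \<theta>)\<^sup>2" "minkowski y u = 0"
      unfolding u_def minkowski_linear y z zy by (simp_all add: sinh_square_eq) (simp add: power2_eq_square)
    then have "minkowski w w = 1" "minkowski y w = 0"
      using s unfolding w_def minkowski_linear by (simp_all add: power2_eq_square)
    moreover have "z = cosh \<theta> *\<^sub>R y + sinh \<theta> *\<^sub>R w" using s by (simp add: w_def u_def)
    ultimately show "\<exists>w. minkowski w w = 1 \<and> minkowski y w = 0 \<and> z = cosh \<theta> *\<^sub>R y + sinh \<theta> *\<^sub>R w" by blast
  qed
qed

text \<open>
  The curve could leave the upper sheet only through height \<open>0\<close>; it does not because a tangent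
  vector \<open>w\<close> at \<open>y\<close> has a third component of smaller absolute value than that of \<open>y\<close>.
\<close>

lemma hyperboloid_curve:
  assumes y: "minkowski y y = - 1" "y $ 3 > 0" and w: "minkowski w w = 1" "minkowski y w = 0"
  shows "minkowski (cosh s *\<^sub>R y + sinh s *\<^sub>R w) (cosh t *\<^sub>R y + sinh t *\<^sub>R w) = - cosh (s - t)"
    and "(cosh s *\<^sub>R y + sinh s *\<^sub>R w) $ 3 > 0"
proof -
  have wy: "minkowski w y = 0" using w by (simp add: minkowski_commute)
  show "minkowski (cosh s *\<^sub>R y + sinh s *\<^sub>R w) (cosh t *\<^sub>R y + sinh t *\<^sub>R w) = - cosh (s - t)"
    unfolding minkowski_linear y w wy cosh_diff by simp
  have "(w $ 3 * y $ 3)\<^sup>2 = (y $ 1 * w $ 1 + y $ 2 * w $ 2)\<^sup>2" using w(2) by (simp add: minkowski_def mult.commute)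
  also have "\<dots> \<le> ((y $ 1)\<^sup>2 + (y $ 2)\<^sup>2) * ((w $ 1)\<^sup>2 + (w $ 2)\<^sup>2)"
  proof -
    have "((y $ 1)\<^sup>2 + (y $ 2)\<^sup>2) * ((w $ 1)\<^sup>2 + (w $ 2)\<^sup>2) = (y $ 1 * w $ 1 + y $ 2 * w $ 2)\<^sup>2 + (y $ 1 * w $ 2 - y $ 2 * w $ 1)\<^sup>2"
      by algebra
    then show ?thesis by simp
  qed
  also have "\<dots> = ((y $ 3)\<^sup>2 - 1) * ((w $ 3)\<^sup>2 + 1)"
  proof -
    have "(y $ 1)\<^sup>2 + (y $ 2)\<^sup>2 = (y $ 3)\<^sup>2 - 1" "(w $ 1)\<^sup>2 + (w $ 2)\<^sup>2 = (w $ 3)\<^sup>2 + 1"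
      using y(1) w(1) by (simp_all add: minkowski_def power2_eq_square)
    then show ?thesis by simp
  qed
  finally have "(w $ 3)\<^sup>2 < (y $ 3)\<^sup>2" by (simp add: algebra_simps power_mult_distrib)
  then have w3: "\<bar>w $ 3\<bar> < y $ 3" using y(2) by (metis abs_of_pos abs_square_less_1 abs_le_square_iff not_le)
  have "\<bar>sinh s * w $ 3\<bar> \<le> cosh s * \<bar>w $ 3\<bar>"
  proof -
    have "\<bar>sinh s\<bar> \<le> cosh s" using sinh_less_cosh_real[of s] sinh_less_cosh_real[of "- s"] by simp
    then show ?thesis by (simp add: abs_mult mult_right_mono)
  qed
  also have "\<dots> < cosh s * y $ 3" using w3 by simp
  finally show "(cosh s *\<^sub>R y + sinh s *\<^sub>R w) $ 3 > 0" by simp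
qed


lemma model_geodesicI:
  assumes q: "q > 0" and len: "model_dist \<kappa> y z = \<theta> / q"
    and P0: "P 0 = y" and P1: "P \<theta> = z" and P: "\<And>s. P s \<in> model_points \<kappa>"
    and iso: "\<And>s t. \<lbrakk>0 \<le> s; s \<le> \<theta>; 0 \<le> t; t \<le> \<theta>\<rbrakk> \<Longrightarrow> model_dist \<kappa> (P s) (P t) = \<bar>s - t\<bar> / q"
  shows "geodesic (model_surface \<kappa>) y z (restrict (\<lambda>s. P (q * s)) {0..model_dist \<kappa> y z})"
proof -
  have le: "q * s \<le> \<theta>" if "s \<le> model_dist \<kappa> y z" for s
    using that q by (simp add: len field_simps)
  have "model_dist \<kappa> (P (q * s)) (P (q * t)) = \<bar>s - t\<bar>"
    if "s \<in> {0..model_dist \<kappa> y z}" "t \<in> {0..model_dist \<kappa> y z}" for s t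
  proof -
    have "\<bar>q * s - q * t\<bar> = q * \<bar>s - t\<bar>" using q by (simp add: abs_mult flip: right_diff_distrib)
    then show ?thesis using iso[of "q * s" "q * t"] le that q by simp
  qed
  moreover have "0 \<le> model_dist \<kappa> y z"
    using Metric_space.nonneg[OF Metric_space_model] .
  moreover have "q * model_dist \<kappa> y z = \<theta>" using q by (simp add: len)
  ultimately show ?thesis
    unfolding geodesic_def using P P0 P1 by (auto simp: PiE_iff)
qed

text \<open>
  Only one geodesic between two given points is needed, since the comparison of triangles allows a
  free choice of the comparison geodesics. The factor \<open>q\<close> rescales to curvature \<open>1\<close>, \<open>0\<close> or \<open>-1\<close>.
\<close>

lemma model_geodesic:
  assumes y: "y \<in> model_points \<kappa>" and z: "z \<in> model_points \<kappa>"
    and lt: "ereal (model_dist \<kappa> y z) < model_diam \<kappa>"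
  shows "\<exists>g. geodesic (model_surface \<kappa>) y z g \<and>
    (\<forall>x\<in>model_points \<kappa>. \<forall>\<rho> t. model_dist \<kappa> x y \<le> \<rho> \<and> model_dist \<kappa> x z \<le> \<rho> \<and> model_dist \<kappa> y z \<le> \<rho> \<and>
       \<bar>\<kappa>\<bar> * \<rho>\<^sup>2 \<le> 1 / 4 \<and> 0 \<le> t \<and> t \<le> 1 \<longrightarrow>
       comparison_bounds \<bar>\<kappa>\<bar> \<rho> (model_dist \<kappa> x y) (model_dist \<kappa> y z) (model_dist \<kappa> x z) t
         (model_dist \<kappa> x (g (t * model_dist \<kappa> y z))))"
proof -
  define q where "q = (if \<kappa> = 0 then 1 else sqrt \<bar>\<kappa>\<bar>)"
  let ?L = "model_dist \<kappa> y z"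
  let ?c = "\<lambda>P. restrict (\<lambda>s. P (q * s)) {0..?L}"
  let ?bd = "\<lambda>x \<rho> t P. comparison_bounds \<bar>\<kappa>\<bar> \<rho> (model_dist \<kappa> x y) (?L) (model_dist \<kappa> x z) t
       (model_dist \<kappa> x (?c P (t * ?L)))"
  have q: "q > 0" by (simp add: q_def)
  have small: "q * \<rho> \<le> 1 / 2" if "\<kappa> \<noteq> 0" "\<bar>\<kappa>\<bar> * \<rho>\<^sup>2 \<le> 1 / 4" for \<rho>
  proof (rule power2_le_imp_le)
    show "(q * \<rho>)\<^sup>2 \<le> (1 / 2)\<^sup>2" using that by (simp add: q_def power_mult_distrib power_divide)
  qed simp
  have d0: "0 \<le> ?L" using Metric_space.nonneg[OF Metric_space_model] .
  have at: "?c P (t * ?L) = P (t * (q * ?L))"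
    if "0 \<le> t" "t \<le> 1" for t and P :: "real \<Rightarrow> real^3"
    using that d0 by (simp add: mult_left_le_one_le mult.left_commute)
  consider "\<kappa> > 0" | "\<kappa> = 0" | "\<kappa> < 0" by linarith
  then show ?thesis
  proof cases
    case 1
    then have qk: "q = sqrt \<kappa>" "q\<^sup>2 = \<bar>\<kappa>\<bar>" by (auto simp: q_def)
    define \<theta> where "\<theta> = arccos (y \<bullet> z)"
    have yz: "y \<bullet> y = 1" "z \<bullet> z = 1" using y z 1 by (auto simp: model_points_def)
    have md: "model_dist \<kappa> u v = arccos (u \<bullet> v) / q" if "u \<bullet> u = 1" "v \<bullet> v = 1" for u v
      using that 1 by (simp add: model_dist_def model_points_def qk)
    have len: "?L = \<theta> / q" using md[OF yz] by (simp add: \<theta>_def)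
    have "\<theta> < pi" using lt 1 q by (simp add: model_diam_def len qk divide_less_cancel)
    then obtain w where w: "w \<bullet> w = 1" "y \<bullet> w = 0" "z = cos \<theta> *\<^sub>R y + sin \<theta> *\<^sub>R w"
      using sphere_join[OF yz] by (auto simp: \<theta>_def)
    define P where "P s = cos s *\<^sub>R y + sin s *\<^sub>R w" for s
    have PP: "P s \<bullet> P t = cos (s - t)" for s t
      unfolding P_def using yz w(1,2)
      by (simp add: inner_add_left inner_add_right inner_commute[of w y] cos_diff)
    have P1: "P s \<bullet> P s = 1" for s by (simp add: PP)
    have P\<theta>: "P \<theta> = z" and P0: "P 0 = y" using w(3) by (simp_all add: P_def)
    have g: "geodesic (model_surface \<kappa>) y z (?c P)"
    proof (rule model_geodesicI[OF q len P0 P\<theta>])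
      show "P s \<in> model_points \<kappa>" for s using P1 1 by (simp add: model_points_def)
      fix s t :: real assume st: "0 \<le> s" "s \<le> \<theta>" "0 \<le> t" "t \<le> \<theta>"
      have "arccos (cos (s - t)) = \<bar>s - t\<bar>"
        using st \<open>\<theta> < pi\<close> arccos_cos[of "\<bar>s - t\<bar>"] by simp
      then show "model_dist \<kappa> (P s) (P t) = \<bar>s - t\<bar> / q" by (simp add: md[OF P1 P1] PP)
    qed
    show ?thesis
    proof (intro exI conjI, rule g, intro ballI allI impI, elim conjE)
      fix x :: "real^3" and \<rho> t :: real assume x: "x \<in> model_points \<kappa>" and le: "model_dist \<kappa> x y \<le> \<rho>" "model_dist \<kappa> x z \<le> \<rho>" "?L \<le> \<rho>"
        and \<rho>: "\<bar>\<kappa>\<bar> * \<rho>\<^sup>2 \<le> 1 / 4" and t: "0 \<le> t" "t \<le> 1"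
      have xx: "x \<bullet> x = 1" using x 1 by (simp add: model_points_def)
      have q\<rho>: "q * \<rho> \<le> 1 / 2" using small 1 \<rho> by simp
      have \<theta>0: "0 \<le> \<theta>" using d0 q by (simp add: len zero_le_divide_iff)
      have le': "arccos (x \<bullet> y) \<le> q * \<rho>" "arccos (x \<bullet> z) \<le> q * \<rho>" "\<theta> \<le> q * \<rho>"
        using le q by (simp_all add: md[OF xx yz(1)] md[OF xx yz(2)] len field_simps)
      have "comparison_bounds 1 (q * \<rho>) (arccos (x \<bullet> y)) \<theta> (arccos (x \<bullet> z)) t (arccos (x \<bullet> P (t * \<theta>)))"
        using sphere_bounds[OF xx yz(1) w(1,2) \<theta>0 le'(3) q\<rho> t le'(1)] le'(2) unfolding P_def w(3)[symmetric] by simp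
      moreover have "arccos (x \<bullet> y) = q * model_dist \<kappa> x y" "arccos (x \<bullet> z) = q * model_dist \<kappa> x z"
        "\<theta> = q * ?L" "arccos (x \<bullet> P s) = q * model_dist \<kappa> x (P s)" for s
        using q by (simp_all add: md[OF xx yz(1)] md[OF xx yz(2)] md[OF xx P1] len)
      ultimately have "comparison_bounds 1 (q * \<rho>) (q * model_dist \<kappa> x y) (q * ?L) (q * model_dist \<kappa> x z) t
         (q * model_dist \<kappa> x (P (t * (q * ?L))))" by simp
      from comparison_bounds_scale[OF this q]
      show "?bd x \<rho> t P"
        unfolding at[OF t] qk(2) .
    qed
  next
    case 2
    then have qk: "q = 1" by (simp add: q_def)
    have yz: "y $ 3 = 0" "z $ 3 = 0" using y z 2 by (auto simp: model_points_def)
    have md: "model_dist \<kappa> u v = dist u v" if "u $ 3 = 0" "v $ 3 = 0" for u v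
      using that 2 by (simp add: model_dist_def model_points_def)
    define \<theta> where "\<theta> = dist y z"
    have len: "?L = \<theta> / q" using md[OF yz] by (simp add: \<theta>_def qk)
    have "\<exists>w::real^3. w \<bullet> w = 1 \<and> w $ 3 = 0 \<and> z = y + \<theta> *\<^sub>R w"
    proof (cases "y = z")
      case True
      then show ?thesis by (intro exI[of _ "axis 1 1"]) (simp add: \<theta>_def inner_axis_axis, simp add: axis_def)
    next
      case False
      then have "\<theta> > 0" by (simp add: \<theta>_def)
      moreover have "(z - y) \<bullet> (z - y) = \<theta> * \<theta>"
        by (simp add: \<theta>_def dist_norm norm_minus_commute dot_square_norm power2_eq_square)
      ultimately show ?thesis
        using yz by (intro exI[of _ "(z - y) /\<^sub>R \<theta>"]) (simp, simp add: field_simps)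
    qed
    then obtain w :: "real^3" where w: "w \<bullet> w = 1" "w $ 3 = 0" "z = y + \<theta> *\<^sub>R w" by blast
    have nw: "norm w = 1" using w(1) by (simp add: norm_eq_sqrt_inner)
    define P where "P s = y + s *\<^sub>R w" for s
    have P3: "P s $ 3 = 0" for s using yz w by (simp add: P_def)
    have P\<theta>: "P \<theta> = z" and P0: "P 0 = y" using w(3) by (simp_all add: P_def)
    have g: "geodesic (model_surface \<kappa>) y z (?c P)"
    proof (rule model_geodesicI[OF q len P0 P\<theta>])
      show "P s \<in> model_points \<kappa>" for s using P3 2 by (simp add: model_points_def)
      fix s t :: real
      have "P s - P t = (s - t) *\<^sub>R w" by (simp add: P_def scaleR_left_diff_distrib)
      then show "model_dist \<kappa> (P s) (P t) = \<bar>s - t\<bar> / q" by (simp add: md P3 dist_norm nw qk)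
    qed
    show ?thesis
    proof (intro exI conjI, rule g, intro ballI allI impI, elim conjE)
      fix x :: "real^3" and \<rho> t :: real assume x: "x \<in> model_points \<kappa>" and t: "0 \<le> t" "t \<le> (1::real)"
      have xx: "x $ 3 = 0" using x 2 by (simp add: model_points_def)
      have "comparison_bounds 0 \<rho> (dist x y) \<theta> (dist x z) t (dist x (P (t * \<theta>)))"
        unfolding P_def w(3) by (rule plane_bounds[OF w(1) t])
      then show "?bd x \<rho> t P"
        unfolding at[OF t] unfolding md[OF xx yz(1)] md[OF yz] md[OF xx yz(2)] md[OF xx P3]
        using 2 by (simp add: \<theta>_def qk)
    qed
  next
    case 3
    then have qk: "q = sqrt (- \<kappa>)" "q\<^sup>2 = \<bar>\<kappa>\<bar>" by (auto simp: q_def)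
    define \<theta> where "\<theta> = arcosh (- minkowski y z)"
    have yz: "minkowski y y = - 1" "y $ 3 > 0" "minkowski z z = - 1" "z $ 3 > 0"
      using y z 3 by (auto simp: model_points_def)
    have md: "model_dist \<kappa> u v = arcosh (- minkowski u v) / q"
      if "minkowski u u = - 1" "u $ 3 > 0" "minkowski v v = - 1" "v $ 3 > 0" for u v
      using that 3 by (simp add: model_dist_def model_points_def qk)
    have len: "?L = \<theta> / q" using md[OF yz] by (simp add: \<theta>_def)
    obtain w where w: "minkowski w w = 1" "minkowski y w = 0" "z = cosh \<theta> *\<^sub>R y + sinh \<theta> *\<^sub>R w"
      using hyperboloid_join[OF yz] by (auto simp: \<theta>_def)
    define P where "P s = cosh s *\<^sub>R y + sinh s *\<^sub>R w" for s
    have PP: "minkowski (P s) (P t) = - cosh (s - t)" for s t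
      unfolding P_def by (rule hyperboloid_curve(1)[OF yz(1,2) w(1,2)])
    have P1: "minkowski (P s) (P s) = - 1" for s by (simp add: PP)
    have P3: "P s $ 3 > 0" for s unfolding P_def by (rule hyperboloid_curve(2)[OF yz(1,2) w(1,2)])
    have P\<theta>: "P \<theta> = z" and P0: "P 0 = y" using w(3) by (simp_all add: P_def)
    have g: "geodesic (model_surface \<kappa>) y z (?c P)"
    proof (rule model_geodesicI[OF q len P0 P\<theta>])
      show "P s \<in> model_points \<kappa>" for s using P1 P3 3 by (simp add: model_points_def)
      fix s t :: real
      have "arcosh (cosh (s - t)) = \<bar>s - t\<bar>"
        using arcosh_cosh_real[of "\<bar>s - t\<bar>"] by simp
      then show "model_dist \<kappa> (P s) (P t) = \<bar>s - t\<bar> / q" by (simp add: md P1 P3 PP)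
    qed
    show ?thesis
    proof (intro exI conjI, rule g, intro ballI allI impI, elim conjE)
      fix x :: "real^3" and \<rho> t :: real assume x: "x \<in> model_points \<kappa>" and le: "model_dist \<kappa> x y \<le> \<rho>" "model_dist \<kappa> x z \<le> \<rho>" "?L \<le> \<rho>"
        and \<rho>: "\<bar>\<kappa>\<bar> * \<rho>\<^sup>2 \<le> 1 / 4" and t: "0 \<le> t" "t \<le> 1"
      have xx: "minkowski x x = - 1" "x $ 3 > 0" using x 3 by (simp_all add: model_points_def)
      have q\<rho>: "q * \<rho> \<le> 1 / 2" using small 3 \<rho> by simp
      have \<theta>0: "0 \<le> \<theta>" using d0 q by (simp add: len zero_le_divide_iff)
      have le': "arcosh (- minkowski x (P 0)) \<le> q * \<rho>" "arcosh (- minkowski x (P \<theta>)) \<le> q * \<rho>" "\<theta> \<le> q * \<rho>"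
        using le q by (simp_all add: P0 P\<theta> md[OF xx yz(1,2)] md[OF xx yz(3,4)] len field_simps)
      have "comparison_bounds 1 (q * \<rho>) (arcosh (- minkowski x y)) \<theta> (arcosh (- minkowski x z)) t (arcosh (- minkowski x (P (t * \<theta>))))"
        using hyperboloid_bounds[OF xx P1 P3 P_def \<theta>0 le'(3) q\<rho> t le'(1,2)] by (simp add: P0 P\<theta>)
      moreover have "arcosh (- minkowski x y) = q * model_dist \<kappa> x y" "arcosh (- minkowski x z) = q * model_dist \<kappa> x z"
        "\<theta> = q * ?L" "arcosh (- minkowski x (P s)) = q * model_dist \<kappa> x (P s)" for s
        using q by (simp_all add: md[OF xx yz(1,2)] md[OF xx yz(3,4)] md[OF xx P1 P3] len)
      ultimately have "comparison_bounds 1 (q * \<rho>) (q * model_dist \<kappa> x y) (q * ?L) (q * model_dist \<kappa> x z) t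
         (q * model_dist \<kappa> x (P (t * (q * ?L))))" by simp
      from comparison_bounds_scale[OF this q]
      show "?bd x \<rho> t P"
        unfolding at[OF t] qk(2) .
    qed
  qed
qed


text \<open>
  Put one side on a coordinate geodesic; the third vertex is then given by one component \<open>u\<close>, which the
  law of cosines determines, and by a second one, which exists because the triangle inequalities
  bound \<open>u\<close>. If the side \<open>b\<close> has length \<open>0\<close>, then \<open>u\<close> is arbitrary and is taken to be \<open>0\<close>.
\<close>

lemma model_triangle:
  assumes n: "0 \<le> a" "0 \<le> b" "0 \<le> c" and tri: "a \<le> b + c" "b \<le> a + c" "c \<le> a + b"
    and le: "a \<le> \<rho>" "b \<le> \<rho>" "c \<le> \<rho>" and \<rho>: "\<bar>\<kappa>\<bar> * \<rho>\<^sup>2 \<le> 1 / 4"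
  shows "\<exists>x\<in>model_points \<kappa>. \<exists>y\<in>model_points \<kappa>. \<exists>z\<in>model_points \<kappa>.
     model_dist \<kappa> x y = a \<and> model_dist \<kappa> y z = b \<and> model_dist \<kappa> x z = c"
proof -
  define q where "q = (if \<kappa> = 0 then 1 else sqrt \<bar>\<kappa>\<bar>)"
  have q: "q > 0" by (simp add: q_def)
  have q\<rho>: "q * \<rho> \<le> 1 / 2" if "\<kappa> \<noteq> 0"
  proof (rule power2_le_imp_le)
    show "(q * \<rho>)\<^sup>2 \<le> (1 / 2)\<^sup>2" using that \<rho> by (simp add: q_def power_mult_distrib power_divide)
  qed simp
  define \<alpha> \<beta> \<gamma> where "\<alpha> = q * a" and "\<beta> = q * b" and "\<gamma> = q * c"
  have n': "0 \<le> \<alpha>" "0 \<le> \<beta>" "0 \<le> \<gamma>" using n q by (simp_all add: \<alpha>_def \<beta>_def \<gamma>_def)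
  have tri': "\<alpha> \<le> \<beta> + \<gamma>" "\<beta> \<le> \<alpha> + \<gamma>" "\<gamma> \<le> \<alpha> + \<beta>"
    using tri q by (simp_all add: \<alpha>_def \<beta>_def \<gamma>_def flip: distrib_left)
  have le': "\<alpha> \<le> 1/2" "\<beta> \<le> 1/2" "\<gamma> \<le> 1/2" if "\<kappa> \<noteq> 0"
  proof -
    have "\<alpha> \<le> q * \<rho>" "\<beta> \<le> q * \<rho>" "\<gamma> \<le> q * \<rho>"
      unfolding \<alpha>_def \<beta>_def \<gamma>_def using le q by (auto intro!: mult_left_mono)
    then show "\<alpha> \<le> 1/2" "\<beta> \<le> 1/2" "\<gamma> \<le> 1/2" using q\<rho>[OF that] by auto
  qed
  have unscale: "\<alpha> / q = a" "\<beta> / q = b" "\<gamma> / q = c" using q by (simp_all add: \<alpha>_def \<beta>_def \<gamma>_def)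
  consider "\<kappa> > 0" | "\<kappa> = 0" | "\<kappa> < 0" by linarith
  then show ?thesis
  proof cases
    case 1
    have "\<exists>u. u * sin \<beta> = cos \<gamma> - cos \<alpha> * cos \<beta> \<and> u\<^sup>2 \<le> (sin \<alpha>)\<^sup>2"
    proof (cases "\<beta> = 0")
      case True
      then have "\<alpha> = \<gamma>" using tri' by simp
      then show ?thesis using True by (intro exI[of _ 0]) simp
    next
      case False
      then have s: "sin \<beta> > 0" using n' le' 1 pi_gt3 by (intro sin_gt_zero) auto
      have "cos (\<alpha> + \<beta>) \<le> cos \<gamma>"
        using n' le' tri' 1 pi_gt3 by (auto intro!: cos_monotone_0_pi_le)
      moreover have "cos \<gamma> \<le> cos \<bar>\<alpha> - \<beta>\<bar>"
        by (rule cos_monotone_0_pi_le) (use n' le' tri' 1 pi_gt3 in auto)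
      ultimately have "\<bar>cos \<gamma> - cos \<alpha> * cos \<beta>\<bar> \<le> sin \<alpha> * sin \<beta>"
        by (simp add: cos_add cos_diff abs_le_iff)
      then have "\<bar>(cos \<gamma> - cos \<alpha> * cos \<beta>) / sin \<beta>\<bar> \<le> sin \<alpha>"
        using s by (simp add: pos_divide_le_eq)
      then have "((cos \<gamma> - cos \<alpha> * cos \<beta>) / sin \<beta>)\<^sup>2 \<le> (sin \<alpha>)\<^sup>2"
        unfolding abs_le_square_iff[symmetric] by linarith
      then show ?thesis
        using s by (intro exI[of _ "(cos \<gamma> - cos \<alpha> * cos \<beta>) / sin \<beta>"]) simp
    qed
    then obtain u where u: "u * sin \<beta> = cos \<gamma> - cos \<alpha> * cos \<beta>" "u\<^sup>2 \<le> (sin \<alpha>)\<^sup>2" by blast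
    define w where "w = sqrt ((sin \<alpha>)\<^sup>2 - u\<^sup>2)"
    have w: "u\<^sup>2 + w\<^sup>2 = (sin \<alpha>)\<^sup>2" using u(2) by (simp add: w_def)
    define x y z :: "real^3" where "x = vector [cos \<alpha>, u, w]" and "y = vector [1, 0, 0]" and "z = vector [cos \<beta>, sin \<beta>, 0]"
    have "x \<bullet> x = 1" using w sin_cos_squared_add[of \<alpha>]
      by (simp add: x_def inner_vec_def sum_3 power2_eq_square)
    moreover have "y \<bullet> y = 1" "z \<bullet> z = 1" using sin_cos_squared_add[of \<beta>]
      by (simp_all add: y_def z_def inner_vec_def sum_3 power2_eq_square)
    moreover have "x \<bullet> y = cos \<alpha>" "y \<bullet> z = cos \<beta>" "x \<bullet> z = cos \<gamma>"
      using u(1) by (simp_all add: x_def y_def z_def inner_vec_def sum_3 algebra_simps)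
    moreover have "arccos (cos \<alpha>) = \<alpha>" "arccos (cos \<beta>) = \<beta>" "arccos (cos \<gamma>) = \<gamma>"
      using n' le' 1 pi_gt3 by (auto intro!: arccos_cos)
    moreover have "sqrt \<kappa> = q" using 1 by (simp add: q_def)
    ultimately show ?thesis using 1 unscale
      by (intro bexI[of _ x] bexI[of _ y] bexI[of _ z]) (auto simp: model_points_def model_dist_def)
  next
    case 2
    have "\<exists>u. 2 * u * b = a\<^sup>2 + b\<^sup>2 - c\<^sup>2 \<and> u\<^sup>2 \<le> a\<^sup>2"
    proof (cases "b = 0")
      case True
      then have "a = c" using tri by simp
      then show ?thesis using True by (intro exI[of _ 0]) simp
    next
      case False
      then have s: "b > 0" using n by simp
      have "(c - (a - b)) * (c + (a - b)) \<ge> 0" "(a + b - c) * (a + b + c) \<ge> 0" using tri n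
        by (intro mult_nonneg_nonneg; simp)+
      then have "\<bar>a\<^sup>2 + b\<^sup>2 - c\<^sup>2\<bar> \<le> a * (2 * b)"
        by (simp add: abs_le_iff power2_eq_square algebra_simps)
      then have "\<bar>(a\<^sup>2 + b\<^sup>2 - c\<^sup>2) / (2 * b)\<bar> \<le> a"
        using s by (simp add: pos_divide_le_eq)
      then show ?thesis
        using s n by (intro exI[of _ "(a\<^sup>2 + b\<^sup>2 - c\<^sup>2) / (2 * b)"]) (simp add: abs_le_square_iff[symmetric])
    qed
    then obtain u where u: "2 * u * b = a\<^sup>2 + b\<^sup>2 - c\<^sup>2" "u\<^sup>2 \<le> a\<^sup>2" by blast
    define w where "w = sqrt (a\<^sup>2 - u\<^sup>2)"
    have w: "u\<^sup>2 + w\<^sup>2 = a\<^sup>2" using u(2) by (simp add: w_def)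
    define x y z :: "real^3" where "x = vector [u, w, 0]" and "y = vector [0, 0, 0]" and "z = vector [b, 0, 0]"
    have "(u - b)\<^sup>2 + w\<^sup>2 = c\<^sup>2"
      using w u(1) by (simp add: power2_eq_square algebra_simps)
    then have "dist x y = a" "dist y z = b" "dist x z = c"
      using w n by (simp_all add: x_def y_def z_def dist_vec_def L2_set_def sum_3 dist_real_def)
    then show ?thesis using 2
      by (intro bexI[of _ x] bexI[of _ y] bexI[of _ z])
        (auto simp: model_points_def model_dist_def x_def y_def z_def)
  next
    case 3
    have "\<exists>u. u * sinh \<beta> = cosh \<alpha> * cosh \<beta> - cosh \<gamma> \<and> u\<^sup>2 \<le> (sinh \<alpha>)\<^sup>2"
    proof (cases "\<beta> = 0")
      case True
      then have "\<alpha> = \<gamma>" using tri' by simp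
      then show ?thesis using True by (intro exI[of _ 0]) simp
    next
      case False
      then have s: "sinh \<beta> > 0" using n' by simp
      have "cosh \<gamma> \<le> cosh (\<alpha> + \<beta>)" "cosh \<bar>\<alpha> - \<beta>\<bar> \<le> cosh \<gamma>"
        using n' tri' by (subst cosh_real_nonneg_le_iff; auto)+
      then have "\<bar>cosh \<alpha> * cosh \<beta> - cosh \<gamma>\<bar> \<le> sinh \<alpha> * sinh \<beta>"
        by (simp add: cosh_add cosh_diff abs_le_iff)
      then have "\<bar>(cosh \<alpha> * cosh \<beta> - cosh \<gamma>) / sinh \<beta>\<bar> \<le> sinh \<alpha>"
        using s by (simp add: pos_divide_le_eq)
      then show ?thesis
        using s n' by (intro exI[of _ "(cosh \<alpha> * cosh \<beta> - cosh \<gamma>) / sinh \<beta>"]) (simp add: abs_le_square_iff[symmetric])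
    qed
    then obtain u where u: "u * sinh \<beta> = cosh \<alpha> * cosh \<beta> - cosh \<gamma>" "u\<^sup>2 \<le> (sinh \<alpha>)\<^sup>2" by blast
    define w where "w = sqrt ((sinh \<alpha>)\<^sup>2 - u\<^sup>2)"
    have w: "u\<^sup>2 + w\<^sup>2 = (sinh \<alpha>)\<^sup>2" using u(2) by (simp add: w_def)
    define x y z :: "real^3" where "x = vector [u, w, cosh \<alpha>]" and "y = vector [0, 0, 1]" and "z = vector [sinh \<beta>, 0, cosh \<beta>]"
    have "minkowski x x = - 1" using w sinh_square_eq[of \<alpha>]
      by (simp add: x_def minkowski_def power2_eq_square)
    moreover have "minkowski y y = - 1" "minkowski z z = - 1" using sinh_square_eq[of \<beta>]
      by (simp_all add: y_def z_def minkowski_def power2_eq_square)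
    moreover have "- minkowski x y = cosh \<alpha>" "- minkowski y z = cosh \<beta>" "- minkowski x z = cosh \<gamma>"
      using u(1) by (simp_all add: x_def y_def z_def minkowski_def algebra_simps)
    moreover have "arcosh (cosh \<alpha>) = \<alpha>" "arcosh (cosh \<beta>) = \<beta>" "arcosh (cosh \<gamma>) = \<gamma>"
      using n' by (auto intro!: arcosh_cosh_real)
    moreover have "x $ 3 > 0" "y $ 3 > 0" "z $ 3 > 0" by (simp_all add: x_def y_def z_def)
    moreover have "sqrt (- \<kappa>) = q" using 3 by (simp add: q_def)
    ultimately show ?thesis using 3 unscale
      by (intro bexI[of _ x] bexI[of _ y] bexI[of _ z])
        (auto simp: model_points_def model_dist_def simp del: minus_divide_left)
  qed
qed


lemma comparison_bounds_mono:
  assumes "comparison_bounds k \<rho> a b c t D'" "0 \<le> D" "D \<le> D'"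
  shows "comparison_bounds k \<rho> a b c t D"
proof -
  have "D\<^sup>2 \<le> D'\<^sup>2" using assms(2,3) by (intro power_mono)
  then show ?thesis using assms(1) unfolding comparison_bounds_def by linarith
qed

lemma CAT_geodesic_exists:
  assumes "CAT \<kappa> Z" "x \<in> mspace Z" "y \<in> mspace Z" "mdist Z x y \<le> \<rho>" "\<bar>\<kappa>\<bar> * \<rho>\<^sup>2 \<le> 1 / 4"
  shows "\<exists>c. geodesic Z x y c"
    and "ereal (mdist Z x y) < model_diam \<kappa>"
    and "ereal (3 * \<rho>) < 2 * model_diam \<kappa>"
proof -
  have *: "ereal (mdist Z x y) < model_diam \<kappa> \<and> ereal (3 * \<rho>) < 2 * model_diam \<kappa>"
  proof (cases "\<kappa> > 0")
    case True
    have "sqrt \<kappa> * \<rho> \<le> 1 / 2"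
    proof (rule power2_le_imp_le)
      show "(sqrt \<kappa> * \<rho>)\<^sup>2 \<le> (1 / 2)\<^sup>2" using True assms(5) by (simp add: power_mult_distrib power_divide)
    qed simp
    then have "\<rho> \<le> (1 / 2) / sqrt \<kappa>" using True by (simp add: field_simps)
    moreover have "(1 / 2) / sqrt \<kappa> < pi / sqrt \<kappa>" "3 * ((1 / 2) / sqrt \<kappa>) < 2 * (pi / sqrt \<kappa>)"
      using True pi_gt3 by (auto simp: divide_strict_right_mono field_simps)
    ultimately have 1: "mdist Z x y < pi / sqrt \<kappa>" "3 * \<rho> < 2 * (pi / sqrt \<kappa>)"
      using assms(4) by linarith+
    have "2 * model_diam \<kappa> = ereal (2 * (pi / sqrt \<kappa>))" using True by (simp add: model_diam_def)
    then show ?thesis using 1 True by (simp add: model_diam_def)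
  qed (simp add: model_diam_def)
  then show "ereal (mdist Z x y) < model_diam \<kappa>" "ereal (3 * \<rho>) < 2 * model_diam \<kappa>" by auto
  with assms show "\<exists>c. geodesic Z x y c" unfolding CAT_def by blast
qed

text \<open>Compare the vertex \<open>x\<close> with a point of the opposite side.\<close>

lemma CAT_comparison_bounds:
  assumes CAT: "CAT \<kappa> Z" and xyz: "x \<in> mspace Z" "y \<in> mspace Z" "z \<in> mspace Z"
    and le: "mdist Z x y \<le> \<rho>" "mdist Z y z \<le> \<rho>" "mdist Z x z \<le> \<rho>" and \<rho>: "\<bar>\<kappa>\<bar> * \<rho>\<^sup>2 \<le> 1 / 4"
    and c: "geodesic Z y z c" and t: "0 \<le> t" "t \<le> 1"
  shows "comparison_bounds \<bar>\<kappa>\<bar> \<rho> (mdist Z x y) (mdist Z y z) (mdist Z x z) t (mdist Z x (c (t * mdist Z y z)))"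
proof -
  have zx: "mdist Z z x = mdist Z x z" by (rule mdist_commute)
  obtain c0 where c0: "geodesic Z x y c0" using CAT_geodesic_exists(1)[OF CAT xyz(1,2) le(1) \<rho>] by blast
  obtain c2 where c2: "geodesic Z z x c2" using CAT_geodesic_exists(1)[OF CAT xyz(3,1) _ \<rho>] le(3) zx by auto
  define v where "v i = (if i = 0 then x else if i = 1 then y else z)" for i :: nat
  define C where "C i = (if i = 0 then c0 else if i = 1 then c else c2)" for i :: nat
  have less3: "i = 0 \<or> i = 1 \<or> i = 2" if "i < 3" for i :: nat using that by auto
  have T: "geodesic_triangle Z v C"
    unfolding geodesic_triangle_def using less3 c0 c c2 by (auto simp: v_def C_def dest!: less3)
  have sl: "side_length Z v 0 = mdist Z x y" "side_length Z v 1 = mdist Z y z" "side_length Z v 2 = mdist Z x z"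
    by (simp_all add: side_length_def v_def zx)
  have sum3: "(\<Sum>i<3. f i) = f 0 + f 1 + f 2" for f :: "nat \<Rightarrow> real"
    by (simp add: numeral_3_eq_3 numeral_2_eq_2)
  have "ereal (\<Sum>i<3. side_length Z v i) \<le> ereal (3 * \<rho>)" unfolding sum3 sl using le by simp
  then have per: "ereal (\<Sum>i<3. side_length Z v i) < 2 * model_diam \<kappa>"
    using CAT_geodesic_exists(3)[OF CAT xyz(1,2) le(1) \<rho>] by (rule order_le_less_trans)
  have triangle: "mdist Z u w \<le> mdist Z u v + mdist Z v w"
    if "u \<in> mspace Z" "v \<in> mspace Z" "w \<in> mspace Z" for u v w
    using Metric_space.triangle[OF Metric_space_mspace_mdist that] .
  have "mdist Z x y \<le> mdist Z y z + mdist Z x z" "mdist Z y z \<le> mdist Z x y + mdist Z x z"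
    "mdist Z x z \<le> mdist Z x y + mdist Z y z"
    using triangle[OF xyz(1,3,2)] triangle[OF xyz(2,1,3)] triangle[OF xyz]
    by (simp_all add: mdist_commute[of Z y x] mdist_commute[of Z z y])
  then obtain x' y' z' where
    P: "x' \<in> model_points \<kappa>" "y' \<in> model_points \<kappa>" "z' \<in> model_points \<kappa>" and
    d: "model_dist \<kappa> x' y' = mdist Z x y" "model_dist \<kappa> y' z' = mdist Z y z" "model_dist \<kappa> x' z' = mdist Z x z"
    using model_triangle[of "mdist Z x y" "mdist Z y z" "mdist Z x z" \<rho> \<kappa>] le \<rho> by auto
  have zx': "model_dist \<kappa> z' x' = mdist Z x z"
    using d(3) Metric_space.commute[OF Metric_space_model] by metis
  have lt: "ereal (model_dist \<kappa> x' y') < model_diam \<kappa>" "ereal (model_dist \<kappa> y' z') < model_diam \<kappa>"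
    "ereal (model_dist \<kappa> z' x') < model_diam \<kappa>"
    unfolding d zx' using CAT_geodesic_exists(2)[OF CAT] xyz le \<rho> by blast+
  obtain g0 g2 where g02: "geodesic (model_surface \<kappa>) x' y' g0" "geodesic (model_surface \<kappa>) z' x' g2"
    using model_geodesic[OF P(1,2) lt(1)] model_geodesic[OF P(3,1) lt(3)] by blast
  obtain g where g: "geodesic (model_surface \<kappa>) y' z' g"
    and gb: "comparison_bounds \<bar>\<kappa>\<bar> \<rho> (mdist Z x y) (mdist Z y z) (mdist Z x z) t (model_dist \<kappa> x' (g (t * mdist Z y z)))"
    using model_geodesic[OF P(2,3) lt(2)] P(1) le \<rho> t unfolding d by (metis d)
  define v' where "v' i = (if i = 0 then x' else if i = 1 then y' else z')" for i :: nat
  define C' where "C' i = (if i = 0 then g0 else if i = 1 then g else g2)" for i :: nat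
  have "geodesic_triangle (model_surface \<kappa>) v' C'"
    unfolding geodesic_triangle_def using g02 g by (auto simp: v'_def C'_def dest!: less3)
  moreover have "side_length (model_surface \<kappa>) v' i = side_length Z v i" if "i < 3" for i
    using less3[OF that] d zx' sl by (auto simp: side_length_def v'_def)
  ultimately have "comparison_triangle \<kappa> Z v v' C'" unfolding comparison_triangle_def by blast
  then have "\<forall>i<3. \<forall>j<3. \<forall>s\<in>{0..side_length Z v i}. \<forall>t\<in>{0..side_length Z v j}.
      mdist Z (C i s) (C j t) \<le> mdist (model_surface \<kappa>) (C' i s) (C' j t)"
    using CAT T per unfolding CAT_def by blast
  from this[rule_format, of 0 1 0 "t * mdist Z y z"]
  have "mdist Z (C 0 0) (C 1 (t * mdist Z y z)) \<le> model_dist \<kappa> (C' 0 0) (C' 1 (t * mdist Z y z))"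
    using t by (simp add: sl[unfolded One_nat_def] mult_left_le_one_le)
  moreover have "C 0 0 = x" "C' 0 0 = x'" "C 1 = c" "C' 1 = g"
    using c0 g02 by (simp_all add: C_def C'_def geodesic_def)
  ultimately have "mdist Z x (c (t * mdist Z y z)) \<le> model_dist \<kappa> x' (g (t * mdist Z y z))" by simp
  from comparison_bounds_mono[OF gb _ this] show ?thesis by simp
qed

section \<open>Small balls\<close>

lemma mdist_triangle:
  "\<lbrakk>x \<in> mspace X; y \<in> mspace X; z \<in> mspace X\<rbrakk> \<Longrightarrow> mdist X x z \<le> mdist X x y + mdist X y z"
  by (rule Metric_space.triangle[OF Metric_space_mspace_mdist])

lemma mdist_zero_iff: "\<lbrakk>x \<in> mspace X; y \<in> mspace X\<rbrakk> \<Longrightarrow> mdist X x y = 0 \<longleftrightarrow> x = y"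
  by (rule Metric_space.zero[OF Metric_space_mspace_mdist])

lemma mdist_self [simp]: "x \<in> mspace X \<Longrightarrow> mdist X x x = 0"
  by (simp add: mdist_zero_iff)

lemma geodesicD:
  assumes "geodesic X x y c"
  shows "s \<in> {0..mdist X x y} \<Longrightarrow> c s \<in> mspace X"
    and "\<lbrakk>s \<in> {0..mdist X x y}; t \<in> {0..mdist X x y}\<rbrakk> \<Longrightarrow> mdist X (c s) (c t) = \<bar>s - t\<bar>"
    and "c 0 = x" and "c (mdist X x y) = y"
  using assms unfolding geodesic_def by (blast intro: PiE_mem)+

lemma geodesic_dist_ends:
  assumes c: "geodesic X x y c" and s: "0 \<le> s" "s \<le> mdist X x y"
  shows "mdist X x (c s) = s" "mdist X (c s) y = mdist X x y - s"
  using geodesicD(2)[OF c, of 0 s] geodesicD(2)[OF c, of s "mdist X x y"] geodesicD(3,4)[OF c] s by auto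

lemma geodesic_restrict:
  assumes c: "geodesic X x y c" and s: "0 \<le> s" "s \<le> mdist X x y"
  shows "geodesic X x (c s) (restrict c {0..s})"
  using geodesic_dist_ends[OF c s] geodesicD[OF c] s unfolding geodesic_def
  by (auto simp: PiE_iff)

lemma geodesic_submetric:
  "geodesic (submetric X S) x y c \<longleftrightarrow> geodesic X x y c \<and> c ` {0..mdist X x y} \<subseteq> S"
  unfolding geodesic_def by (auto simp: PiE_iff image_subset_iff)

text \<open>
  What is used of the curvature bound in a small ball. Geodesics are required to run inside the
  ball, so that they can be used as sides of further triangles.
\<close>

locale convex_ball =
  fixes X :: "'a metric" and p :: 'a and R k :: real
  assumes p: "p \<in> mspace X" and R: "R > 0" and k: "0 \<le> k"
    and geod_ex: "\<And>u v. u \<in> mball_of X p R \<Longrightarrow> v \<in> mball_of X p R \<Longrightarrow>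
      \<exists>c. geodesic X u v c \<and> c ` {0..mdist X u v} \<subseteq> mball_of X p R"
    and bounds: "\<And>x y z c \<rho> t. \<lbrakk>x \<in> mball_of X p R; y \<in> mball_of X p R; z \<in> mball_of X p R;
      geodesic X y z c; c ` {0..mdist X y z} \<subseteq> mball_of X p R;
      mdist X x y \<le> \<rho>; mdist X y z \<le> \<rho>; mdist X x z \<le> \<rho>; \<rho> \<le> 2 * R; 0 \<le> t; t \<le> 1\<rbrakk> \<Longrightarrow>
      comparison_bounds k \<rho> (mdist X x y) (mdist X y z) (mdist X x z) t (mdist X x (c (t * mdist X y z)))"
begin

abbreviation "d \<equiv> mdist X"
abbreviation "B \<equiv> mball_of X p R"

lemma BX: "x \<in> B \<Longrightarrow> x \<in> mspace X" by simp

lemma d0 [simp]: "0 \<le> d x y" by simp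

lemma tri: "\<lbrakk>x \<in> mspace X; y \<in> mspace X; z \<in> mspace X\<rbrakk> \<Longrightarrow> d x z \<le> d x y + d y z"
  by (rule mdist_triangle)

lemma tri': "\<lbrakk>x \<in> mspace X; y \<in> mspace X; z \<in> mspace X\<rbrakk> \<Longrightarrow> d x z \<le> d x y + d z y"
  using mdist_triangle[of x X y z] by (simp add: mdist_commute)

lemma d_B: "\<lbrakk>x \<in> B; y \<in> B\<rbrakk> \<Longrightarrow> d x y < 2 * R"
  using tri[of x p y] by (simp add: mdist_commute)

lemma pB: "p \<in> B" using p R by simp

text \<open>The choice is unique: \<open>near_geodesic\<close> shows that only one geodesic in the ball joins \<open>u\<close> and \<open>v\<close>.\<close>

definition between :: "'a \<Rightarrow> 'a \<Rightarrow> real \<Rightarrow> 'a" where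
  "between u v t = (SOME c. geodesic X u v c \<and> c ` {0..d u v} \<subseteq> B) (t * d u v)"

context
  fixes u v t
  assumes u: "u \<in> B" and v: "v \<in> B" and t: "0 \<le> t" "t \<le> (1::real)"
begin

lemma between_geodesic: "\<exists>c. geodesic X u v c \<and> c ` {0..d u v} \<subseteq> B \<and> (\<forall>t. between u v t = c (t * d u v))"
proof -
  define c where "c = (SOME c. geodesic X u v c \<and> c ` {0..d u v} \<subseteq> B)"
  have "geodesic X u v c \<and> c ` {0..d u v} \<subseteq> B" unfolding c_def by (rule someI_ex[OF geod_ex[OF u v]])
  moreover have "between u v t = c (t * d u v)" for t by (simp add: between_def c_def)
  ultimately show ?thesis by blast
qed

lemma t_range: "t * d u v \<in> {0..d u v}"
  using t by (simp add: mult_left_le_one_le)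

lemma between_in_B: "between u v t \<in> B"
  using between_geodesic t_range by blast

lemma between_dist: "d u (between u v t) = t * d u v" "d v (between u v t) = (1 - t) * d u v"
proof -
  obtain c where c: "geodesic X u v c" "\<And>t. between u v t = c (t * d u v)" using between_geodesic by blast
  have r: "0 \<le> t * d u v" "t * d u v \<le> d u v" using t_range by auto
  show "d u (between u v t) = t * d u v"
    unfolding c(2) by (rule geodesic_dist_ends(1)[OF c(1) r])
  show "d v (between u v t) = (1 - t) * d u v"
    unfolding c(2) mdist_commute[of X v] geodesic_dist_ends(2)[OF c(1) r] by (simp add: left_diff_distrib)
qed

lemma between_bounds:
  assumes "x \<in> B" "d x u \<le> \<rho>" "d u v \<le> \<rho>" "d x v \<le> \<rho>" "\<rho> \<le> 2 * R"
  shows "comparison_bounds k \<rho> (d x u) (d u v) (d x v) t (d x (between u v t))"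
  using between_geodesic bounds[OF assms(1) u v _ _ assms(2-5) t] by metis

lemma between_max:
  assumes x: "x \<in> B" "d x u \<le> r" "d x v \<le> r"
  shows "(d x (between u v t))\<^sup>2 \<le> r\<^sup>2 - t * (1 - t) * (d u v)\<^sup>2 / 4"
proof -
  have "(d x (between u v t))\<^sup>2 \<le> (max (d x u) (d x v))\<^sup>2 - t * (1 - t) * (d u v)\<^sup>2 / 4"
    using between_bounds[OF x(1) less_imp_le[OF d_B[OF x(1) u]] less_imp_le[OF d_B[OF u v]]
        less_imp_le[OF d_B[OF x(1) v]] order_refl]
    unfolding comparison_bounds_def by blast
  moreover have "(max (d x u) (d x v))\<^sup>2 \<le> r\<^sup>2" using x by (intro power_mono) (auto simp: le_max_iff_disj)
  ultimately show ?thesis by linarith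
qed

lemma between_convex:
  assumes x: "x \<in> B" "d x u \<le> r" "d x v \<le> r"
  shows "d x (between u v t) \<le> r"
proof (rule power2_le_imp_le)
  have "0 \<le> t * (1 - t) * (d u v)\<^sup>2 / 4" using t by simp
  then show "(d x (between u v t))\<^sup>2 \<le> r\<^sup>2" using between_max[OF x] by linarith
  show "0 \<le> r" using x(2) d0[of x u] by linarith
qed

end

text \<open>
  A point \<open>m'\<close> whose distances from \<open>u\<close> and \<open>v\<close> exceed those of a point \<open>m\<close> of the geodesic by at
  most \<open>e\<close> is close to \<open>m\<close>: otherwise, by the convexity of balls, the midpoint of \<open>m\<close> and \<open>m'\<close> would
  be so close to \<open>u\<close> and \<open>v\<close> that the triangle inequality fails. This serves as a substitute for
  compactness. For \<open>e = 0\<close> it shows that geodesics are unique.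
\<close>

lemma near_geodesic:
  assumes B: "u \<in> B" "v \<in> B" "m \<in> B" "m' \<in> B" and ab: "a + b = d u v"
    and m: "d u m \<le> a" "d v m \<le> b" and m': "d u m' \<le> a + e" "d v m' \<le> b + e" and e: "0 \<le> e"
  shows "(d m m')\<^sup>2 \<le> 64 * (e * (a + e))"
proof -
  define h where "h = between m m' (1/2)"
  define q where "q = (d m m')\<^sup>2 / 16"
  have h: "h \<in> B" unfolding h_def by (rule between_in_B) (use B in auto)
  have X: "(d u h)\<^sup>2 \<le> (a + e)\<^sup>2 - q"
    using between_max[OF B(3,4) _ _ B(1), of "1/2" "a + e"] m m' e by (simp add: h_def q_def)
  have Y: "(d v h)\<^sup>2 \<le> (b + e)\<^sup>2 - q"
    using between_max[OF B(3,4) _ _ B(2), of "1/2" "b + e"] m m' e by (simp add: h_def q_def)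
  have q: "0 \<le> q" by (simp add: q_def)
  have a: "0 \<le> a" using m(1) d0[of u m] by linarith
  have b: "0 \<le> b" using m(2) d0[of v m] by linarith
  have "(d v h)\<^sup>2 \<le> (b + e)\<^sup>2" using Y q by linarith
  then have dv: "d v h \<le> b + e" by (rule power2_le_imp_le) (use b e in simp)
  have "(d u h)\<^sup>2 \<le> (a + e)\<^sup>2" using X q by linarith
  then have du: "d u h \<le> a + e" by (rule power2_le_imp_le) (use a e in simp)
  have s: "a + b \<le> d u h + d v h" using tri'[of u h v] B h ab by auto
  have "q \<le> (a + e - d u h) * (a + e + d u h)" using X by (simp add: algebra_simps power2_eq_square)
  also have "\<dots> \<le> (2 * e) * (2 * (a + e))"
    using s dv du a e by (intro mult_mono) auto
  finally show ?thesis by (simp add: q_def algebra_simps)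
qed

lemma between_continuity_estimate:
  assumes B: "u \<in> B" "v \<in> B" "u' \<in> B" "v' \<in> B" and t: "0 \<le> t" "t \<le> 1" "0 \<le> t'" "t' \<le> 1"
    and e: "e = \<bar>t' - t\<bar> * (2 * R) + 2 * d u' u + 2 * d v' v"
  shows "(d (between u' v' t') (between u v t))\<^sup>2 \<le> 64 * (e * (2 * R + e))"
proof -
  let ?m = "between u v t" and ?m' = "between u' v' t'"
  have m: "?m \<in> B" and m': "?m' \<in> B" using between_in_B B t by auto
  have uv: "d u' v' \<le> d u v + d u' u + d v' v"
    using tri[of u' u v'] tri'[of u v v'] B by auto
  have R': "d u v \<le> 2 * R" using d_B[OF B(1,2)] by simp
  have e0: "0 \<le> e" using R by (simp add: e)
  have move: "r' * d u' v' \<le> r * d u v + \<bar>r' - r\<bar> * (2 * R) + d u' u + d v' v" if r: "0 \<le> r'" "r' \<le> 1" for r r'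
  proof -
    have "r' * d u' v' \<le> r' * (d u v + d u' u + d v' v)" using uv r by (intro mult_left_mono) auto
    also have "\<dots> = r' * d u v + r' * (d u' u + d v' v)" by (simp add: algebra_simps)
    also have "r' * (d u' u + d v' v) \<le> d u' u + d v' v" using r by (intro mult_left_le_one_le) auto
    also have "r' * d u v = r * d u v + (r' - r) * d u v" by (simp add: algebra_simps)
    also have "(r' - r) * d u v \<le> \<bar>r' - r\<bar> * (2 * R)" using R' by (intro mult_mono) auto
    finally show ?thesis by simp
  qed
  have 1: "t' * d u' v' \<le> t * d u v + \<bar>t' - t\<bar> * (2 * R) + d u' u + d v' v" by (rule move[OF t(3,4)])
  have 2: "(1 - t') * d u' v' \<le> (1 - t) * d u v + \<bar>t' - t\<bar> * (2 * R) + d u' u + d v' v"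
    using move[of "1 - t'" "1 - t"] t by (simp add: abs_minus_commute)
  have X: "d u ?m' \<le> t * d u v + e"
  proof -
    have "d u ?m' \<le> d u' u + t' * d u' v'"
      using tri[OF BX BX BX, OF B(1,3) m'] by (simp add: between_dist(1)[OF B(3,4) t(3,4)] mdist_commute[of X u u'])
    then show ?thesis using 1 mdist_nonneg[of X v' v] unfolding e by linarith
  qed
  have Y: "d v ?m' \<le> (1 - t) * d u v + e"
  proof -
    have "d v ?m' \<le> d v' v + (1 - t') * d u' v'"
      using tri[OF BX BX BX, OF B(2,4) m'] by (simp add: between_dist(2)[OF B(3,4) t(3,4)] mdist_commute[of X v v'])
    then show ?thesis using 2 mdist_nonneg[of X u' u] unfolding e by linarith
  qed
  have "(d ?m ?m')\<^sup>2 \<le> 64 * (e * (t * d u v + e))"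
    by (rule near_geodesic[OF B(1,2) m m' _ _ _ X Y e0])
      (use between_dist[OF B(1,2) t(1,2)] in \<open>auto simp: algebra_simps\<close>)
  also have "\<dots> \<le> 64 * (e * (2 * R + e))"
  proof -
    have "t * d u v \<le> 1 * (2 * R)" using t R' R by (intro mult_mono) auto
    then show ?thesis using e0 by (intro mult_left_mono) auto
  qed
  finally show ?thesis by (simp add: mdist_commute)
qed

lemma between_tendsto:
  assumes B: "eventually (\<lambda>y. f y \<in> B) F" "eventually (\<lambda>y. g y \<in> B) F" "u \<in> B" "v \<in> B"
    and t: "eventually (\<lambda>y. 0 \<le> h y \<and> h y \<le> 1) F" "0 \<le> t" "t \<le> 1"
    and lim: "((\<lambda>y. d (f y) u) \<longlongrightarrow> 0) F" "((\<lambda>y. d (g y) v) \<longlongrightarrow> 0) F" "(h \<longlongrightarrow> t) F"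
  shows "((\<lambda>y. d (between (f y) (g y) (h y)) (between u v t)) \<longlongrightarrow> 0) F"
proof -
  define e where "e y = \<bar>h y - t\<bar> * (2 * R) + 2 * d (f y) u + 2 * d (g y) v" for y
  have "(e \<longlongrightarrow> \<bar>t - t\<bar> * (2 * R) + 2 * 0 + 2 * 0) F" unfolding e_def by (intro tendsto_intros lim)
  then have e: "(e \<longlongrightarrow> 0) F" by simp
  have "((\<lambda>y. sqrt (64 * (e y * (2 * R + e y)))) \<longlongrightarrow> sqrt (64 * (0 * (2 * R + 0)))) F"
    by (intro tendsto_intros e)
  then have s: "((\<lambda>y. sqrt (64 * (e y * (2 * R + e y)))) \<longlongrightarrow> 0) F" by simp
  show ?thesis
  proof (rule tendsto_sandwich[OF _ _ tendsto_const s])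
    show "eventually (\<lambda>y. d (between (f y) (g y) (h y)) (between u v t) \<le> sqrt (64 * (e y * (2 * R + e y)))) F"
      using B(1,2) t(1)
    proof eventually_elim
      case (elim y)
      then show ?case
        using between_continuity_estimate[OF B(3,4) elim(1,2) t(2,3) _ _ e_def] by (intro real_le_rsqrt) auto
    qed
  qed simp
qed

lemma between_ends:
  assumes "u \<in> B" "v \<in> B"
  shows "between u v 0 = u" "between u v 1 = v"
proof -
  obtain c where c: "geodesic X u v c" "\<forall>t. between u v t = c (t * d u v)"
    using between_geodesic[OF assms order_refl zero_le_one] by (elim exE conjE) (rule that)
  show "between u v 0 = u" "between u v 1 = v"
    using geodesicD(3,4)[OF c(1)] spec[OF c(2), of 0] spec[OF c(2), of 1] by simp_all
qed

lemma geodesic_between: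
  assumes c: "geodesic X u v c" "c ` {0..d u v} \<subseteq> B" and s: "0 \<le> s" "s \<le> d u v"
  shows "c s = between u v (s / d u v)"
proof -
  have ends: "c 0 = u" "c (d u v) = v" using geodesicD(3,4)[OF c(1)] by auto
  have "c 0 \<in> B" "c (d u v) \<in> B" "c s \<in> B" using c(2) s by (auto simp del: in_mball_of)
  then have B: "u \<in> B" "v \<in> B" "c s \<in> B" unfolding ends .
  define t where "t = s / d u v"
  have t: "0 \<le> t" "t \<le> 1" "t * d u v = s" using s by (auto simp: t_def divide_le_eq)
  have "(d (c s) (between u v t))\<^sup>2 \<le> 64 * (0 * (s + 0))"
    by (rule near_geodesic[OF B(1,2,3) between_in_B[OF B(1,2) t(1,2)], where b = "d u v - s"])
      (use geodesic_dist_ends[OF c(1) s] between_dist[OF B(1,2) t(1,2)] t(3) in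
       \<open>auto simp: mdist_commute algebra_simps\<close>)
  then have "d (c s) (between u v t) = 0" by simp
  then show ?thesis
    using mdist_zero_iff[of "c s" X "between u v t"] B between_in_B[OF B(1,2) t(1,2)] by (simp add: t_def)
qed

lemma geodesic_from_p_in_B:
  assumes c: "geodesic X p x c" and x: "x \<in> B"
  shows "c ` {0..d p x} \<subseteq> B"
  using geodesic_dist_ends(1)[OF c] geodesicD(1)[OF c] x p by auto

lemma geodesic_from_p_unique:
  assumes x: "x \<in> B" shows "\<exists>!c. geodesic X p x c"
proof -
  obtain c where c: "geodesic X p x c" using geod_ex[OF pB x] by blast
  moreover have "c' = c" if c': "geodesic X p x c'" for c'
  proof
    fix s show "c' s = c s"
    proof (cases "s \<in> {0..d p x}")
      case True
      then show ?thesis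
        using geodesic_between[OF c geodesic_from_p_in_B[OF c x]] geodesic_between[OF c' geodesic_from_p_in_B[OF c' x]]
        by simp
    next
      case False
      then show ?thesis using c c' unfolding geodesic_def by (auto simp: PiE_def extensional_def)
    qed
  qed
  ultimately show ?thesis by blast
qed

end

text \<open>
  Geodesics of \<open>S\<close> between points of the ball stay in it by the second comparison bound, applied to
  the centre as the vertex.
\<close>

lemma convex_ball_CAT:
  assumes CAT: "CAT \<kappa> (submetric X S)" and S: "mball_of X p R \<subseteq> S" and p: "p \<in> mspace X"
    and R: "R > 0" "\<bar>\<kappa>\<bar> * (2 * R)\<^sup>2 \<le> 1 / 4"
  shows "convex_ball X p R \<bar>\<kappa>\<bar>"
proof
  let ?B = "mball_of X p R"
  show "p \<in> mspace X" "R > 0" "0 \<le> \<bar>\<kappa>\<bar>" using p R by auto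
  have inS: "x \<in> mspace (submetric X S)" if "x \<in> ?B" for x using that S by auto
  have d2: "mdist X x y \<le> 2 * R" if "x \<in> ?B" "y \<in> ?B" for x y
    using that mdist_triangle[of x X p y] by (simp add: mdist_commute)
  note cb = CAT_comparison_bounds[OF CAT, simplified mdist_submetric]
  have cb': "comparison_bounds \<bar>\<kappa>\<bar> \<rho> (mdist X x y) (mdist X y z) (mdist X x z) t (mdist X x (c (t * mdist X y z)))"
    if "x \<in> ?B" "y \<in> ?B" "z \<in> ?B" "geodesic (submetric X S) y z c"
      "mdist X x y \<le> \<rho>" "mdist X y z \<le> \<rho>" "mdist X x z \<le> \<rho>" "\<rho> \<le> 2 * R" "0 \<le> t" "t \<le> 1" for x y z c \<rho> t
  proof (rule cb[OF inS inS inS])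
    have "0 \<le> \<rho>" using that(5) mdist_nonneg[of X x y] by linarith
    then have "\<rho>\<^sup>2 \<le> (2 * R)\<^sup>2" using that(8) by (intro power_mono)
    then have "\<bar>\<kappa>\<bar> * \<rho>\<^sup>2 \<le> \<bar>\<kappa>\<bar> * (2 * R)\<^sup>2" by (intro mult_left_mono) auto
    then show "\<bar>\<kappa>\<bar> * \<rho>\<^sup>2 \<le> 1 / 4" using R(2) by linarith
  qed (use that in auto)
  show "\<exists>c. geodesic X u v c \<and> c ` {0..mdist X u v} \<subseteq> ?B" if u: "u \<in> ?B" and v: "v \<in> ?B" for u v
  proof -
    obtain c where c: "geodesic (submetric X S) u v c"
      using CAT_geodesic_exists(1)[OF CAT inS[OF u] inS[OF v] _ R(2)] d2[OF u v] by auto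
    have "c s \<in> ?B" if s: "s \<in> {0..mdist X u v}" for s
    proof -
      define t where "t = s / mdist X u v"
      have t: "0 \<le> t" "t \<le> 1" "t * mdist X u v = s" using s by (auto simp: t_def divide_le_eq)
      have pB: "p \<in> ?B" using p R by simp
      have "(mdist X p (c s))\<^sup>2 \<le> (max (mdist X p u) (mdist X p v))\<^sup>2 - t * (1 - t) * (mdist X u v)\<^sup>2 / 4"
        using cb'[OF pB u v c _ _ _ order_refl t(1,2)] d2[OF pB u] d2[OF pB v] d2[OF u v]
        by (simp add: comparison_bounds_def t(3))
      moreover have "0 \<le> t * (1 - t) * (mdist X u v)\<^sup>2 / 4" using t by simp
      ultimately have "(mdist X p (c s))\<^sup>2 \<le> (max (mdist X p u) (mdist X p v))\<^sup>2" by linarith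
      then have "mdist X p (c s) \<le> max (mdist X p u) (mdist X p v)"
        by (rule power2_le_imp_le) (simp add: le_max_iff_disj)
      also have "\<dots> < R" using u v by simp
      finally show ?thesis using geodesicD(1)[OF c, of s] s p by simp
    qed
    then show ?thesis using c by (auto simp: geodesic_submetric)
  qed
  show "comparison_bounds \<bar>\<kappa>\<bar> \<rho> (mdist X x y) (mdist X y z) (mdist X x z) t (mdist X x (c (t * mdist X y z)))"
    if "x \<in> ?B" "y \<in> ?B" "z \<in> ?B" "geodesic X y z c" "c ` {0..mdist X y z} \<subseteq> ?B"
      "mdist X x y \<le> \<rho>" "mdist X y z \<le> \<rho>" "mdist X x z \<le> \<rho>" "\<rho> \<le> 2 * R" "0 \<le> t" "t \<le> 1" for x y z c \<rho> t
    by (rule cb') (use that S in \<open>auto simp: geodesic_submetric\<close>)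
qed

section \<open>Angles\<close>

text \<open>The limit is the infimum of \<open>\<phi> s + C * s\<^sup>2\<close>.\<close>

lemma almost_decreasing_limit:
  fixes \<phi> :: "real \<Rightarrow> real"
  assumes s0: "0 < s0" and nn: "\<And>s. \<lbrakk>0 < s; s \<le> s0\<rbrakk> \<Longrightarrow> 0 \<le> \<phi> s" and C: "0 \<le> C"
    and dec: "\<And>s' s. \<lbrakk>0 < s'; s' \<le> s; s \<le> s0\<rbrakk> \<Longrightarrow> \<phi> s' \<le> \<phi> s + C * s\<^sup>2"
  shows "\<exists>L. (\<phi> \<longlongrightarrow> L) (at_right 0) \<and> 0 \<le> L \<and> (\<forall>s. 0 < s \<and> s \<le> s0 \<longrightarrow> L \<le> \<phi> s + C * s\<^sup>2)"
proof -
  define V where "V = (\<lambda>s. \<phi> s + C * s\<^sup>2) ` {0<..s0}"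
  define L where "L = Inf V"
  have V: "0 \<le> v" if "v \<in> V" for v using that nn C by (auto simp: V_def)
  have bdd: "bdd_below V" using V by (rule bdd_belowI)
  have ne: "V \<noteq> {}" using s0 by (auto simp: V_def)
  have low: "L \<le> \<phi> s + C * s\<^sup>2" if "0 < s" "s \<le> s0" for s
    unfolding L_def by (rule cInf_lower[OF _ bdd]) (use that in \<open>auto simp: V_def\<close>)
  have "(\<phi> \<longlongrightarrow> L) (at_right 0)"
  proof (rule tendstoI)
    fix e :: real assume e: "e > 0"
    obtain v where v: "v \<in> V" "v < L + e" using cInf_lessD[OF ne, of "L + e"] e by (auto simp: L_def)
    then obtain s where s: "0 < s" "s \<le> s0" "\<phi> s + C * s\<^sup>2 < L + e" by (auto simp: V_def)
    have "((\<lambda>s. C * s\<^sup>2) \<longlongrightarrow> C * 0\<^sup>2) (at_right 0)" by (intro tendsto_intros)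
    then have small: "eventually (\<lambda>t. C * t\<^sup>2 < e) (at_right 0)" using e order_tendstoD(2)[of _ "0::real"] by simp
    have "eventually (\<lambda>t. t < s) (at_right 0)" "eventually (\<lambda>t. 0 < t) (at_right (0::real))"
      using s(1) by (auto simp: eventually_at_right_field)
    then show "eventually (\<lambda>t. dist (\<phi> t) L < e) (at_right 0)" using small
    proof eventually_elim
      case (elim t)
      then show ?case using dec[of t s] low[of t] s by (simp add: dist_real_def)
    qed
  qed
  moreover have "0 \<le> L" unfolding L_def using ne V by (rule cInf_greatest)
  ultimately show ?thesis using low by blast
qed

lemma le_four_sin: "x \<le> 4 * sin x" if "0 \<le> x" "x \<le> pi / 2" for x :: real
proof (cases "x \<le> pi / 3")
  case True
  have der: "\<exists>D. ((\<lambda>t. 4 * sin t - t) has_real_derivative D) (at t) \<and> 0 \<le> D" if t: "0 \<le> t" "t \<le> x" for t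
  proof (intro exI conjI)
    show "((\<lambda>t. 4 * sin t - t) has_real_derivative 4 * cos t - 1) (at t)"
      by (rule derivative_eq_intros refl | simp)+
    have "cos (pi / 3) \<le> cos t" using t True by (intro cos_monotone_0_pi_le) auto
    then show "0 \<le> 4 * cos t - 1" by (simp add: cos_60)
  qed
  have "4 * sin 0 - 0 \<le> 4 * sin x - x"
    by (rule DERIV_nonneg_imp_nondecreasing[where f = "\<lambda>t. 4 * sin t - t"]) (rule that(1), rule der)
  then show ?thesis by simp
next
  case False
  then have "sin (pi / 3) \<le> sin x" using that by (subst sin_mono_le_eq) auto
  moreover have "1 / 2 \<le> sin (pi / 3)" using real_le_rsqrt[of 1 3] by (simp add: sin_60)
  ultimately show ?thesis using that pi_less_4 by linarith
qed

text \<open>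
  In the Euclidean plane, take unit vectors \<open>e\<close> and \<open>e'\<close> that enclose the angle \<open>\<alpha> + \<beta>\<close>. The ray that
  splits it into \<open>\<alpha>\<close> and \<open>\<beta>\<close> meets the segment from \<open>e\<close> to \<open>e'\<close> at distance \<open>b\<close> from the origin. The
  square roots are the lengths of the two parts of the segment, and \<open>2 * sin S\<close> is its length.
\<close>

lemma angle_split:
  fixes \<alpha> \<beta> :: real
  assumes "0 \<le> \<alpha>" "0 \<le> \<beta>" "\<alpha> + \<beta> < pi"
  defines "S \<equiv> (\<alpha> + \<beta>) / 2"
  shows "\<exists>b>0. b \<le> 1 \<and> sqrt (1 + b\<^sup>2 - 2 * b * cos \<alpha>) + sqrt (1 + b\<^sup>2 - 2 * b * cos \<beta>) = 2 * sin S"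
proof -
  define \<delta> where "\<delta> = (\<alpha> - \<beta>) / 2"
  have S: "0 \<le> S" "S < pi / 2" "\<bar>\<delta>\<bar> \<le> S" using assms by (auto simp: S_def \<delta>_def)
  have eq: "\<alpha> = S + \<delta>" "\<beta> = S - \<delta>" by (simp_all add: S_def \<delta>_def field_simps)
  have cS: "cos S > 0" and cd: "cos \<delta> > 0" using S by (auto intro!: cos_gt_zero_pi)
  have "cos S \<le> cos \<bar>\<delta>\<bar>" by (rule cos_monotone_0_pi_le) (use S in auto)
  then have le: "cos S \<le> cos \<delta>" by simp
  define b where "b = cos S / cos \<delta>"
  have b: "0 < b" "b \<le> 1" "cos S = b * cos \<delta>" using cS cd le by (auto simp: b_def divide_le_eq)
  have ds: "\<bar>b * sin \<delta>\<bar> \<le> sin S"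
  proof -
    have "\<bar>sin \<delta>\<bar> = sin \<bar>\<delta>\<bar>" using S sin_ge_zero[of "\<bar>\<delta>\<bar>"] by (auto simp: abs_if split: if_splits)
    also have "\<dots> \<le> sin S" using S by (subst sin_mono_le_eq) auto
    finally have "\<bar>sin \<delta>\<bar> \<le> sin S" .
    then have "b * \<bar>sin \<delta>\<bar> \<le> 1 * sin S" using b by (intro mult_mono) auto
    then show ?thesis using b by (simp add: abs_mult)
  qed
  have sq: "1 + b\<^sup>2 - 2 * b * cos (S + x) = (sin S + b * sin x)\<^sup>2" if "cos x = cos \<delta>" for x
  proof -
    have bx: "b * cos x = cos S" using b that by simp
    have "2 * b * cos (S + x) = 2 * cos S * (b * cos x) - 2 * b * sin S * sin x"
      by (simp add: cos_add algebra_simps)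
    also have "\<dots> = 2 * (cos S)\<^sup>2 - 2 * b * sin S * sin x" by (simp add: bx power2_eq_square)
    finally have 1: "2 * b * cos (S + x) = 2 * (cos S)\<^sup>2 - 2 * b * sin S * sin x" .
    have "b\<^sup>2 = b\<^sup>2 * ((sin x)\<^sup>2 + (cos x)\<^sup>2)" by simp
    also have "\<dots> = b\<^sup>2 * (sin x)\<^sup>2 + (b * cos x)\<^sup>2" by (simp only: power_mult_distrib distrib_left)
    finally have 2: "b\<^sup>2 = b\<^sup>2 * (sin x)\<^sup>2 + (cos S)\<^sup>2" unfolding bx .
    show ?thesis unfolding 1 using 2
      by (simp add: power2_sum power_mult_distrib sin_squared_eq[of S])
  qed
  have "sqrt (1 + b\<^sup>2 - 2 * b * cos \<alpha>) = sin S + b * sin \<delta>" "sqrt (1 + b\<^sup>2 - 2 * b * cos \<beta>) = sin S - b * sin \<delta>"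
    using sq[of \<delta>] sq[of "- \<delta>"] ds by (simp_all add: eq)
  then show ?thesis using b by (intro exI[of _ b]) auto
qed

text \<open>
  The angle is defined on a ball of radius \<open>R0\<close>, which may be much larger than the radius \<open>R\<close> for
  which the bounds hold. All that matters of a point of the large ball is the beginning of its
  geodesic from \<open>p\<close>.
\<close>

locale direction_ball = convex_ball +
  fixes R0 :: real
  assumes R0: "R \<le> R0"
    and unique_geodesic: "\<And>x. x \<in> mball_of X p R0 - {p} \<Longrightarrow> \<exists>!c. geodesic X p x c"
begin

abbreviation "A0 \<equiv> mball_of X p R0 - {p}"
abbreviation "A \<equiv> B - {p}"

lemma A_A0: "x \<in> A \<Longrightarrow> x \<in> A0" using R0 by auto

lemma A0_pos: "x \<in> A0 \<Longrightarrow> 0 < d p x"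
  using mdist_zero_iff[of p X x] mdist_nonneg[of X p x] p by (auto simp del: mdist_nonneg simp: less_le)

definition ray :: "'a \<Rightarrow> real \<Rightarrow> 'a" where "ray u = (THE c. geodesic X p u c)"

lemma ray_geodesic: "u \<in> A0 \<Longrightarrow> geodesic X p u (ray u)"
  unfolding ray_def by (rule theI'[OF unique_geodesic])

lemma ray_eqI: "\<lbrakk>u \<in> A0; geodesic X p u c\<rbrakk> \<Longrightarrow> ray u = c"
  using unique_geodesic ray_geodesic by blast

context
  fixes u s
  assumes u: "u \<in> A0" and s: "0 \<le> s" "s \<le> d p u"
begin

lemma ray_dist: "d p (ray u s) = s" "d (ray u s) u = d p u - s"
  using geodesic_dist_ends[OF ray_geodesic[OF u] s] by auto

lemma ray_in: "ray u s \<in> mspace X" using geodesicD(1)[OF ray_geodesic[OF u]] s by auto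

lemma ray_in_B: "s < R \<Longrightarrow> ray u s \<in> B" using ray_in ray_dist p by simp

lemma ray_in_A0: "0 < s \<Longrightarrow> ray u s \<in> A0"
  using ray_in ray_dist p u s by auto

lemma ray_in_A: "\<lbrakk>0 < s; s < R\<rbrakk> \<Longrightarrow> ray u s \<in> A"
  using ray_in_B ray_in_A0 by blast

lemma ray_dist_ray: "\<lbrakk>0 \<le> t; t \<le> d p u\<rbrakk> \<Longrightarrow> d (ray u s) (ray u t) = \<bar>s - t\<bar>"
  using geodesicD(2)[OF ray_geodesic[OF u]] s by auto

lemma ray_ray:
  assumes "0 < s" "0 \<le> t" "t \<le> s"
  shows "ray (ray u s) t = ray u t"
proof -
  have "ray (ray u s) = restrict (ray u) {0..s}"
    by (rule ray_eqI[OF ray_in_A0[OF assms(1)] geodesic_restrict[OF ray_geodesic[OF u] s]])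
  then show ?thesis using assms by simp
qed

text \<open>
  The triangle with vertices \<open>x\<close>, \<open>p\<close> and \<open>ray u s\<close> has sides of length at most \<open>2 * \<sigma>\<close>, which
  explains the constant \<open>64 = 4 * 2 ^ 4\<close>.
\<close>

lemma ray_bound:
  assumes sR: "s \<le> \<sigma>" "\<sigma> < R" and x: "x \<in> B" "d p x \<le> \<sigma>" and l: "0 \<le> l" "l \<le> 1"
  shows "(d x (ray u (l * s)))\<^sup>2 \<le> (1 - l) * (d p x)\<^sup>2 + l * (d x (ray u s))\<^sup>2 - l * (1 - l) * s\<^sup>2 + 64 * k * \<sigma> ^ 4"
proof -
  have rB: "ray u s \<in> B" using ray_in_B sR by simp
  have g: "geodesic X p (ray u s) (restrict (ray u) {0..s})"
    by (rule geodesic_restrict[OF ray_geodesic[OF u] s])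
  have dx: "d x (ray u s) \<le> 2 * \<sigma>"
    using tri[OF BX BX BX, OF x(1) pB rB] x(2) sR(1) by (simp add: ray_dist mdist_commute)
  have "comparison_bounds k (2 * \<sigma>) (d x p) (d p (ray u s)) (d x (ray u s)) l
     (d x (restrict (ray u) {0..s} (l * d p (ray u s))))"
    by (rule bounds[OF x(1) pB rB g geodesic_from_p_in_B[OF g rB]])
      (use dx x s sR l in \<open>auto simp: ray_dist mdist_commute\<close>)
  moreover have "restrict (ray u) {0..s} (l * s) = ray u (l * s)"
    using s l by (simp add: mult_left_le_one_le)
  ultimately show ?thesis
    by (simp add: comparison_bounds_def ray_dist mdist_commute power_mult_distrib)
qed

end

lemma ray_ends: "u \<in> A0 \<Longrightarrow> ray u 0 = p" "u \<in> A0 \<Longrightarrow> ray u (d p u) = u"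
  using geodesicD(3,4)[OF ray_geodesic] by auto

definition chord_ratio_sq :: "'a \<Rightarrow> 'a \<Rightarrow> real \<Rightarrow> real" where "chord_ratio_sq u v s = (d (ray u s) (ray v s) / s)\<^sup>2"

text \<open>
  Apply \<open>ray_bound\<close> twice, to move first one and then the other end of the chord towards \<open>p\<close>. The
  main terms give exactly \<open>l\<^sup>2\<close> times the square of the chord. As the error is divided by \<open>l\<^sup>2\<close>, the
  factor \<open>l\<close> is kept away from \<open>0\<close>.
\<close>

lemma chord_ratio_step:
  assumes uv: "u \<in> A0" "v \<in> A0" and s: "0 < s" "s \<le> d p u" "s \<le> d p v" "s < R" and l: "1 / 2 \<le> l" "l \<le> 1"
  shows "chord_ratio_sq u v (l * s) \<le> chord_ratio_sq u v s + 512 * k * s\<^sup>2"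
proof -
  define D where "D = (d (ray u s) (ray v s))\<^sup>2"
  have l0: "0 \<le> l" "l > 0" using l by auto
  have ls: "0 \<le> l * s" "l * s \<le> s" "l * s \<le> d p u" "l * s \<le> d p v" "l * s < R"
  proof -
    show "0 \<le> l * s" using l0 s by simp
    show "l * s \<le> s" using l l0 s by (intro mult_left_le_one_le) auto
    then show "l * s \<le> d p u" "l * s \<le> d p v" "l * s < R" using s(2-4) by linarith+
  qed
  have s0: "0 \<le> s" using s by simp
  have 1: "(d (ray v s) (ray u (l * s)))\<^sup>2 \<le> (1 - l) * s\<^sup>2 + l * D - l * (1 - l) * s\<^sup>2 + 64 * k * s ^ 4"
    using ray_bound[OF uv(1) s0 s(2) order_refl s(4) ray_in_B[OF uv(2) s0 s(3,4)] _ l0(1) l(2)]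
    by (simp add: ray_dist[OF uv(2) s0 s(3)] D_def mdist_commute[of X "ray v s" "ray u s"])
  have 2: "(d (ray u (l * s)) (ray v (l * s)))\<^sup>2 \<le>
     (1 - l) * (l * s)\<^sup>2 + l * (d (ray u (l * s)) (ray v s))\<^sup>2 - l * (1 - l) * s\<^sup>2 + 64 * k * s ^ 4"
    using ray_bound[OF uv(2) s0 s(3) order_refl s(4) ray_in_B[OF uv(1) ls(1,3,5)] _ l0(1) l(2)]
    by (simp add: ray_dist[OF uv(1) ls(1,3)] ls)
  have ks: "0 \<le> k * s ^ 4" using k s by simp
  have "l * (d (ray u (l * s)) (ray v s))\<^sup>2 \<le> l * ((1 - l) * s\<^sup>2 + l * D - l * (1 - l) * s\<^sup>2 + 64 * k * s ^ 4)"
    using 1 l0 by (intro mult_left_mono) (simp_all add: mdist_commute)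
  moreover have "l * (64 * (k * s ^ 4)) \<le> 64 * (k * s ^ 4)"
    using l l0 ks by (intro mult_left_le_one_le) auto
  moreover have "(1 - l) * (l * s)\<^sup>2 + l * ((1 - l) * s\<^sup>2 + l * D - l * (1 - l) * s\<^sup>2 + 64 * k * s ^ 4)
      - l * (1 - l) * s\<^sup>2 + 64 * k * s ^ 4 = l\<^sup>2 * D + l * (64 * (k * s ^ 4)) + 64 * (k * s ^ 4)"
    by algebra
  ultimately have "(d (ray u (l * s)) (ray v (l * s)))\<^sup>2 \<le> l\<^sup>2 * D + 128 * (k * s ^ 4)"
    using 2 by linarith
  then have "chord_ratio_sq u v (l * s) \<le> (l\<^sup>2 * D + 128 * (k * s ^ 4)) / (l * s)\<^sup>2"
    unfolding chord_ratio_sq_def power_divide by (intro divide_right_mono) auto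
  also have "\<dots> = D / s\<^sup>2 + 128 * k * s\<^sup>2 / l\<^sup>2"
  proof -
    define a b where "a = l\<^sup>2" and "b = s\<^sup>2"
    have "a > 0" "b > 0" using l0 s by (simp_all add: a_def b_def)
    then have "(a * D + 128 * (k * (b * b))) / (a * b) = D / b + 128 * k * b / a" by (simp add: field_simps)
    moreover have eq: "s ^ 4 = b * b" "(l * s)\<^sup>2 = a * b"
      unfolding a_def b_def by (simp_all add: power_mult_distrib flip: power_add)
    ultimately show ?thesis unfolding eq a_def[symmetric] b_def[symmetric] by blast
  qed
  also have "128 * k * s\<^sup>2 / l\<^sup>2 \<le> 128 * k * s\<^sup>2 / (1 / 2)\<^sup>2"
    using l k by (intro divide_left_mono power_mono mult_pos_pos zero_less_power) auto
  finally show ?thesis by (simp add: chord_ratio_sq_def D_def power_divide)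
qed

text \<open>
  Halve \<open>s\<close> repeatedly. The errors form a geometric series: \<open>512 + 700 / 4 \<le> 700\<close>.
\<close>

lemma chord_ratio_decreasing:
  assumes uv: "u \<in> A0" "v \<in> A0" and s: "0 < s'" "s' \<le> s" "s \<le> d p u" "s \<le> d p v" "s < R"
  shows "chord_ratio_sq u v s' \<le> chord_ratio_sq u v s + 700 * k * s\<^sup>2"
proof -
  have "chord_ratio_sq u v s' \<le> chord_ratio_sq u v s + 700 * k * s\<^sup>2"
    if "s \<le> 2 ^ n * s'" "s' \<le> s" "s \<le> d p u" "s \<le> d p v" "s < R" for n s
    using that
  proof (induction n arbitrary: s)
    case 0
    then have "s = s'" by simp
    then show ?case using k by simp
  next
    case (Suc n)
    have sp: "0 < s" using s(1) Suc.prems by simp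
    have ks: "0 \<le> k * s\<^sup>2" using k by simp
    show ?case
    proof (cases "s \<le> 2 * s'")
      case True
      then have "chord_ratio_sq u v ((s' / s) * s) \<le> chord_ratio_sq u v s + 512 * k * s\<^sup>2"
        using sp Suc.prems by (intro chord_ratio_step[OF uv]) (auto simp: field_simps)
      then show ?thesis using sp ks by simp
    next
      case False
      have "chord_ratio_sq u v s' \<le> chord_ratio_sq u v (s / 2) + 700 * k * (s / 2)\<^sup>2"
        using Suc.prems False sp by (intro Suc.IH) auto
      moreover have "chord_ratio_sq u v ((1 / 2) * s) \<le> chord_ratio_sq u v s + 512 * k * s\<^sup>2"
        using sp Suc.prems by (intro chord_ratio_step[OF uv]) auto
      ultimately show ?thesis using ks by (simp add: power_divide)
    qed
  qed
  moreover obtain n :: nat where "s / s' < 2 ^ n" using real_arch_pow[of 2] by auto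
  then have "s \<le> 2 ^ n * s'" using s(1) by (simp add: field_simps)
  ultimately show ?thesis using s by blast
qed

abbreviation "ang \<equiv> angle_at X p"

lemma ray_chord_le:
  assumes uv: "u \<in> A0" "v \<in> A0" and s: "0 \<le> s" "s \<le> d p u" "s \<le> d p v"
  shows "d (ray u s) (ray v s) \<le> 2 * s"
  using tri'[OF ray_in[OF uv(1) s(1,2)] p ray_in[OF uv(2) s(1,3)]]
  by (simp add: ray_dist[OF uv(1) s(1,2)] ray_dist[OF uv(2) s(1,3)] mdist_commute[of X _ p])

text \<open>
  The quotient of chord and distance has a limit by almost monotonicity, and the angle is
  defined in such a way that this limit is \<open>2 * sin (\<alpha> / 2)\<close>.
\<close>

lemma angle_facts:
  assumes uv: "u \<in> A0" "v \<in> A0"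
  shows angle_range: "0 \<le> ang u v" "ang u v \<le> pi"
    and angle_tendsto: "((\<lambda>s. d (ray u s) (ray v s) / s) \<longlongrightarrow> 2 * sin (ang u v / 2)) (at_right 0)"
    and angle_bound: "\<lbrakk>0 < s; s \<le> d p u; s \<le> d p v; s < R\<rbrakk> \<Longrightarrow>
       (2 * sin (ang u v / 2))\<^sup>2 \<le> chord_ratio_sq u v s + 700 * k * s\<^sup>2"
proof -
  define s0 where "s0 = min (R / 2) (min (d p u) (d p v))"
  have s0: "0 < s0" using R A0_pos[OF uv(1)] A0_pos[OF uv(2)] by (simp add: s0_def)
  have s0': "s \<le> d p u" "s \<le> d p v" "s < R" if "s \<le> s0" for s using that R by (auto simp: s0_def)
  have "\<exists>L. (chord_ratio_sq u v \<longlongrightarrow> L) (at_right 0) \<and> 0 \<le> L \<and> (\<forall>s. 0 < s \<and> s \<le> s0 \<longrightarrow> L \<le> chord_ratio_sq u v s + (700 * k) * s\<^sup>2)"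
    by (rule almost_decreasing_limit[OF s0]) (use k s0' chord_ratio_decreasing[OF uv] in \<open>auto simp: chord_ratio_sq_def\<close>)
  then obtain L where L: "(chord_ratio_sq u v \<longlongrightarrow> L) (at_right 0)" "0 \<le> L" by blast
  have ev: "eventually (\<lambda>s. 0 < s \<and> s \<le> s0) (at_right 0)"
    using s0 by (auto simp: eventually_at_right_field intro: exI[of _ s0])
  have "((\<lambda>s. sqrt (chord_ratio_sq u v s)) \<longlongrightarrow> sqrt L) (at_right 0)" by (intro tendsto_intros L)
  moreover have "eventually (\<lambda>s. sqrt (chord_ratio_sq u v s) = d (ray u s) (ray v s) / s) (at_right 0)"
    using ev by eventually_elim (simp add: chord_ratio_sq_def)
  ultimately have lim: "((\<lambda>s. d (ray u s) (ray v s) / s) \<longlongrightarrow> sqrt L) (at_right 0)"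
    by (rule Lim_transform_eventually)
  have r: "eventually (\<lambda>s. d (ray u s) (ray v s) / (2 * s) \<in> {- 1..1}) (at_right 0)"
    using ev
  proof eventually_elim
    case (elim s)
    then have "d (ray u s) (ray v s) \<le> 2 * s" using s0' by (intro ray_chord_le[OF uv]) auto
    then have "d (ray u s) (ray v s) / (2 * s) \<le> 1" using elim by (simp add: divide_le_eq_1)
    moreover have "0 \<le> d (ray u s) (ray v s) / (2 * s)" using elim by (intro divide_nonneg_nonneg) auto
    ultimately show ?case unfolding atLeastAtMost_iff by linarith
  qed
  have lim2: "((\<lambda>s. d (ray u s) (ray v s) / (2 * s)) \<longlongrightarrow> sqrt L / 2) (at_right 0)"
    using tendsto_divide[OF lim tendsto_const[of 2]] by (simp add: mult.commute)
  have rL: "sqrt L / 2 \<in> {- 1..1}"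
  proof -
    have "sqrt L / 2 \<le> 1"
      by (rule tendsto_upperbound[OF lim2]) (use r in \<open>auto elim: eventually_mono\<close>)
    moreover have "0 \<le> sqrt L / 2" using L(2) by simp
    ultimately show ?thesis unfolding atLeastAtMost_iff by linarith
  qed
  have "((\<lambda>s. arcsin (d (ray u s) (ray v s) / (2 * s))) \<longlongrightarrow> arcsin (sqrt L / 2)) (at_right 0)"
    using continuous_on_tendsto_compose[OF continuous_on_arcsin' lim2 rL r] .
  then have ang: "ang u v = 2 * arcsin (sqrt L / 2)"
    unfolding angle_at_def alexandrov_angle_def ray_def[symmetric]
    by (simp add: tendsto_Lim trivial_limit_at_right_real)
  have sL: "0 \<le> sqrt L / 2" using L by simp
  have "0 \<le> arcsin (sqrt L / 2)" using sL rL arcsin_le_arcsin[of 0 "sqrt L / 2"] by simp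
  then show "0 \<le> ang u v" using ang by simp
  show "ang u v \<le> pi" using ang arcsin_bounded[of "sqrt L / 2"] rL by auto
  have sin: "2 * sin (ang u v / 2) = sqrt L" using rL by (simp add: ang)
  show "((\<lambda>s. d (ray u s) (ray v s) / s) \<longlongrightarrow> 2 * sin (ang u v / 2)) (at_right 0)" unfolding sin by (rule lim)
  show "(2 * sin (ang u v / 2))\<^sup>2 \<le> chord_ratio_sq u v s + 700 * k * s\<^sup>2"
    if s: "0 < s" "s \<le> d p u" "s \<le> d p v" "s < R"
  proof -
    have "eventually (\<lambda>t. chord_ratio_sq u v t \<le> chord_ratio_sq u v s + 700 * k * s\<^sup>2) (at_right 0)"
      using s chord_ratio_decreasing[OF uv _ _ s(2-4)] by (auto simp: eventually_at_right_field intro!: exI[of _ s])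
    then have "L \<le> chord_ratio_sq u v s + 700 * k * s\<^sup>2"
      by (rule tendsto_upperbound[OF L(1)]) (simp add: trivial_limit_at_right_real)
    then show ?thesis unfolding sin using L(2) by simp
  qed
qed

lemma angle_eqI:
  assumes uv: "u \<in> A0" "v \<in> A0" "u' \<in> A0" "v' \<in> A0"
    and eq: "eventually (\<lambda>s. d (ray u s) (ray v s) = d (ray u' s) (ray v' s)) (at_right 0)"
  shows "ang u v = ang u' v'"
proof -
  have "eventually (\<lambda>s. d (ray u s) (ray v s) / s = d (ray u' s) (ray v' s) / s) (at_right 0)"
    using eq by eventually_elim simp
  note L = Lim_transform_eventually[OF angle_tendsto[OF uv(1,2)] this]
  have "2 * sin (ang u v / 2) = 2 * sin (ang u' v' / 2)"
    by (rule tendsto_unique[OF trivial_limit_at_right_real L angle_tendsto[OF uv(3,4)]])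
  then have "sin (ang u v / 2) = sin (ang u' v' / 2)" by simp
  then have "ang u v / 2 = ang u' v' / 2"
    by (rule sin_inj_pi[rotated 4]) (use angle_range[OF uv(1,2)] angle_range[OF uv(3,4)] in auto)
  then show ?thesis by simp
qed

lemma angle_sym: "\<lbrakk>u \<in> A0; v \<in> A0\<rbrakk> \<Longrightarrow> ang u v = ang v u"
  by (rule angle_eqI) (simp_all add: mdist_commute)

lemma angle_self: "u \<in> A0 \<Longrightarrow> ang u u = 0"
proof -
  assume u: "u \<in> A0"
  have "eventually (\<lambda>s. 0 = d (ray u s) (ray u s) / s) (at_right 0)"
    using A0_pos[OF u] ray_in[OF u] unfolding eventually_at_right_field by (intro exI[of _ "d p u"]) auto
  note L = Lim_transform_eventually[OF tendsto_const this]
  have "2 * sin (ang u u / 2) = 0"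
    by (rule tendsto_unique[OF trivial_limit_at_right_real angle_tendsto[OF u u] L])
  then have "sin (ang u u / 2) = sin 0" by simp
  then have "ang u u / 2 = 0"
    by (rule sin_inj_pi[rotated 4]) (use angle_range[OF u u] in auto)
  then show ?thesis by simp
qed

lemma angle_ray:
  assumes u: "u \<in> A0" and v: "v \<in> A0" and s: "0 < s" "s \<le> d p u"
  shows "ang (ray u s) v = ang u v"
proof (rule angle_eqI[OF ray_in_A0[OF u _ s(2) s(1)] v u v])
  show "eventually (\<lambda>t. d (ray (ray u s) t) (ray v t) = d (ray u t) (ray v t)) (at_right 0)"
    using ray_ray[OF u _ s(2,1)] s unfolding eventually_at_right_field by (intro exI[of _ s]) auto
qed (use s in simp)

text \<open>
  The upper half of the law of cosines for infinitesimal triangles: the distance of the points at distances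
  \<open>s\<close> and \<open>b * s\<close> from \<open>p\<close> is asymptotically at most \<open>s\<close> times the third side of the Euclidean triangle
  with sides \<open>1\<close>, \<open>b\<close> and the given angle. The bound before the limit comes from \<open>ray_bound\<close>.
\<close>

definition hinge_bound :: "real \<Rightarrow> 'a \<Rightarrow> 'a \<Rightarrow> real \<Rightarrow> real" where
  "hinge_bound b u v s = sqrt ((1 - b) + b * (d (ray u s) (ray v s) / s)\<^sup>2 - b * (1 - b) + 64 * k * s\<^sup>2)"

lemma hinge_upper:
  assumes uv: "u \<in> A0" "v \<in> A0" and b: "0 < b" "b \<le> 1"
  shows "eventually (\<lambda>s. d (ray u s) (ray v (b * s)) / s \<le>
           hinge_bound b u v s) (at_right 0)"
    and "(hinge_bound b u v
           \<longlongrightarrow> sqrt (1 + b\<^sup>2 - 2 * b * cos (ang u v))) (at_right 0)"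
proof -
  define s0 where "s0 = min (R / 2) (min (d p u) (d p v))"
  have s0: "0 < s0" using R A0_pos[OF uv(1)] A0_pos[OF uv(2)] by (simp add: s0_def)
  have main: "d (ray u s) (ray v (b * s)) / s \<le>
           hinge_bound b u v s"
    if s: "0 < s" "s < s0" for s
    unfolding hinge_bound_def
  proof (rule real_le_rsqrt)
    have s': "0 \<le> s" "s \<le> d p u" "s \<le> d p v" "s < R" using s R by (auto simp: s0_def)
    have "(d (ray u s) (ray v (b * s)))\<^sup>2 \<le>
        (1 - b) * s\<^sup>2 + b * (d (ray u s) (ray v s))\<^sup>2 - b * (1 - b) * s\<^sup>2 + 64 * k * s ^ 4"
      using ray_bound[OF uv(2) s'(1,3) order_refl s'(4) ray_in_B[OF uv(1) s'(1,2,4)] _ less_imp_le[OF b(1)] b(2)]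
      by (simp add: ray_dist[OF uv(1) s'(1,2)])
    then have "(d (ray u s) (ray v (b * s)) / s)\<^sup>2 \<le>
        ((1 - b) * s\<^sup>2 + b * (d (ray u s) (ray v s))\<^sup>2 - b * (1 - b) * s\<^sup>2 + 64 * k * s ^ 4) / s\<^sup>2"
      unfolding power_divide by (intro divide_right_mono) auto
    also have "\<dots> = (1 - b) + b * (d (ray u s) (ray v s) / s)\<^sup>2 - b * (1 - b) + 64 * k * s\<^sup>2"
    proof -
      define q where "q = s\<^sup>2"
      have q: "q > 0" using s by (simp add: q_def)
      have s4: "s ^ 4 = q * q" unfolding q_def by (simp flip: power_add)
      show ?thesis unfolding power_divide s4 q_def[symmetric] using q by (simp add: field_simps)
    qed
    finally show "(d (ray u s) (ray v (b * s)) / s)\<^sup>2 \<le>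
      (1 - b) + b * (d (ray u s) (ray v s) / s)\<^sup>2 - b * (1 - b) + 64 * k * s\<^sup>2" .
  qed
  then show "eventually (\<lambda>s. d (ray u s) (ray v (b * s)) / s \<le>
           hinge_bound b u v s) (at_right 0)"
    unfolding eventually_at_right_field using s0 by blast
  define a where "a = ang u v"
  have L: "(hinge_bound b u v
           \<longlongrightarrow> sqrt ((1 - b) + b * (2 * sin (a / 2))\<^sup>2 - b * (1 - b) + 64 * k * 0\<^sup>2)) (at_right 0)"
    unfolding a_def hinge_bound_def by (intro tendsto_intros angle_tendsto uv)
  have eq': "(1 - b) + b * (2 * sin (a / 2))\<^sup>2 - b * (1 - b) + 64 * k * 0\<^sup>2 = 1 + b\<^sup>2 - 2 * b * cos a"
  proof -
    have eq: "(2 * sin (a / 2))\<^sup>2 = 2 - 2 * cos a"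
      using cos_double_sin[of "a / 2"] by (simp add: power_mult_distrib)
    show ?thesis unfolding eq by (simp add: algebra_simps power2_eq_square)
  qed
  show "(hinge_bound b u v
           \<longlongrightarrow> sqrt (1 + b\<^sup>2 - 2 * b * cos (ang u v))) (at_right 0)"
    using L unfolding eq' unfolding a_def .
qed

text \<open>
  Let the middle point run at \<open>b\<close> times the speed of the other two, with \<open>b\<close> from \<open>angle_split\<close>. The
  triangle inequality for the three points becomes, in the limit, the inequality between the
  half sines.
\<close>

lemma angle_triangle:
  assumes uvw: "u \<in> A0" "v \<in> A0" "w \<in> A0"
  shows "ang u w \<le> ang u v + ang v w"
proof (cases "ang u v + ang v w < pi")
  case False
  then show ?thesis using angle_range(2)[OF uvw(1,3)] by linarith
next
  case True
  have r: "0 \<le> ang u v" "0 \<le> ang w v" "ang u v + ang w v < pi"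
    using angle_range uvw True angle_sym[OF uvw(2,3)] by auto
  obtain b where b: "0 < b" "b \<le> 1" and
    split: "sqrt (1 + b\<^sup>2 - 2 * b * cos (ang u v)) + sqrt (1 + b\<^sup>2 - 2 * b * cos (ang w v)) = 2 * sin ((ang u v + ang w v) / 2)"
    using angle_split[OF r] by blast
  define s0 where "s0 = min (d p u) (min (d p v) (d p w))"
  have s0: "0 < s0" using A0_pos[OF uvw(1)] A0_pos[OF uvw(2)] A0_pos[OF uvw(3)] by (simp add: s0_def)
  have tr: "eventually (\<lambda>s. d (ray u s) (ray w s) / s \<le> d (ray u s) (ray v (b * s)) / s + d (ray w s) (ray v (b * s)) / s) (at_right 0)"
    unfolding eventually_at_right_field
  proof (intro exI[of _ s0] conjI s0 allI impI)
    fix s assume s: "0 < s" "s < s0"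
    have "b * s \<le> s" using b s by (intro mult_left_le_one_le) auto
    moreover have "s \<le> d p v" "0 \<le> b * s" using b s by (auto simp: s0_def)
    ultimately have bs: "0 \<le> b * s" "b * s \<le> d p v" by linarith+
    have "d (ray u s) (ray w s) \<le> d (ray u s) (ray v (b * s)) + d (ray w s) (ray v (b * s))"
      by (rule tri'[OF ray_in[OF uvw(1)] ray_in[OF uvw(2) bs] ray_in[OF uvw(3)]]) (use s in \<open>auto simp: s0_def\<close>)
    then show "d (ray u s) (ray w s) / s \<le> d (ray u s) (ray v (b * s)) / s + d (ray w s) (ray v (b * s)) / s"
      using s by (simp add: divide_right_mono flip: add_divide_distrib)
  qed
  have "eventually (\<lambda>s. d (ray u s) (ray w s) / s \<le> hinge_bound b u v s + hinge_bound b w v s) (at_right 0)"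
    using tr hinge_upper(1)[OF uvw(1,2) b] hinge_upper(1)[OF uvw(3,2) b]
    by eventually_elim linarith
  moreover have "((\<lambda>s. hinge_bound b u v s + hinge_bound b w v s) \<longlongrightarrow> 2 * sin ((ang u v + ang w v) / 2)) (at_right 0)"
    unfolding split[symmetric]
    by (intro tendsto_add hinge_upper(2) uvw b)
  ultimately have "2 * sin (ang u w / 2) \<le> 2 * sin ((ang u v + ang w v) / 2)"
    by (rule tendsto_le[OF trivial_limit_at_right_real _ angle_tendsto[OF uvw(1,3)], rotated])
  then have "ang u w / 2 \<le> (ang u v + ang w v) / 2"
    using angle_range[OF uvw(1,3)] r by (subst sin_mono_le_eq[symmetric]) auto
  then show ?thesis using angle_sym[OF uvw(2,3)] by simp
qed

lemma pseudometric_angle: "pseudometric_on A0 ang"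
  unfolding pseudometric_on_def
  using angle_self angle_range(1) angle_sym angle_triangle by blast

lemma angle_le_chord:
  assumes uv: "u \<in> A0" "v \<in> A0" and s: "0 < s" "s \<le> d p u" "s \<le> d p v" "s < R"
  shows "ang u v \<le> 4 * sqrt (chord_ratio_sq u v s + 700 * k * s\<^sup>2)"
proof -
  have "2 * sin (ang u v / 2) \<le> sqrt (chord_ratio_sq u v s + 700 * k * s\<^sup>2)"
    using angle_bound[OF uv s] by (rule real_le_rsqrt)
  then show ?thesis using le_four_sin[of "ang u v / 2"] angle_range[OF uv] by simp
qed

text \<open>
  At the smaller of the two distances from \<open>p\<close> the chord is at most \<open>2 * d m q\<close>, and \<open>angle_le_chord\<close>
  bounds the angle by the chord.
\<close>

lemma angle_close:
  assumes mq: "m \<in> A" "q \<in> A" and r: "d m q \<le> r * d p q" "r \<le> 1 / 2"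
  shows "ang m q \<le> 16 * r + 120 * (1 + k) * d p q"
proof -
  have mq': "m \<in> A0" "q \<in> A0" using mq A_A0 by auto
  define \<sigma> where "\<sigma> = d p q"
  define a where "a = d p m"
  have \<sigma>: "0 < \<sigma>" and a: "0 < a" using A0_pos mq' by (auto simp: \<sigma>_def a_def)
  define s where "s = min a \<sigma>"
  have s: "0 < s" "s \<le> a" "s \<le> \<sigma>" "s < R" using a \<sigma> mq by (auto simp: s_def \<sigma>_def a_def)
  have r0: "0 \<le> r"
  proof -
    have "0 \<le> r * \<sigma>" using r(1) mdist_nonneg[of X m q] unfolding \<sigma>_def by linarith
    then show ?thesis using \<sigma> by (simp add: zero_le_mult_iff)
  qed
  have mX: "m \<in> mspace X" and qX: "q \<in> mspace X" using mq by auto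
  have dif: "\<bar>a - \<sigma>\<bar> \<le> d m q"
    using tri[OF p mX qX] tri'[OF p qX mX] by (auto simp: a_def \<sigma>_def abs_le_iff)
  have half: "r * \<sigma> \<le> (1 / 2) * \<sigma>" using r \<sigma> by (intro mult_right_mono) auto
  have s2: "\<sigma> \<le> 2 * s"
  proof -
    have "\<sigma> \<le> 2 * a" using dif r(1) half unfolding \<sigma>_def[symmetric] by linarith
    then show ?thesis using \<sigma> by (simp add: s_def min_def)
  qed
  have "d (ray m s) (ray q s) \<le> d m q + \<bar>a - \<sigma>\<bar>"
  proof (cases "a \<le> \<sigma>")
    case True
    then have sa: "s = a" by (simp add: s_def)
    have "ray m s = m" using ray_ends(2)[OF mq'(1)] sa by (simp add: a_def)
    moreover have "d (ray q s) q = \<sigma> - a"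
      using ray_dist(2)[OF mq'(2), of s] s sa by (simp add: \<sigma>_def)
    ultimately show ?thesis
      using tri'[OF mX qX ray_in[OF mq'(2), of s]] s sa True by (simp add: \<sigma>_def)
  next
    case False
    then have sa: "s = \<sigma>" by (simp add: s_def)
    have "ray q s = q" using ray_ends(2)[OF mq'(2)] sa by (simp add: \<sigma>_def)
    moreover have "d (ray m s) m = a - \<sigma>"
      using ray_dist(2)[OF mq'(1), of s] s sa by (simp add: a_def)
    ultimately show ?thesis
      using tri[OF ray_in[OF mq'(1), of s] mX qX] s sa False by (simp add: a_def)
  qed
  also have "\<dots> \<le> 2 * (r * \<sigma>)" using dif r(1) by (simp add: \<sigma>_def)
  also have "\<dots> \<le> 4 * r * s" using mult_left_mono[OF s2 r0] by (simp add: mult.commute mult.left_commute)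
  finally have "d (ray m s) (ray q s) / s \<le> 4 * r" using s by (simp add: divide_le_eq)
  then have "chord_ratio_sq m q s \<le> (4 * r)\<^sup>2" unfolding chord_ratio_sq_def using s by (intro power_mono) auto
  moreover have "700 * k * s\<^sup>2 \<le> (30 * (1 + k) * \<sigma>)\<^sup>2"
  proof -
    have "k * s\<^sup>2 \<le> (1 + k)\<^sup>2 * \<sigma>\<^sup>2"
      using s k by (intro mult_mono power_mono) (auto simp: power2_eq_square algebra_simps)
    moreover have "0 \<le> k * s\<^sup>2" using k by simp
    ultimately have "700 * (k * s\<^sup>2) \<le> 900 * ((1 + k)\<^sup>2 * \<sigma>\<^sup>2)" by linarith
    moreover have "(30 * (1 + k) * \<sigma>)\<^sup>2 = 900 * ((1 + k)\<^sup>2 * \<sigma>\<^sup>2)"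
      by (simp only: power_mult_distrib mult.assoc) simp
    ultimately show ?thesis by (simp only: mult.assoc)
  qed
  ultimately have "chord_ratio_sq m q s + 700 * k * s\<^sup>2 \<le> (4 * r)\<^sup>2 + (30 * (1 + k) * \<sigma>)\<^sup>2" by linarith
  then have "sqrt (chord_ratio_sq m q s + 700 * k * s\<^sup>2) \<le> sqrt ((4 * r)\<^sup>2 + (30 * (1 + k) * \<sigma>)\<^sup>2)" by simp
  also have "\<dots> \<le> 4 * r + 30 * (1 + k) * \<sigma>"
    using r0 k \<sigma> by (intro sqrt_sum_squares_le_sum) auto
  finally have "sqrt (chord_ratio_sq m q s + 700 * k * s\<^sup>2) \<le> 4 * r + 30 * (1 + k) * \<sigma>" .
  moreover have "ang m q \<le> 4 * sqrt (chord_ratio_sq m q s + 700 * k * s\<^sup>2)"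
    by (rule angle_le_chord[OF mq' s(1) _ _ s(4)]) (use s(2,3) in \<open>simp_all add: a_def \<sigma>_def\<close>)
  ultimately show ?thesis unfolding \<sigma>_def[symmetric] by linarith
qed

lemma ray_between: "\<lbrakk>u \<in> A; 0 \<le> s; s \<le> d p u\<rbrakk> \<Longrightarrow> ray u s = between p u (s / d p u)"
  using geodesic_between[OF ray_geodesic[OF A_A0] geodesic_from_p_in_B[OF ray_geodesic[OF A_A0]]] by blast

text \<open>
  The bound \<open>angle_le_chord\<close> at distance \<open>s\<close> has an error that does not vanish as \<open>f y\<close> tends to
  \<open>u\<close>. So first choose \<open>s\<close> small, and then use that the points at this fixed distance on the two
  geodesics converge to each other.
\<close>

lemma angle_continuous:
  assumes f: "eventually (\<lambda>y. f y \<in> A) F" and u: "u \<in> A" and lim: "((\<lambda>y. d (f y) u) \<longlongrightarrow> 0) F"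
  shows "((\<lambda>y. ang (f y) u) \<longlongrightarrow> 0) F"
proof (rule tendstoI)
  fix e :: real assume e: "e > 0"
  define a where "a = d p u"
  have u0: "u \<in> A0" using u A_A0 by blast
  have a: "0 < a" "a < R" using A0_pos[OF u0] u by (auto simp: a_def)
  have "((\<lambda>s. 700 * k * s\<^sup>2) \<longlongrightarrow> 700 * k * 0\<^sup>2) (at_right 0)" by (intro tendsto_intros)
  then have "eventually (\<lambda>s. 700 * k * s\<^sup>2 < (e / 4)\<^sup>2 / 2) (at_right 0)"
    by (rule order_tendstoD(2)) (use e in simp)
  moreover have "eventually (\<lambda>s. s < a) (at_right 0)" "eventually (\<lambda>s. 0 < s) (at_right (0::real))"
    using a by (auto simp: eventually_at_right_field)
  ultimately have "eventually (\<lambda>s. 700 * k * s\<^sup>2 < (e / 4)\<^sup>2 / 2 \<and> s < a \<and> 0 < s) (at_right 0)"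
    by eventually_elim simp
  then obtain s where s: "700 * k * s\<^sup>2 < (e / 4)\<^sup>2 / 2" "s < a" "0 < s"
    using eventually_happens[of _ "at_right (0::real)"] trivial_limit_at_right_real by blast
  have dp: "((\<lambda>y. d p (f y)) \<longlongrightarrow> a) F"
  proof (rule LIM_zero_cancel)
    show "((\<lambda>y. d p (f y) - a) \<longlongrightarrow> 0) F"
    proof (rule Lim_null_comparison[OF _ lim])
      show "eventually (\<lambda>y. norm (d p (f y) - a) \<le> d (f y) u) F" using f
      proof eventually_elim
        case (elim y)
        have "f y \<in> mspace X" "u \<in> mspace X" using elim u by auto
        then show ?case using tri[OF p, of "f y" u] tri'[OF p, of u "f y"] by (auto simp: a_def abs_le_iff)
      qed
    qed
  qed
  have big: "eventually (\<lambda>y. s < d p (f y)) F" using order_tendstoD(1)[OF dp s(2)] .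
  have "((\<lambda>y. d (between p (f y) (s / d p (f y))) (between p u (s / a))) \<longlongrightarrow> 0) F"
  proof (rule between_tendsto[OF _ _ pB])
    show "eventually (\<lambda>y. f y \<in> B) F" using f by eventually_elim simp
    show "u \<in> B" using u by simp
    show "eventually (\<lambda>y. 0 \<le> s / d p (f y) \<and> s / d p (f y) \<le> 1) F"
      using big by eventually_elim (use s in \<open>auto simp: divide_le_eq_1\<close>)
    show "0 \<le> s / a" "s / a \<le> 1" using s a by auto
    show "((\<lambda>y. d p p) \<longlongrightarrow> 0) F" using p by simp
    show "((\<lambda>y. s / d p (f y)) \<longlongrightarrow> s / a) F" using a by (intro tendsto_intros dp) auto
  qed (use pB lim in auto)
  then have "((\<lambda>y. (d (between p (f y) (s / d p (f y))) (between p u (s / a)) / s)\<^sup>2) \<longlongrightarrow> (0 / s)\<^sup>2) F"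
    using s by (intro tendsto_intros) auto
  then have "((\<lambda>y. (d (between p (f y) (s / d p (f y))) (between p u (s / a)) / s)\<^sup>2) \<longlongrightarrow> 0) F" by simp
  then have "eventually (\<lambda>y. (d (between p (f y) (s / d p (f y))) (between p u (s / a)) / s)\<^sup>2 < (e / 4)\<^sup>2 / 2) F"
    by (rule order_tendstoD(2)) (use e in simp)
  then show "eventually (\<lambda>y. dist (ang (f y) u) 0 < e) F"
    using f big
  proof eventually_elim
    case (elim y)
    have y: "f y \<in> A0" using A_A0 elim(2) by blast
    have "ray (f y) s = between p (f y) (s / d p (f y))" "ray u s = between p u (s / a)"
      using ray_between[OF elim(2), of s] ray_between[OF u, of s] s elim(3) by (auto simp: a_def)
    then have "chord_ratio_sq (f y) u s < (e / 4)\<^sup>2 / 2" using elim(1) by (simp add: chord_ratio_sq_def)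
    then have "chord_ratio_sq (f y) u s + 700 * k * s\<^sup>2 < (e / 4)\<^sup>2" using s(1) by linarith
    then have "sqrt (chord_ratio_sq (f y) u s + 700 * k * s\<^sup>2) < e / 4"
      using e real_sqrt_less_mono real_sqrt_abs by fastforce
    then have "ang (f y) u < e"
      using angle_le_chord[OF y u0 s(3)] s a elim(3) by (simp add: a_def)
    then show ?case using angle_range(1)[OF y u0] by (simp add: dist_real_def)
  qed
qed

text \<open>
  A geodesic through \<open>p\<close> consists of two rays from \<open>p\<close> whose chords at distance \<open>s\<close> are equal to \<open>2 * s\<close>.
\<close>

lemma between_avoids_p:
  assumes uv: "u \<in> A" "v \<in> A" and ang: "ang u v < pi" and t: "0 \<le> t" "t \<le> 1"
  shows "between u v t \<in> A"
proof -
  have uvB: "u \<in> B" "v \<in> B" and uv0: "u \<in> A0" "v \<in> A0" using uv A_A0 by auto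
  have "between u v t \<noteq> p"
  proof
    assume eq: "between u v t = p"
    obtain c where c: "geodesic X u v c" "c ` {0..d u v} \<subseteq> B" "\<forall>t. between u v t = c (t * d u v)"
      using between_geodesic[OF uvB t] by (elim exE conjE) (rule that)
    define a where "a = t * d u v"
    have ca: "c a = p" using c(3) eq by (simp add: a_def)
    have a: "0 \<le> a" "a \<le> d u v" using t by (auto simp: a_def mult_left_le_one_le)
    have du: "d p u = a" and dv: "d p v = d u v - a"
      using geodesic_dist_ends[OF c(1) a] ca by (simp_all add: mdist_commute)
    have "geodesic X p u (restrict (\<lambda>s. c (a - s)) {0..d p u})"
      using geodesicD[OF c(1)] a ca unfolding geodesic_def du by (auto simp: PiE_iff)
    from ray_eqI[OF uv0(1) this] have ru: "ray u s = c (a - s)" if "0 \<le> s" "s \<le> a" for s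
      using that by (simp add: du)
    have "geodesic X p v (restrict (\<lambda>s. c (a + s)) {0..d p v})"
      using geodesicD[OF c(1)] a ca unfolding geodesic_def dv by (auto simp: PiE_iff)
    from ray_eqI[OF uv0(2) this] have rv: "ray v s = c (a + s)" if "0 \<le> s" "s \<le> d u v - a" for s
      using that by (simp add: dv)
    define s0 where "s0 = min a (d u v - a)"
    have s0: "0 < s0" using A0_pos[OF uv0(1)] A0_pos[OF uv0(2)] by (simp add: s0_def du dv)
    have "d (ray u s) (ray v s) / s = 2" if "0 < s" "s < s0" for s
      using geodesicD(2)[OF c(1), of "a - s" "a + s"] that a ru[of s] rv[of s] by (simp add: s0_def)
    then have "eventually (\<lambda>s. 2 = d (ray u s) (ray v s) / s) (at_right 0)"
      unfolding eventually_at_right_field using s0 by metis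
    note L = Lim_transform_eventually[OF tendsto_const this]
    have "2 * sin (ang u v / 2) = 2"
      by (rule tendsto_unique[OF trivial_limit_at_right_real angle_tendsto[OF uv0] L])
    then have "sin (ang u v / 2) = sin (pi / 2)" by simp
    then have "ang u v / 2 = pi / 2"
      by (rule sin_inj_pi[rotated 4]) (use angle_range[OF uv0] in auto)
    then show False using ang by simp
  qed
  then show ?thesis using between_in_B[OF uvB t] by simp
qed

end

section \<open>Lipschitz covers of metric spaces\<close>

text \<open>
  If \<open>P\<close> holds locally at all small enough scales, then half of the supremum of the radii \<open>\<delta> \<le> 1\<close> for which
  \<open>P\<close> holds on the \<open>\<delta>\<close>-ball around \<open>y\<close> at all scales up to \<open>\<delta>\<close> is an admissible scale. It depends on
  \<open>y\<close> in a Lipschitz way because the ball around a point \<open>z\<close> of radius \<open>\<delta> - d(y, z)\<close> is contained in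
  the \<open>\<delta>\<close>-ball around \<open>y\<close>.
\<close>

lemma lipschitz_scale:
  fixes Y :: "'y metric" and P :: "'y \<Rightarrow> real \<Rightarrow> bool"
  assumes loc: "\<forall>y\<in>mspace Y. \<exists>\<delta>>0. \<forall>z\<in>mspace Y. mdist Y y z < \<delta> \<longrightarrow> (\<forall>s. 0 < s \<and> s \<le> \<delta> \<longrightarrow> P z s)"
  shows "\<exists>\<sigma>. (\<forall>y\<in>mspace Y. 0 < \<sigma> y \<and> P y (\<sigma> y)) \<and>
    (\<forall>y\<in>mspace Y. \<forall>z\<in>mspace Y. \<bar>\<sigma> y - \<sigma> z\<bar> \<le> mdist Y y z)"
proof -
  define Q where "Q y \<delta> \<longleftrightarrow> 0 < \<delta> \<and> \<delta> \<le> 1 \<and>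
    (\<forall>z\<in>mspace Y. mdist Y y z < \<delta> \<longrightarrow> (\<forall>s. 0 < s \<and> s \<le> \<delta> \<longrightarrow> P z s))" for y \<delta>
  define \<tau> where "\<tau> y = Sup {\<delta>. Q y \<delta>}" for y
  have bdd: "bdd_above {\<delta>. Q y \<delta>}" for y by (rule bdd_aboveI[of _ 1]) (simp add: Q_def)
  have ex: "\<exists>\<delta>. Q y \<delta>" if y: "y \<in> mspace Y" for y
  proof -
    obtain \<delta> where "\<delta> > 0" "\<forall>z\<in>mspace Y. mdist Y y z < \<delta> \<longrightarrow> (\<forall>s. 0 < s \<and> s \<le> \<delta> \<longrightarrow> P z s)"
      using bspec[OF loc y] by blast
    then have "Q y (min \<delta> 1)" by (auto simp: Q_def)
    then show ?thesis by blast
  qed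
  have up: "\<delta> \<le> \<tau> y" if "Q y \<delta>" for y \<delta>
    unfolding \<tau>_def by (rule cSup_upper[OF _ bdd]) (simp add: that)
  have pos: "0 < \<tau> y" if "y \<in> mspace Y" for y
    using ex[OF that] up[of y] unfolding Q_def by (meson less_le_trans)
  have lip: "\<tau> y \<le> \<tau> z + mdist Y y z" if y: "y \<in> mspace Y" and z: "z \<in> mspace Y" for y z
    unfolding \<tau>_def[of y]
  proof (rule cSup_least)
    show "{\<delta>. Q y \<delta>} \<noteq> {}" using ex[OF y] by blast
    fix \<delta> assume "\<delta> \<in> {\<delta>. Q y \<delta>}"
    then have \<delta>: "Q y \<delta>" by simp
    show "\<delta> \<le> \<tau> z + mdist Y y z"
    proof (cases "\<delta> - mdist Y y z > 0")
      case True
      have "Q z (\<delta> - mdist Y y z)" unfolding Q_def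
      proof (intro conjI ballI impI allI)
        show "\<delta> - mdist Y y z \<le> 1" using \<delta> mdist_nonneg[of Y y z] unfolding Q_def by linarith
        fix w s assume w: "w \<in> mspace Y" "mdist Y z w < \<delta> - mdist Y y z" and s: "0 < s \<and> s \<le> \<delta> - mdist Y y z"
        have "mdist Y y w < \<delta>" using mdist_triangle[OF y z w(1)] w(2) by linarith
        moreover have "s \<le> \<delta>" using s mdist_nonneg[of Y y z] by linarith
        ultimately show "P w s" using \<delta> w(1) s unfolding Q_def by blast
      qed (rule True)
      from up[OF this] show ?thesis by simp
    next
      case False
      then show ?thesis using pos[OF z] by linarith
    qed
  qed
  have "P y (\<tau> y / 2)" if y: "y \<in> mspace Y" for y
  proof -
    have "\<tau> y / 2 < Sup {\<delta>. Q y \<delta>}" using pos[OF y] by (simp add: \<tau>_def)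
    then obtain \<delta> where \<delta>: "Q y \<delta>" "\<tau> y / 2 < \<delta>" using less_cSupE ex[OF y] by (metis empty_iff mem_Collect_eq)
    have "mdist Y y y < \<delta>" using \<delta>(1) y unfolding Q_def by simp
    then show ?thesis using \<delta> pos[OF y] y unfolding Q_def by (metis half_gt_zero less_imp_le)
  qed
  moreover have "\<bar>\<tau> y / 2 - \<tau> z / 2\<bar> \<le> mdist Y y z" if "y \<in> mspace Y" "z \<in> mspace Y" for y z
    using lip[OF that] lip[OF that(2,1)] mdist_nonneg[of Y y z] mdist_commute[of Y y z] by linarith
  ultimately show ?thesis using pos by (intro exI[of _ "\<lambda>y. \<tau> y / 2"]) auto
qed

text \<open>
  Stone's refinement, for the cover by the sets on which one of the equally Lipschitz functions \<open>h i\<close>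
  is positive. Well-order the indices. Layer \<open>n\<close> consists of the sets \<open>S n i\<close> of points at which
  \<open>h i \<ge> 1 / (n + 1)\<close> and no earlier function is positive. Points of \<open>S n i\<close> and \<open>S n j\<close> for \<open>i \<noteq> j\<close>
  have distance at least \<open>1 / (n + 1)\<close>, so that the index \<open>\<iota> n\<close> is locally constant near the layer. The
  weight \<open>w n\<close> is \<open>1\<close> near the layer and vanishes away from it. Each point lies in the layer of
  the first index that is positive there, for large \<open>n\<close>; so some weight is \<open>1\<close> near it.
\<close>

lemma discrete_layers:
  fixes Y :: "'y metric" and h :: "'i \<Rightarrow> 'y \<Rightarrow> real"
  assumes cover': "\<forall>y\<in>mspace Y. \<exists>i\<in>I. 0 < h i y"
    and lip': "\<forall>i\<in>I. \<forall>y\<in>mspace Y. \<forall>z\<in>mspace Y. \<bar>h i y - h i z\<bar> \<le> mdist Y y z"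
  shows "\<exists>(w :: nat \<Rightarrow> 'y \<Rightarrow> real) (\<iota> :: nat \<Rightarrow> 'y \<Rightarrow> 'i).
    (\<forall>n y. 0 \<le> w n y \<and> w n y \<le> 1) \<and>
    (\<forall>n. \<exists>L. \<forall>y\<in>mspace Y. \<forall>z\<in>mspace Y. \<bar>w n y - w n z\<bar> \<le> L * mdist Y y z) \<and>
    (\<forall>n. \<forall>y\<in>mspace Y. \<iota> n y \<in> I \<and> (0 < w n y \<longrightarrow> 0 < h (\<iota> n y) y)) \<and>
    (\<forall>n. \<forall>y\<in>mspace Y. \<exists>\<delta>>0. (\<forall>z\<in>mspace Y. mdist Y y z < \<delta> \<longrightarrow> w n z = 0) \<or>
        (\<forall>z\<in>mspace Y. mdist Y y z < \<delta> \<longrightarrow> \<iota> n z = \<iota> n y)) \<and>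
    (\<forall>y\<in>mspace Y. \<exists>n. \<exists>\<delta>>0. \<forall>z\<in>mspace Y. mdist Y y z < \<delta> \<longrightarrow> w n z = 1)"
proof -
  note cover = bspec[OF cover'] and lip = bspec[OF bspec[OF bspec[OF lip']]]
  obtain r :: "('i \<times> 'i) set" where r: "well_order_on I r" using well_order_on by blast
  have tot: "(i, j) \<in> r \<or> (j, i) \<in> r" if "i \<in> I" "j \<in> I" "i \<noteq> j" for i j
    using r that unfolding well_order_on_def linear_order_on_def total_on_def by blast
  have wf: "wf (r - Id)" using r unfolding well_order_on_def by blast
  define \<epsilon> :: "nat \<Rightarrow> real" where "\<epsilon> n = inverse (real (Suc n))" for n
  have \<epsilon>: "0 < \<epsilon> n" for n by (simp add: \<epsilon>_def)
  define S where "S n i = {y \<in> mspace Y. \<epsilon> n \<le> h i y \<and> (\<forall>j\<in>I. (j, i) \<in> r \<and> j \<noteq> i \<longrightarrow> h j y \<le> 0)}" for n i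
  have SY: "x \<in> S n i \<Longrightarrow> x \<in> mspace Y" for x n i by (simp add: S_def)
  have sep1: "\<epsilon> n \<le> mdist Y x y"
    if "i \<in> I" "j \<in> I" "x \<in> S n i" "y \<in> S n j" "(i, j) \<in> r" "i \<noteq> j" for n i j x y
  proof -
    have "\<epsilon> n \<le> h i x" "h i y \<le> 0" using that by (auto simp: S_def)
    then show ?thesis using lip[of i x y] that SY by fastforce
  qed
  have sep: "i = j" if "i \<in> I" "j \<in> I" "x \<in> S n i" "y \<in> S n j" "z \<in> mspace Y"
      "mdist Y x z < \<epsilon> n / 2" "mdist Y y z < \<epsilon> n / 2" for n i j x y z
  proof (rule ccontr)
    assume "i \<noteq> j"
    then have "\<epsilon> n \<le> mdist Y x y"
      using tot[OF that(1,2)] sep1[OF that(1-4)] sep1[OF that(2,1,4,3)] by (auto simp: mdist_commute)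
    then show False
      using mdist_triangle[OF SY[OF that(3)] that(5) SY[OF that(4)]] that(6,7) by (simp add: mdist_commute)
  qed
  define near where "near n y i \<longleftrightarrow> i \<in> I \<and> (\<exists>x\<in>S n i. mdist Y x y < \<epsilon> n / 2)" for n y i
  define \<iota> where "\<iota> n y = (if \<exists>i. near n y i then SOME i. near n y i else SOME i. i \<in> I)" for n y
  have \<iota>: "\<iota> n y = i" if "near n y i" "y \<in> mspace Y" for n y i
  proof -
    have "near n y (SOME i. near n y i)" using that(1) by (rule someI)
    then have "(SOME i. near n y i) = i" using that sep unfolding near_def by blast
    then show ?thesis using that by (auto simp: \<iota>_def)
  qed
  have \<iota>I: "\<iota> n y \<in> I" if "y \<in> mspace Y" for n y
  proof (cases "\<exists>i. near n y i")
    case True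
    then show ?thesis using \<iota>[OF _ that] by (auto simp: near_def)
  next
    case False
    then show ?thesis using cover[OF that] someI_ex[of "\<lambda>i. i \<in> I"] by (auto simp: \<iota>_def)
  qed
  define c where "c n = 6 / \<epsilon> n" for n
  have c: "0 < c n" for n using \<epsilon> by (simp add: c_def)
  define b where "b n x y = max 0 (min 1 (2 - c n * mdist Y x y))" for n x y
  define w where "w n y = Sup (insert 0 ((\<lambda>x. b n x y) ` (\<Union>i\<in>I. S n i)))" for n y
  have bdd: "bdd_above (insert 0 ((\<lambda>x. b n x y) ` (\<Union>i\<in>I. S n i)))" for n y
    by (rule bdd_aboveI[of _ 1]) (auto simp: b_def)
  have w_ge: "b n x y \<le> w n y" if "i \<in> I" "x \<in> S n i" for n x y i
    unfolding w_def by (rule cSup_upper[OF _ bdd]) (use that in auto)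
  have w_le: "w n y \<le> a" if "0 \<le> a" "\<And>i x. \<lbrakk>i \<in> I; x \<in> S n i\<rbrakk> \<Longrightarrow> b n x y \<le> a" for n y a
    unfolding w_def by (rule cSup_least) (use that in auto)
  have w0: "0 \<le> w n y" for n y unfolding w_def by (rule cSup_upper[OF _ bdd]) simp
  have w1: "w n y \<le> 1" for n y by (rule w_le) (auto simp: b_def)
  have wlip: "w n y \<le> w n z + c n * mdist Y y z" if "y \<in> mspace Y" "z \<in> mspace Y" for n y z
  proof (rule w_le)
    show "0 \<le> w n z + c n * mdist Y y z" using w0 c[of n] by (simp add: add_nonneg_nonneg)
    fix i x assume ix: "i \<in> I" "x \<in> S n i"
    have "mdist Y x z \<le> mdist Y x y + mdist Y y z" by (rule mdist_triangle[OF SY[OF ix(2)] that])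
    then have "c n * mdist Y x z \<le> c n * mdist Y x y + c n * mdist Y y z"
      using c[of n] by (simp flip: distrib_left)
    moreover have "0 \<le> c n * mdist Y y z" using c[of n] by simp
    ultimately have "b n x y \<le> b n x z + c n * mdist Y y z" unfolding b_def by linarith
    then show "b n x y \<le> w n z + c n * mdist Y y z" using w_ge[OF ix, of z] by linarith
  qed
  have w_pos: "\<exists>i x. i \<in> I \<and> x \<in> S n i \<and> mdist Y x y < \<epsilon> n / 3" if "0 < w n y" for n y
  proof (rule ccontr)
    assume neg: "\<not> ?thesis"
    have "w n y \<le> 0"
    proof (rule w_le)
      fix i x assume ix: "i \<in> I" "x \<in> S n i"
      then have "\<epsilon> n / 3 \<le> mdist Y x y" using neg by (meson not_le)
      then have "c n * (\<epsilon> n / 3) \<le> c n * mdist Y x y" using c[of n] by (intro mult_left_mono) auto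
      moreover have "c n * (\<epsilon> n / 3) = 2" using \<epsilon>[of n] by (simp add: c_def)
      ultimately show "b n x y \<le> 0" by (simp add: b_def)
    qed simp
    then show False using that by simp
  qed
  have h_pos: "0 < h (\<iota> n y) y" if "0 < w n y" "y \<in> mspace Y" for n y
  proof -
    obtain i x where ix: "i \<in> I" "x \<in> S n i" "mdist Y x y < \<epsilon> n / 3" using w_pos[OF \<open>0 < w n y\<close>] by blast
    then have "near n y i" using \<epsilon>[of n] unfolding near_def by (intro conjI bexI[of _ x]) auto
    from \<iota>[OF this that(2)] have "\<iota> n y = i" .
    moreover have "\<epsilon> n \<le> h i x" using ix by (simp add: S_def)
    moreover have "\<bar>h i x - h i y\<bar> \<le> mdist Y x y" by (rule lip[OF ix(1) SY[OF ix(2)] that(2)])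
    ultimately show ?thesis using ix(3) \<epsilon>[of n] by simp
  qed
  have const: "\<exists>\<delta>>0. (\<forall>z\<in>mspace Y. mdist Y y z < \<delta> \<longrightarrow> w n z = 0) \<or>
        (\<forall>z\<in>mspace Y. mdist Y y z < \<delta> \<longrightarrow> \<iota> n z = \<iota> n y)" if y: "y \<in> mspace Y" for n y
  proof (cases "\<exists>i. near n y i")
    case True
    then obtain i x where i: "near n y i" "i \<in> I" "x \<in> S n i" "mdist Y x y < \<epsilon> n / 2" unfolding near_def by blast
    have "\<iota> n z = \<iota> n y" if z: "z \<in> mspace Y" "mdist Y y z < \<epsilon> n / 2 - mdist Y x y" for z
    proof -
      have "mdist Y x z < \<epsilon> n / 2" using mdist_triangle[OF SY[OF i(3)] y z(1)] z(2) by linarith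
      then have "near n z i" using i(2,3) unfolding near_def by blast
      then show ?thesis using \<iota>[OF i(1) y] \<iota>[OF _ z(1)] by simp
    qed
    then show ?thesis using i(4) by (intro exI[of _ "\<epsilon> n / 2 - mdist Y x y"]) auto
  next
    case False
    have "w n z = 0" if z: "z \<in> mspace Y" "mdist Y y z < \<epsilon> n / 6" for z
    proof (rule ccontr)
      assume "w n z \<noteq> 0"
      then have "0 < w n z" using w0[of n z] by simp
      then obtain i x where ix: "i \<in> I" "x \<in> S n i" "mdist Y x z < \<epsilon> n / 3" using w_pos by blast
      have "mdist Y x y < \<epsilon> n / 2"
        using mdist_triangle[OF SY[OF ix(2)] z(1) y] z(2) ix(3) by (simp add: mdist_commute)
      then show False using False ix unfolding near_def by blast
    qed
    then show ?thesis using \<epsilon>[of n] by (intro exI[of _ "\<epsilon> n / 6"]) auto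
  qed
  have one: "\<exists>n. \<exists>\<delta>>0. \<forall>z\<in>mspace Y. mdist Y y z < \<delta> \<longrightarrow> w n z = 1" if y: "y \<in> mspace Y" for y
  proof -
    obtain i where i: "i \<in> {i \<in> I. 0 < h i y}" "\<And>j. (j, i) \<in> r - Id \<Longrightarrow> j \<notin> {i \<in> I. 0 < h i y}"
      using wfE_min'[OF wf, of "{i \<in> I. 0 < h i y}"] cover[OF y] by blast
    obtain n where n: "inverse (real (Suc n)) < h i y" using reals_Archimedean i(1) by blast
    have "y \<in> S n i" using i n y unfolding S_def \<epsilon>_def by (auto simp: not_less[symmetric])
    have "w n z = 1" if z: "z \<in> mspace Y" "mdist Y y z < 1 / c n" for z
    proof -
      have "c n * mdist Y y z \<le> 1" using z(2) c[of n] by (simp add: field_simps)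
      then have "b n y z = 1" by (simp add: b_def)
      then show ?thesis using w_ge[OF _ \<open>y \<in> S n i\<close>, of z] w1[of n z] i(1) by simp
    qed
    then show ?thesis using c[of n] by (intro exI[of _ n] exI[of _ "1 / c n"]) auto
  qed
  have "\<bar>w n y - w n z\<bar> \<le> c n * mdist Y y z" if "y \<in> mspace Y" "z \<in> mspace Y" for n y z
    using wlip[OF that, of n] wlip[OF that(2,1), of n] by (simp add: mdist_commute abs_le_iff)
  then show ?thesis
    using w0 w1 \<iota>I h_pos const one by (intro exI[of _ w] exI[of _ \<iota>]) blast
qed

section \<open>Mixing points and directions\<close>

lemma limitin_mtopology_of:
  "limitin (mtopology_of Z) f l F \<longleftrightarrow>
     l \<in> mspace Z \<and> eventually (\<lambda>x. f x \<in> mspace Z) F \<and> ((\<lambda>x. mdist Z (f x) l) \<longlongrightarrow> 0) F"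
  unfolding mtopology_of_def by (rule Metric_space.limitin_metric_dist_null[OF Metric_space_mspace_mdist])

lemma eventually_atin_topspace: "eventually (\<lambda>y. y \<in> topspace T) (atin T x)"
  unfolding eventually_atin by (metis DiffD1 openin_topspace)

lemma continuous_map_mtopology_iff:
  "continuous_map T (mtopology_of Z) f \<longleftrightarrow>
     f \<in> topspace T \<rightarrow> mspace Z \<and> (\<forall>x\<in>topspace T. ((\<lambda>y. mdist Z (f y) (f x)) \<longlongrightarrow> 0) (atin T x))"
  (is "_ \<longleftrightarrow> ?R")
proof
  assume "continuous_map T (mtopology_of Z) f"
  then show ?R using continuous_map_funspace[of T "mtopology_of Z" f]
    by (auto simp: continuous_map_atin limitin_mtopology_of)
next
  assume R: ?R
  then have "eventually (\<lambda>y. f y \<in> mspace Z) (atin T x)" for x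
    using eventually_atin_topspace[of T x] by (auto elim: eventually_mono)
  with R show "continuous_map T (mtopology_of Z) f"
    by (auto simp: continuous_map_atin limitin_mtopology_of)
qed

lemma eventually_atin_mball:
  assumes y: "y \<in> mspace Y" and \<delta>: "0 < \<delta>" and P: "\<And>z. \<lbrakk>z \<in> mspace Y; mdist Y y z < \<delta>\<rbrakk> \<Longrightarrow> P z"
  shows "eventually P (atin (mtopology_of Y) y)"
proof -
  have "openin (mtopology_of Y) (mball_of Y y \<delta>)"
    unfolding mtopology_of_def mball_of_def by (rule Metric_space.openin_mball[OF Metric_space_mspace_mdist])
  moreover have "y \<in> mball_of Y y \<delta>" using y \<delta> by simp
  ultimately show ?thesis unfolding eventually_atin using P by auto
qed

lemma lipschitz_tendsto_atin:
  fixes f :: "'y \<Rightarrow> real"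
  assumes y: "y \<in> mspace Y" and f: "\<And>z. z \<in> mspace Y \<Longrightarrow> \<bar>f y - f z\<bar> \<le> L * mdist Y y z"
  shows "(f \<longlongrightarrow> f y) (atin (mtopology_of Y) y)"
proof (rule tendstoI)
  fix e :: real assume e: "e > 0"
  show "eventually (\<lambda>z. dist (f z) (f y) < e) (atin (mtopology_of Y) y)"
  proof (rule eventually_atin_mball[OF y])
    show "0 < e / (\<bar>L\<bar> + 1)" using e by simp
    fix z assume z: "z \<in> mspace Y" "mdist Y y z < e / (\<bar>L\<bar> + 1)"
    have "L * mdist Y y z \<le> (\<bar>L\<bar> + 1) * mdist Y y z" by (intro mult_right_mono) auto
    also have "\<dots> < e" using z(2) by (simp add: field_simps)
    finally show "dist (f z) (f y) < e" using f[OF z(1)] by (simp add: dist_real_def)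
  qed
qed

context convex_ball
begin

text \<open>
  The points are mixed in from the last to the first. Therefore a weight \<open>l m = 1\<close> erases whatever
  the points after \<open>x m\<close> have contributed (\<open>mix_truncate\<close>). So infinitely many points can be mixed, with
  weights that are not normalised, as soon as one of the weights is \<open>1\<close>.
\<close>

primrec mix :: "(nat \<Rightarrow> real) \<Rightarrow> (nat \<Rightarrow> 'a) \<Rightarrow> nat \<Rightarrow> 'a \<Rightarrow> 'a" where
  "mix l x 0 w = w"
| "mix l x (Suc n) w = mix l x n (between w (x n) (l n))"

lemma mix_in_B:
  assumes "\<And>m. x m \<in> B" "\<And>m. 0 \<le> l m \<and> l m \<le> 1" "w \<in> B"
  shows "mix l x n w \<in> B"
  using assms(3)
proof (induction n arbitrary: w)
  case (Suc n)
  have "between w (x n) (l n) \<in> B" using between_in_B[OF Suc.prems assms(1)] assms(2) by blast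
  then show ?case using Suc.IH by (simp del: in_mball_of)
qed simp

lemma mix_convex:
  assumes x: "\<And>m. x m \<in> B" "\<And>m. 0 \<le> l m \<and> l m \<le> 1" and q: "q \<in> B"
    and "w \<in> B" "d q w \<le> r" and c: "\<And>m. m < n \<Longrightarrow> 0 < l m \<Longrightarrow> d q (x m) \<le> r"
  shows "d q (mix l x n w) \<le> r"
  using assms(4-6)
proof (induction n arbitrary: w)
  case (Suc n)
  have l: "0 \<le> l n" "l n \<le> 1" using x(2) by auto
  have g: "between w (x n) (l n) \<in> B" by (rule between_in_B[OF Suc.prems(1) x(1) l])
  have "d q (between w (x n) (l n)) \<le> r"
  proof (cases "l n = 0")
    case True
    then show ?thesis using between_ends(1)[OF Suc.prems(1) x(1)] Suc.prems(2) by simp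
  next
    case False
    then show ?thesis using between_convex[OF Suc.prems(1) x(1) l q Suc.prems(2)] Suc.prems(3)[of n] l by simp
  qed
  then show ?case using Suc.IH[OF g] Suc.prems(3) by simp
qed simp

lemma mix_truncate:
  assumes x: "\<And>m. x m \<in> B" "\<And>m. 0 \<le> l m \<and> l m \<le> 1" and lm: "l m = 1" "m \<le> n" and w: "w \<in> B" "w' \<in> B"
  shows "mix l x (Suc n) w = mix l x (Suc m) w'"
  using lm(2) w(1)
proof (induction n arbitrary: w)
  case 0
  then show ?case using between_ends(2)[OF _ x(1)] w(2) lm by simp
next
  case (Suc n)
  show ?case
  proof (cases "m = Suc n")
    case True
    then show ?thesis using between_ends(2)[OF _ x(1)] w(2) lm Suc.prems by simp
  next
    case False
    have "between w (x (Suc n)) (l (Suc n)) \<in> B" using between_in_B[OF Suc.prems(2) x(1)] x(2) by blast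
    from Suc.IH[OF _ this] show ?thesis using False Suc.prems(1) by simp
  qed
qed

text \<open>
  A point \<open>x z m\<close> need not depend continuously on \<open>z\<close> where its weight vanishes identically.
\<close>

lemma mix_tendsto:
  assumes x: "eventually (\<lambda>z. \<forall>m. x z m \<in> B) F" "\<And>m. x0 m \<in> B"
    and l: "eventually (\<lambda>z. \<forall>m. 0 \<le> l z m \<and> l z m \<le> 1) F" "\<And>m. 0 \<le> l0 m \<and> l0 m \<le> 1"
    and lim: "\<And>m. ((\<lambda>z. l z m) \<longlongrightarrow> l0 m) F"
    and alt: "\<And>m. (eventually (\<lambda>z. l z m = 0) F \<and> l0 m = 0) \<or> ((\<lambda>z. d (x z m) (x0 m)) \<longlongrightarrow> 0) F"
    and "eventually (\<lambda>z. w z \<in> B) F" "w0 \<in> B" "((\<lambda>z. d (w z) w0) \<longlongrightarrow> 0) F"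
  shows "((\<lambda>z. d (mix (l z) (x z) n (w z)) (mix l0 x0 n w0)) \<longlongrightarrow> 0) F"
  using assms(7-9)
proof (induction n arbitrary: w w0)
  case (Suc n)
  have xn: "eventually (\<lambda>z. x z n \<in> B) F" using x(1) by eventually_elim blast
  have ln: "eventually (\<lambda>z. 0 \<le> l z n \<and> l z n \<le> 1) F" using l(1) by eventually_elim blast
  have l0n: "0 \<le> l0 n" "l0 n \<le> 1" using l(2) by auto
  have 1: "eventually (\<lambda>z. between (w z) (x z n) (l z n) \<in> B) F"
    using Suc.prems(1) xn ln by eventually_elim (rule between_in_B, auto simp del: in_mball_of)
  have 2: "between w0 (x0 n) (l0 n) \<in> B" by (rule between_in_B[OF Suc.prems(2) x(2) l0n])
  have 3: "((\<lambda>z. d (between (w z) (x z n) (l z n)) (between w0 (x0 n) (l0 n))) \<longlongrightarrow> 0) F"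
    using alt[of n]
  proof (elim disjE conjE)
    assume l0: "eventually (\<lambda>z. l z n = 0) F" "l0 n = 0"
    have "eventually (\<lambda>z. d (w z) w0 = d (between (w z) (x z n) (l z n)) (between w0 (x0 n) (l0 n))) F"
      using l0(1) Suc.prems(1) xn
      by eventually_elim (simp add: l0(2) between_ends(1) x(2) Suc.prems(2) del: in_mball_of)
    from Lim_transform_eventually[OF Suc.prems(3) this] show ?thesis .
  next
    assume "((\<lambda>z. d (x z n) (x0 n)) \<longlongrightarrow> 0) F"
    then show ?thesis
      by (rule between_tendsto[OF Suc.prems(1) xn Suc.prems(2) x(2) ln l0n Suc.prems(3) _ lim])
  qed
  show ?case using Suc.IH[OF 1 2 3] by simp
qed simp

end

context direction_ball
begin

abbreviation "Dir \<equiv> Cauchy_completion A0 ang"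
abbreviation "emb \<equiv> completion_embed A0 ang"

lemmas emb_in = completion_embed_in[OF pseudometric_angle]
lemmas emb_dist = mdist_completion_embed[OF pseudometric_angle]

text \<open>Points on one geodesic from \<open>p\<close> have the same direction, so a small ball has all directions.\<close>

lemma emb_dense_ball:
  assumes S: "S \<in> mspace Dir" and e: "0 < e"
  shows "\<exists>v\<in>A. mdist Dir (emb v) S < e"
proof -
  obtain a where a: "a \<in> A0" "mdist Dir (emb a) S < e"
    using completion_embed_dense[OF pseudometric_angle S e] by blast
  define s where "s = min (d p a) (R / 2)"
  have s: "0 < s" "0 \<le> s" "s \<le> d p a" "s < R" using A0_pos[OF a(1)] R by (auto simp: s_def)
  have v: "ray a s \<in> A" by (rule ray_in_A[OF a(1) s(2,3,1,4)])
  have v0: "ray a s \<in> A0" using v A_A0 by blast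
  have "mdist Dir (emb (ray a s)) (emb a) = 0"
    using emb_dist[OF v0 a(1)] angle_ray[OF a(1,1) s(1,3)] angle_self[OF a(1)] by simp
  then have "mdist Dir (emb (ray a s)) S < e"
    using mdist_triangle[OF emb_in[OF v0] emb_in[OF a(1)] S] a(2) by linarith
  then show ?thesis using v by blast
qed

lemma emb_continuous: "continuous_map (mtopology_of (submetric X A)) (mtopology_of Dir) emb"
  unfolding continuous_map_mtopology_iff
proof (intro conjI ballI)
  let ?T = "mtopology_of (submetric X A)"
  show "emb \<in> topspace ?T \<rightarrow> mspace Dir" using emb_in A_A0 by auto
  fix u assume "u \<in> topspace ?T"
  then have u: "u \<in> A" by auto
  have ev: "eventually (\<lambda>z. z \<in> A) (atin ?T u)"
    using eventually_atin_topspace[of "?T" u] by eventually_elim simp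
  have "continuous_map ?T ?T (\<lambda>z. z)" by simp
  then have "((\<lambda>z. d z u) \<longlongrightarrow> 0) (atin ?T u)"
    unfolding continuous_map_mtopology_iff using u by auto
  from angle_continuous[OF ev u this]
  have lim: "((\<lambda>z. ang z u) \<longlongrightarrow> 0) (atin ?T u)" .
  have "eventually (\<lambda>z. ang z u = mdist Dir (emb z) (emb u)) (atin ?T u)"
    using ev by eventually_elim (use emb_dist[OF A_A0 A_A0[OF u]] in simp)
  from Lim_transform_eventually[OF lim this]
  show "((\<lambda>z. mdist Dir (emb z) (emb u)) \<longlongrightarrow> 0) (atin ?T u)" .
qed

lemma small_chords:
  assumes uv: "u \<in> A0" "v \<in> A0" and b: "ang u v < b"
  shows "eventually (\<lambda>\<delta>. \<forall>s. 0 < s \<and> s \<le> \<delta> \<longrightarrow> d (ray u s) (ray v s) \<le> b * s) (at_right 0)"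
proof -
  have "2 * sin (ang u v / 2) < b" using sin_x_le_x[of "ang u v / 2"] angle_range[OF uv] b by simp
  then have "eventually (\<lambda>s. d (ray u s) (ray v s) / s < b) (at_right 0)"
    by (rule order_tendstoD(2)[OF angle_tendsto[OF uv]])
  then obtain c where c: "c > 0" "\<And>s. 0 < s \<Longrightarrow> s < c \<Longrightarrow> d (ray u s) (ray v s) / s < b"
    unfolding eventually_at_right_field by blast
  have "d (ray u s) (ray v s) \<le> b * s" if "0 < s" "s < c" for s
    using c(2)[OF that] that by (simp add: divide_less_eq)
  then show ?thesis unfolding eventually_at_right_field using c(1) by (intro exI[of _ c]) auto
qed

end

section \<open>Points in prescribed approximate directions\<close>

context direction_ball
begin

text \<open>
  On \<open>Y = \<Sigma> \<times> [0, 1)\<close> the tolerance at \<open>(S, t)\<close> is \<open>\<eta> = 1 - t\<close>. It bounds the distance from \<open>S\<close> of the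
  directions that are mixed (by \<open>c * \<eta>\<close>), their relative distance at the scale \<open>\<sigma>\<close> (by \<open>4 * c * \<eta>\<close>) and
  the scale itself. The constants are chosen so that the angle of the mixture is at most
  \<open>16 * 4 * c * \<eta> + \<eta> / 4 = \<eta> / 2\<close> away from one of the directions.
\<close>

lemma angle_approximation:
  obtains G where
    "continuous_map (prod_topology (mtopology_of Dir) (top_of_set {0..<1})) (mtopology_of (submetric X A)) G"
    "\<And>S t. \<lbrakk>S \<in> mspace Dir; 0 \<le> t; t < 1\<rbrakk> \<Longrightarrow> mdist Dir (emb (G (S, t))) S \<le> 1 - t"
proof -
  define Y where "Y = prod_metric Dir (submetric euclidean_metric {0..<1::real})"
  have Ysp: "y \<in> mspace Y \<longleftrightarrow> fst y \<in> mspace Dir \<and> 0 \<le> snd y \<and> snd y < 1" for y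
    by (cases y) (auto simp: Y_def)
  have Ydist: "mdist Y y z = sqrt ((mdist Dir (fst y) (fst z))\<^sup>2 + (snd y - snd z)\<^sup>2)" for y z
    by (simp add: Y_def prod_dist_def case_prod_unfold dist_real_def)
  have D1: "mdist Dir (fst y) (fst z) \<le> mdist Y y z" for y z
    unfolding Ydist by (rule real_sqrt_sum_squares_ge1)
  have D2: "\<bar>snd y - snd z\<bar> \<le> mdist Y y z" for y z
    unfolding Ydist by (rule real_le_rsqrt) simp
  have Ytop: "mtopology_of Y = prod_topology (mtopology_of Dir) (top_of_set {0..<1})"
    by (simp add: Y_def mtopology_of_prod_metric mtopology_of_submetric)
  define \<eta> where "\<eta> y = 1 - snd y" for y :: "(nat \<Rightarrow> 'a) set \<times> real"
  have \<eta>: "0 < \<eta> y" "\<eta> y \<le> 1" if "y \<in> mspace Y" for y using that by (auto simp: Ysp \<eta>_def)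
  define c :: real where "c = 1 / 256"
  define h where "h v y = (c * \<eta> y - mdist Dir (emb v) (fst y)) / 2" for v y
  \<comment> \<open>The factor \<open>1 / 2\<close> in \<open>h\<close> serves to make it Lipschitz with constant \<open>1\<close>.\<close>
  have cover: "\<exists>v\<in>A. 0 < h v y" if y: "y \<in> mspace Y" for y
    using emb_dense_ball[of "fst y" "c * \<eta> y"] y \<eta>[OF y] by (auto simp: Ysp h_def c_def)
  have lip: "\<bar>h v y - h v z\<bar> \<le> mdist Y y z" if v: "v \<in> A" and y: "y \<in> mspace Y" and z: "z \<in> mspace Y" for v y z
  proof -
    have e: "emb v \<in> mspace Dir" by (rule emb_in[OF A_A0[OF v]])
    have "fst y \<in> mspace Dir" "fst z \<in> mspace Dir" using y z by (auto simp: Ysp)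
    then have "\<bar>mdist Dir (emb v) (fst y) - mdist Dir (emb v) (fst z)\<bar> \<le> mdist Dir (fst y) (fst z)"
      using mdist_triangle[OF e, of "fst y" "fst z"] mdist_triangle[OF e, of "fst z" "fst y"]
        mdist_commute[of Dir "fst y" "fst z"] by (simp add: abs_le_iff)
    then have "\<bar>mdist Dir (emb v) (fst y) - mdist Dir (emb v) (fst z)\<bar> \<le> mdist Y y z" using D1[of y z] by linarith
    moreover have "\<bar>c * (snd y - snd z)\<bar> \<le> 1 * mdist Y y z"
      unfolding abs_mult using D2[of y z] by (intro mult_mono) (auto simp: c_def)
    moreover have "2 * (h v y - h v z) = (mdist Dir (emb v) (fst z) - mdist Dir (emb v) (fst y)) - c * (snd y - snd z)"
      by (simp add: h_def \<eta>_def field_simps)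
    moreover have "\<bar>x\<bar> \<le> D" if "\<bar>a - b\<bar> \<le> D" "\<bar>e\<bar> \<le> 1 * D" "2 * x = (b - a) - e" for a b e x D :: real
      using that by linarith
    ultimately show ?thesis by blast
  qed
  obtain l :: "nat \<Rightarrow> (nat \<Rightarrow> 'a) set \<times> real \<Rightarrow> real" and \<iota> where
    L: "\<forall>n y. 0 \<le> l n y \<and> l n y \<le> 1"
    "\<forall>n. \<exists>L. \<forall>y\<in>mspace Y. \<forall>z\<in>mspace Y. \<bar>l n y - l n z\<bar> \<le> L * mdist Y y z"
    "\<forall>n. \<forall>y\<in>mspace Y. \<iota> n y \<in> A \<and> (0 < l n y \<longrightarrow> 0 < h (\<iota> n y) y)"
    "\<forall>n. \<forall>y\<in>mspace Y. \<exists>\<delta>>0. (\<forall>z\<in>mspace Y. mdist Y y z < \<delta> \<longrightarrow> l n z = 0) \<or>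
        (\<forall>z\<in>mspace Y. mdist Y y z < \<delta> \<longrightarrow> \<iota> n z = \<iota> n y)"
    "\<forall>y\<in>mspace Y. \<exists>n. \<exists>\<delta>>0. \<forall>z\<in>mspace Y. mdist Y y z < \<delta> \<longrightarrow> l n z = 1"
  proof -
    have "\<forall>y\<in>mspace Y. \<exists>v\<in>A. 0 < h v y"
      "\<forall>v\<in>A. \<forall>y\<in>mspace Y. \<forall>z\<in>mspace Y. \<bar>h v y - h v z\<bar> \<le> mdist Y y z"
      using cover lip by blast+
    from discrete_layers[OF this] show thesis by (elim exE conjE) (rule that)
  qed
  note l = L(1)[rule_format] and l_lip = L(2)[rule_format] and alt = L(4)[rule_format] and one = L(5)[rule_format]
  have \<iota>A: "\<iota> n y \<in> A" if "y \<in> mspace Y" for n y using L(3) that by blast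
  have \<iota>h: "0 < h (\<iota> n y) y" if "y \<in> mspace Y" "0 < l n y" for n y using L(3) that by blast
  \<comment> \<open>The direction \<open>\<iota> (N y) y\<close> has full weight; the mixture stays close to it.\<close>
  define N where "N y = (LEAST n. l n y = 1)" for y
  have lN: "l (N y) y = 1" if y: "y \<in> mspace Y" for y
  proof -
    obtain n \<delta> where "\<delta> > 0" "\<forall>z\<in>mspace Y. mdist Y y z < \<delta> \<longrightarrow> l n z = 1" using one[OF y] by blast
    then have "l n y = 1" using y by simp
    then show ?thesis unfolding N_def by (rule LeastI)
  qed
  have N_le: "N y \<le> n" if "l n y = 1" for n y unfolding N_def using that by (rule Least_le)
  have \<iota>dist: "mdist Dir (emb (\<iota> n y)) (fst y) < c * \<eta> y" if "y \<in> mspace Y" "0 < l n y" for n y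
    using \<iota>h[OF that] by (simp add: h_def)
  \<comment> \<open>The requirements on the scale \<open>s\<close> at \<open>y\<close>: they concern the chords of the directions with
      positive weight, up to the index \<open>N y\<close>, with respect to the direction \<open>\<iota> (N y) y\<close>.\<close>
  define P where "P y s \<longleftrightarrow> 480 * (1 + k) * s \<le> \<eta> y \<and>
    (\<forall>n\<le>N y. 0 < l n y \<longrightarrow> s \<le> d p (\<iota> n y) \<and> d (ray (\<iota> n y) s) (ray (\<iota> (N y) y) s) \<le> 4 * c * \<eta> y * s)" for y s
  have loc: "\<forall>y\<in>mspace Y. \<exists>\<delta>>0. \<forall>z\<in>mspace Y. mdist Y y z < \<delta> \<longrightarrow> (\<forall>s. 0 < s \<and> s \<le> \<delta> \<longrightarrow> P z s)"
  proof
    fix y assume y: "y \<in> mspace Y"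
    obtain n0 \<delta>0 where n0: "\<delta>0 > 0" "\<And>z. \<lbrakk>z \<in> mspace Y; mdist Y y z < \<delta>0\<rbrakk> \<Longrightarrow> l n0 z = 1" using one[OF y] by blast
    have v: "\<iota> n y \<in> A0" for n by (rule A_A0[OF \<iota>A[OF y]])
    have near0: "eventually (\<lambda>\<delta>. \<delta> < b) (at_right 0)" if "0 < b" for b :: real
      using that by (auto simp: eventually_at_right_field)
    have e1: "eventually (\<lambda>\<delta>. 0 < \<delta> \<and> \<delta> < \<delta>0 \<and> \<delta> < \<eta> y / 10 \<and> \<delta> < \<eta> y / (600 * (1 + k))) (at_right 0)"
    proof (intro eventually_conj near0 n0(1))
      show "eventually (\<lambda>\<delta>. 0 < \<delta>) (at_right (0::real))" by (rule eventually_at_right_less)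
      show "0 < \<eta> y / 10" "0 < \<eta> y / (600 * (1 + k))" using \<eta>[OF y] k by simp_all
    qed
    \<comment> \<open>Near \<open>y\<close> only the finitely many directions \<open>\<iota> n y\<close> with \<open>n \<le> n0\<close> occur. Their chords are
        controlled by constants slightly larger than at \<open>y\<close>, because \<open>\<eta>\<close> varies.\<close>
    define settled where "settled n \<delta> \<longleftrightarrow> (\<forall>z\<in>mspace Y. mdist Y y z < \<delta> \<longrightarrow> l n z = 0) \<or>
        (\<forall>z\<in>mspace Y. mdist Y y z < \<delta> \<longrightarrow> \<iota> n z = \<iota> n y)" for n \<delta>
    have e2: "eventually (settled n) (at_right 0)" for n
    proof -
      obtain \<delta> where \<delta>: "0 < \<delta>" "settled n \<delta>" using alt[OF y] unfolding settled_def by blast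
      from near0[OF \<delta>(1)] show ?thesis
        by eventually_elim (use \<delta>(2) in \<open>unfold settled_def, meson order.strict_trans\<close>)
    qed
    have e3: "eventually (\<lambda>\<delta>. \<delta> < d p (\<iota> n y)) (at_right 0)" for n
      by (rule near0[OF A0_pos[OF v]])
    define thin where "thin n m \<delta> \<longleftrightarrow> (ang (\<iota> n y) (\<iota> m y) < (5/2) * c * \<eta> y \<longrightarrow>
        (\<forall>s. 0 < s \<and> s \<le> \<delta> \<longrightarrow> d (ray (\<iota> n y) s) (ray (\<iota> m y) s) \<le> (5/2) * c * \<eta> y * s))" for n m \<delta>
    have e4: "eventually (thin n m) (at_right 0)" for n m
      using small_chords[OF v v, of n m "(5/2) * c * \<eta> y"] unfolding thin_def
      by (cases "ang (\<iota> n y) (\<iota> m y) < (5/2) * c * \<eta> y") auto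
    have "eventually (\<lambda>\<delta>. \<forall>n\<in>{..n0}. settled n \<delta>) (at_right 0)"
      "eventually (\<lambda>\<delta>. \<forall>n\<in>{..n0}. \<delta> < d p (\<iota> n y)) (at_right 0)"
      "eventually (\<lambda>\<delta>. \<forall>n\<in>{..n0}. \<forall>m\<in>{..n0}. thin n m \<delta>) (at_right 0)"
      by (intro eventually_ball_finite finite_atMost ballI e2 e3 e4)+
    with e1 have "eventually (\<lambda>\<delta>. (0 < \<delta> \<and> \<delta> < \<delta>0 \<and> \<delta> < \<eta> y / 10 \<and> \<delta> < \<eta> y / (600 * (1 + k))) \<and>
      (\<forall>n\<in>{..n0}. settled n \<delta>) \<and> (\<forall>n\<in>{..n0}. \<delta> < d p (\<iota> n y)) \<and>
      (\<forall>n\<in>{..n0}. \<forall>m\<in>{..n0}. thin n m \<delta>)) (at_right 0)"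
      by eventually_elim (intro conjI; (elim conjE)?; assumption)
    from eventually_happens'[OF trivial_limit_at_right_real this]
    obtain \<delta> where \<delta>: "0 < \<delta>" "\<delta> < \<delta>0" "\<delta> < \<eta> y / 10" "\<delta> < \<eta> y / (600 * (1 + k))" and
      settled: "\<forall>n\<in>{..n0}. settled n \<delta>" and dp0: "\<forall>n\<in>{..n0}. \<delta> < d p (\<iota> n y)" and
      thin: "\<forall>n\<in>{..n0}. \<forall>m\<in>{..n0}. thin n m \<delta>"
      by (elim exE conjE) (rule that)
    have dp: "\<delta> < d p (\<iota> n y)" if "n \<le> n0" for n using bspec[OF dp0, of n] that by simp
    have chord: "d (ray (\<iota> n y) s) (ray (\<iota> m y) s) \<le> (5/2) * c * \<eta> y * s"
      if "n \<le> n0" "m \<le> n0" "ang (\<iota> n y) (\<iota> m y) < (5/2) * c * \<eta> y" "0 < s" "s \<le> \<delta>" for n m s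
      using bspec[OF bspec[OF thin, of n], of m] that by (simp add: thin_def)
    have "P z s" if z: "z \<in> mspace Y" "mdist Y y z < \<delta>" and s: "0 < s" "s \<le> \<delta>" for z s
    proof -
      have \<eta>z: "\<bar>\<eta> y - \<eta> z\<bar> < \<eta> y / 10" using D2[of y z] z(2) \<delta>(3) unfolding \<eta>_def by linarith
      have Nz: "N z \<le> n0" using N_le[OF n0(2)[OF z(1)]] z(2) \<delta>(2) by simp
      have same: "\<iota> n z = \<iota> n y" if "n \<le> n0" "0 < l n z" for n
        using bspec[OF settled, of n] that z unfolding settled_def by fastforce
      have sN: "\<iota> (N z) z = \<iota> (N z) y" by (rule same[OF Nz]) (simp add: lN[OF z(1)])
      have "480 * (1 + k) * s \<le> \<eta> z"
      proof -
        have "s \<le> \<eta> y / (600 * (1 + k))" using s \<delta>(4) by linarith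
        then have "600 * (1 + k) * s \<le> \<eta> y" using k by (simp add: pos_le_divide_eq mult.commute)
        moreover have "480 * (1 + k) * s = (4/5) * (600 * (1 + k) * s)" by simp
        ultimately show ?thesis using \<eta>z by linarith
      qed
      moreover have "s \<le> d p (\<iota> n z)" "d (ray (\<iota> n z) s) (ray (\<iota> (N z) z) s) \<le> 4 * c * \<eta> z * s"
        if n: "n \<le> N z" "0 < l n z" for n
      proof -
        have nn: "n \<le> n0" using n(1) Nz by simp
        have eq: "\<iota> n z = \<iota> n y" by (rule same[OF nn n(2)])
        show "s \<le> d p (\<iota> n z)" using dp[OF nn] s by (simp add: eq)
        have fz: "fst z \<in> mspace Dir" using z(1) by (simp add: Ysp)
        have "ang (\<iota> n y) (\<iota> (N z) y) = mdist Dir (emb (\<iota> n z)) (emb (\<iota> (N z) z))"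
          using emb_dist[OF v v, of n "N z"] by (simp add: eq sN)
        also have "\<dots> \<le> mdist Dir (emb (\<iota> n z)) (fst z) + mdist Dir (emb (\<iota> (N z) z)) (fst z)"
          using mdist_triangle[OF emb_in[OF A_A0[OF \<iota>A[OF z(1)]]] fz emb_in[OF A_A0[OF \<iota>A[OF z(1)]]], of n "N z"]
          by (simp add: mdist_commute)
        also have "\<dots> < 2 * (c * \<eta> z)" using \<iota>dist[OF z(1) n(2)] \<iota>dist[OF z(1), of "N z"] lN[OF z(1)] by simp
        also have "\<dots> \<le> (5/2) * c * \<eta> y" using \<eta>z unfolding c_def by linarith
        finally have "d (ray (\<iota> n y) s) (ray (\<iota> (N z) y) s) \<le> (5/2) * c * \<eta> y * s"
          using chord[OF nn Nz] s by blast
        also have "\<dots> \<le> 4 * c * \<eta> z * s" using \<eta>z s unfolding c_def by (intro mult_right_mono) linarith+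
        finally show "d (ray (\<iota> n z) s) (ray (\<iota> (N z) z) s) \<le> 4 * c * \<eta> z * s" by (simp add: eq sN)
      qed
      ultimately show ?thesis unfolding P_def by blast
    qed
    then show "\<exists>\<delta>>0. \<forall>z\<in>mspace Y. mdist Y y z < \<delta> \<longrightarrow> (\<forall>s. 0 < s \<and> s \<le> \<delta> \<longrightarrow> P z s)"
      using \<delta>(1) by blast
  qed
  obtain \<sigma> where \<sigma>: "\<And>y. y \<in> mspace Y \<Longrightarrow> 0 < \<sigma> y" "\<And>y. y \<in> mspace Y \<Longrightarrow> P y (\<sigma> y)" and
    \<sigma>lip: "\<And>y z. \<lbrakk>y \<in> mspace Y; z \<in> mspace Y\<rbrakk> \<Longrightarrow> \<bar>\<sigma> y - \<sigma> z\<bar> \<le> mdist Y y z"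
    using lipschitz_scale[OF loc] by blast
  \<comment> \<open>The minimum keeps the points on the geodesics also where their weight vanishes and the scale
      is unrelated to them.\<close>
  define x where "x y n = ray (\<iota> n y) (min (\<sigma> y) (d p (\<iota> n y)))" for y n
  have xB: "x y n \<in> B" if y: "y \<in> mspace Y" for y n
    unfolding x_def using \<iota>A[OF y, of n] \<sigma>(1)[OF y] by (intro ray_in_B[OF A_A0]) auto
  define G where "G y = mix (\<lambda>n. l n y) (x y) (Suc (N y)) p" for y
  have G: "G y \<in> A \<and> mdist Dir (emb (G y)) (fst y) \<le> \<eta> y" if y: "y \<in> mspace Y" for y
  proof -
    define v where "v = \<iota> (N y) y"
    define q where "q = x y (N y)"
    have v: "v \<in> A" "v \<in> A0" using \<iota>A[OF y] A_A0 by (auto simp: v_def simp del: in_mball_of)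
    have s: "0 < \<sigma> y" "480 * (1 + k) * \<sigma> y \<le> \<eta> y" "\<sigma> y \<le> d p v"
      using \<sigma>(1)[OF y] \<sigma>(2)[OF y] lN[OF y] by (auto simp: P_def v_def)
    have q: "q = ray v (\<sigma> y)" using s by (simp add: q_def x_def v_def)
    have dq: "d p q = \<sigma> y" using ray_dist(1)[OF v(2) _ s(3)] s by (simp add: q)
    have qB: "q \<in> B" unfolding q_def by (rule xB[OF y])
    have qA: "q \<in> A" using qB dq s p by (auto simp del: in_mball_of)
    define r where "r = 4 * c * \<eta> y"
    have r: "0 \<le> r" "r \<le> 1 / 2" "r < 1" using \<eta>[OF y] by (auto simp: r_def c_def)
    have Gq: "G y = mix (\<lambda>n. l n y) (x y) (N y) q"
      using between_ends(2)[OF pB qB] by (simp add: G_def lN[OF y] q_def del: in_mball_of)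
    have close: "d q (G y) \<le> r * \<sigma> y" unfolding Gq
    proof (rule mix_convex[OF xB[OF y] l qB qB])
      show "d q q \<le> r * \<sigma> y" using qB r s by simp
      fix n assume n: "n < N y" "0 < l n y"
      then have *: "\<sigma> y \<le> d p (\<iota> n y)" "d (ray (\<iota> n y) (\<sigma> y)) (ray v (\<sigma> y)) \<le> r * \<sigma> y"
        using \<sigma>(2)[OF y] by (auto simp: P_def v_def r_def)
      then show "d q (x y n) \<le> r * \<sigma> y" by (simp add: q x_def mdist_commute)
    qed
    have GB: "G y \<in> B" unfolding Gq by (rule mix_in_B[OF xB[OF y] l qB])
    have "r * \<sigma> y < 1 * \<sigma> y" using r s by (intro mult_strict_right_mono) auto
    then have "G y \<noteq> p" using close dq by (auto simp: mdist_commute)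
    then have GA: "G y \<in> A" using GB by blast
    have "ang (G y) q \<le> 16 * r + 120 * (1 + k) * d p q"
      by (rule angle_close[OF GA qA _ r(2)]) (use close in \<open>simp add: dq mdist_commute\<close>)
    then have "ang (G y) q \<le> (1 / 4) * \<eta> y + 120 * (1 + k) * \<sigma> y" by (simp add: dq r_def c_def)
    moreover have "120 * (1 + k) * \<sigma> y = (1 / 4) * (480 * (1 + k) * \<sigma> y)" by simp
    ultimately have 1: "ang (G y) q \<le> \<eta> y / 2" using s(2) by linarith
    have 2: "ang q v = 0"
      using angle_ray[OF v(2,2) s(1,3)] angle_self[OF v(2)] by (simp add: q)
    have 3: "mdist Dir (emb v) (fst y) < c * \<eta> y"
      using \<iota>dist[OF y, of "N y"] lN[OF y] by (simp add: v_def)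
    have "mdist Dir (emb (G y)) (emb v) \<le> \<eta> y / 2"
      using angle_triangle[OF A_A0[OF GA] A_A0[OF qA] v(2)] 1 2 emb_dist[OF A_A0[OF GA] v(2)] by simp
    moreover have "mdist Dir (emb (G y)) (fst y) \<le> mdist Dir (emb (G y)) (emb v) + mdist Dir (emb v) (fst y)"
      using y by (intro mdist_triangle emb_in v(2) A_A0[OF GA]) (auto simp: Ysp)
    ultimately have "mdist Dir (emb (G y)) (fst y) \<le> \<eta> y"
      using 3 \<eta>(1)[OF y] unfolding c_def by linarith
    then show ?thesis using GA by blast
  qed
  have "continuous_map (mtopology_of Y) (mtopology_of (submetric X A)) G"
    unfolding continuous_map_mtopology_iff
  proof (intro conjI ballI)
    show "G \<in> topspace (mtopology_of Y) \<rightarrow> mspace (submetric X A)" using G by auto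
    fix y assume "y \<in> topspace (mtopology_of Y)"
    then have y: "y \<in> mspace Y" by simp
    let ?F = "atin (mtopology_of Y) y"
    obtain n0 \<delta>0 where n0: "\<delta>0 > 0" "\<And>z. \<lbrakk>z \<in> mspace Y; mdist Y y z < \<delta>0\<rbrakk> \<Longrightarrow> l n0 z = 1" using one[OF y] by blast
    have Geq: "G z = mix (\<lambda>n. l n z) (x z) (Suc n0) p" if z: "z \<in> mspace Y" "l n0 z = 1" for z
      unfolding G_def by (rule mix_truncate[where l = "\<lambda>n. l n z" and x = "x z", OF xB[OF z(1)] l lN[OF z(1)] N_le[OF z(2)] pB pB, symmetric])
    have Y1: "eventually (\<lambda>z. z \<in> mspace Y) ?F" using eventually_atin_topspace[of "mtopology_of Y" y] by simp
    have l1: "eventually (\<lambda>z. l n0 z = 1) ?F" by (rule eventually_atin_mball[OF y n0])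
    have "((\<lambda>z. d (mix (\<lambda>n. l n z) (x z) (Suc n0) p) (mix (\<lambda>n. l n y) (x y) (Suc n0) p)) \<longlongrightarrow> 0) ?F"
    proof (rule mix_tendsto[where l = "\<lambda>z n. l n z" and x = x and ?x0.0 = "x y" and ?l0.0 = "\<lambda>n. l n y"
          and w = "\<lambda>_. p" and ?w0.0 = p])
      show "eventually (\<lambda>z. \<forall>m. x z m \<in> B) ?F" using Y1 by eventually_elim (blast intro: xB)
      show "x y m \<in> B" for m by (rule xB[OF y])
      show "eventually (\<lambda>z. \<forall>m. 0 \<le> l m z \<and> l m z \<le> 1) ?F" using l by (intro always_eventually) blast
      show "0 \<le> l m y \<and> l m y \<le> 1" for m by (rule l)
      show "((\<lambda>z. l m z) \<longlongrightarrow> l m y) ?F" for m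
      proof -
        obtain L where "\<forall>y\<in>mspace Y. \<forall>z\<in>mspace Y. \<bar>l m y - l m z\<bar> \<le> L * mdist Y y z" using l_lip by blast
        then show ?thesis using y by (intro lipschitz_tendsto_atin[where L = L]) auto
      qed
      show "(eventually (\<lambda>z. l m z = 0) ?F \<and> l m y = 0) \<or> ((\<lambda>z. d (x z m) (x y m)) \<longlongrightarrow> 0) ?F" for m
      proof -
        obtain \<delta> where \<delta>: "0 < \<delta>" "(\<forall>z\<in>mspace Y. mdist Y y z < \<delta> \<longrightarrow> l m z = 0) \<or>
          (\<forall>z\<in>mspace Y. mdist Y y z < \<delta> \<longrightarrow> \<iota> m z = \<iota> m y)" using alt[OF y] by blast
        show ?thesis using \<delta>(2)
        proof (elim disjE)
          assume 0: "\<forall>z\<in>mspace Y. mdist Y y z < \<delta> \<longrightarrow> l m z = 0"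
          then have "eventually (\<lambda>z. l m z = 0) ?F" by (intro eventually_atin_mball[OF y \<delta>(1)]) blast
          moreover have "l m y = 0" using 0 y \<delta>(1) by simp
          ultimately show ?thesis by blast
        next
          assume const: "\<forall>z\<in>mspace Y. mdist Y y z < \<delta> \<longrightarrow> \<iota> m z = \<iota> m y"
          define v where "v = \<iota> m y"
          have v: "v \<in> A0" unfolding v_def by (rule A_A0[OF \<iota>A[OF y]])
          have ev: "eventually (\<lambda>z. \<iota> m z = v) ?F" unfolding v_def
            by (rule eventually_atin_mball[OF y \<delta>(1)]) (use const in blast)
          have \<sigma>t: "(\<sigma> \<longlongrightarrow> \<sigma> y) ?F"
            using \<sigma>lip[OF y] by (intro lipschitz_tendsto_atin[OF y, where L = 1]) simp
          have "((\<lambda>z. \<bar>min (\<sigma> z) (d p v) - min (\<sigma> y) (d p v)\<bar>) \<longlongrightarrow> \<bar>min (\<sigma> y) (d p v) - min (\<sigma> y) (d p v)\<bar>) ?F"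
            by (intro tendsto_intros \<sigma>t)
          moreover have "eventually (\<lambda>z. \<bar>min (\<sigma> z) (d p v) - min (\<sigma> y) (d p v)\<bar> = d (x z m) (x y m)) ?F"
            using ev Y1
          proof eventually_elim
            case (elim z)
            have "d (ray v (min (\<sigma> z) (d p v))) (ray v (min (\<sigma> y) (d p v))) = \<bar>min (\<sigma> z) (d p v) - min (\<sigma> y) (d p v)\<bar>"
              by (rule ray_dist_ray[OF v]) (use \<sigma>(1)[OF y] \<sigma>(1)[OF elim(2)] in auto)
            then show ?case using elim(1) by (simp add: x_def v_def)
          qed
          ultimately have "((\<lambda>z. d (x z m) (x y m)) \<longlongrightarrow> 0) ?F"
            using Lim_transform_eventually by fastforce
          then show ?thesis by blast
        qed
      qed
    qed (use pB p in auto)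
    moreover have "eventually (\<lambda>z. d (mix (\<lambda>n. l n z) (x z) (Suc n0) p) (mix (\<lambda>n. l n y) (x y) (Suc n0) p) = d (G z) (G y)) ?F"
      using Y1 l1
    proof eventually_elim
      case (elim z)
      have "l n0 y = 1" using n0 y by simp
      then show ?case by (simp only: Geq[OF elim] Geq[OF y])
    qed
    ultimately show "((\<lambda>z. mdist (submetric X A) (G z) (G y)) \<longlongrightarrow> 0) ?F"
      unfolding mdist_submetric by (rule Lim_transform_eventually)
  qed
  moreover have "mdist Dir (emb (G (S, t))) S \<le> 1 - t" if "S \<in> mspace Dir" "0 \<le> t" "t < 1" for S t
    using G[of "(S, t)"] that by (simp add: Ysp \<eta>_def)
  ultimately show thesis using that unfolding Ytop by blast
qed

end

section \<open>The homotopy equivalence\<close>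

lemma atin_open_subtopology:
  assumes V: "openin T V" and x: "x \<in> V"
  shows "atin (subtopology T V) x = atin T x"
proof (rule filter_eqI)
  fix Q
  have xT: "x \<in> topspace T" using V x openin_subset by blast
  have "(\<exists>U. openin T U \<and> U \<subseteq> V \<and> x \<in> U \<and> (\<forall>y\<in>U - {x}. Q y)) \<longleftrightarrow>
      (\<exists>U. openin T U \<and> x \<in> U \<and> (\<forall>y\<in>U - {x}. Q y))" (is "?L \<longleftrightarrow> ?R")
  proof
    assume ?R
    then obtain U where "openin T U" "x \<in> U" "\<forall>y\<in>U - {x}. Q y" by blast
    then show ?L using V x openin_Int[of T U V] by (intro exI[of _ "U \<inter> V"]) blast
  qed blast
  then show "eventually Q (atin (subtopology T V) x) \<longleftrightarrow> eventually Q (atin T x)"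
    unfolding eventually_atin openin_open_subtopology[OF V] using x xT by (simp add: conj_assoc)
qed

context convex_ball
begin

lemma between_continuous_map:
  assumes f: "continuous_map T (mtopology_of X) f" "f \<in> topspace T \<rightarrow> B"
    and g: "continuous_map T (mtopology_of X) g" "g \<in> topspace T \<rightarrow> B"
    and h: "continuous_map T euclideanreal h" "h \<in> topspace T \<rightarrow> {0..1}"
  shows "continuous_map T (mtopology_of X) (\<lambda>z. between (f z) (g z) (h z))"
  unfolding continuous_map_mtopology_iff
proof (intro conjI ballI)
  have gB: "between (f z) (g z) (h z) \<in> B" if "z \<in> topspace T" for z
    using f(2) g(2) h(2) that by (intro between_in_B) auto
  then show "(\<lambda>z. between (f z) (g z) (h z)) \<in> topspace T \<rightarrow> mspace X" by auto
  fix y assume y: "y \<in> topspace T"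
  have ev: "eventually (\<lambda>z. z \<in> topspace T) (atin T y)" by (rule eventually_atin_topspace)
  have "limitin euclideanreal h (h y) (atin T y)" using h(1) y by (simp add: continuous_map_atin)
  then have hl: "(h \<longlongrightarrow> h y) (atin T y)" by simp
  show "((\<lambda>z. mdist X (between (f z) (g z) (h z)) (between (f y) (g y) (h y))) \<longlongrightarrow> 0) (atin T y)"
  proof (rule between_tendsto)
    show "eventually (\<lambda>z. f z \<in> B) (atin T y)" "eventually (\<lambda>z. g z \<in> B) (atin T y)"
      "eventually (\<lambda>z. 0 \<le> h z \<and> h z \<le> 1) (atin T y)"
      using ev f(2) g(2) h(2) by (auto elim!: eventually_mono simp del: in_mball_of)
    show "f y \<in> B" "g y \<in> B" "0 \<le> h y" "h y \<le> 1" using f(2) g(2) h(2) y by auto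
    show "((\<lambda>z. mdist X (f z) (f y)) \<longlongrightarrow> 0) (atin T y)" "((\<lambda>z. mdist X (g z) (g y)) \<longlongrightarrow> 0) (atin T y)"
      using f(1) g(1) y unfolding continuous_map_mtopology_iff by blast+
  qed (rule hl)
qed

end

context direction_ball
begin

declare p [simp]

text \<open>
  The two homotopies described at the beginning. The one on \<open>\<Sigma>\<close> is defined by cases and is continuous
  at \<open>t = 1\<close> since \<open>emb (G (S, t))\<close> is within \<open>1 - t\<close> of \<open>S\<close>.
\<close>

lemma punctured_ball_homotopy_equivalent:
  "subtopology (mtopology_of X) A homotopy_equivalent_space mtopology_of Dir"
proof -
  let ?TA = "mtopology_of (submetric X A)" and ?TD = "mtopology_of Dir"
  let ?I = "top_of_set {0..1::real}"
  obtain G where G: "continuous_map (prod_topology ?TD (top_of_set {0..<1})) ?TA G"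
    and Gd: "\<And>S t. \<lbrakk>S \<in> mspace Dir; 0 \<le> t; t < 1\<rbrakk> \<Longrightarrow> mdist Dir (emb (G (S, t))) S \<le> 1 - t"
    by (rule angle_approximation) (use that in blast)
  have GA: "G (S, t) \<in> A" if "S \<in> mspace Dir" "0 \<le> t" "t < 1" for S t
    using funcset_mem[OF continuous_map_funspace[OF G], of "(S, t)"] that by simp
  define g where "g S = G (S, 0)" for S
  have gA: "g S \<in> A" if "S \<in> mspace Dir" for S unfolding g_def using GA[OF that] by simp
  have "continuous_map ?TD (prod_topology ?TD (top_of_set {0..<1::real})) (\<lambda>S. (S, 0))"
    by (intro continuous_map_pairedI continuous_map_id[unfolded id_def]) auto
  from continuous_map_compose[OF this G]
  have g: "continuous_map ?TD ?TA g" by (simp add: g_def[abs_def] o_def)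
  have embA: "emb u \<in> mspace Dir" if "u \<in> A" for u by (rule emb_in[OF A_A0[OF that]])
  have "homotopic_with (\<lambda>_. True) ?TA ?TA (g \<circ> emb) id"
  proof -
    let ?h = "\<lambda>z. between (g (emb (snd z))) (snd z) (fst z)"
    have TA_X: "continuous_map T (mtopology_of X) f" if "continuous_map T ?TA f" for T :: "'z topology" and f
      using that unfolding mtopology_of_submetric by (rule continuous_map_into_fulltopology)
    have s: "continuous_map (prod_topology ?I ?TA) ?TA snd" by (rule continuous_map_snd)
    have f: "continuous_map (prod_topology ?I ?TA) euclideanreal fst"
      using continuous_map_fst[of ?I ?TA] by (rule continuous_map_into_fulltopology)
    have gs: "continuous_map (prod_topology ?I ?TA) ?TA (\<lambda>z. g (emb (snd z)))"
      using continuous_map_compose[OF continuous_map_compose[OF s emb_continuous] g] by (simp add: o_def)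
    have c: "continuous_map (prod_topology ?I ?TA) (mtopology_of X) ?h"
    proof (rule between_continuous_map[OF TA_X[OF gs] _ TA_X[OF s] _ f])
      show "(\<lambda>z. g (emb (snd z))) \<in> topspace (prod_topology ?I ?TA) \<rightarrow> B"
      proof
        fix z assume "z \<in> topspace (prod_topology ?I ?TA)"
        then have "snd z \<in> A" by auto
        then show "g (emb (snd z)) \<in> B" using gA[OF embA] by blast
      qed
    qed auto
    have hA: "?h z \<in> A" if z: "z \<in> topspace (prod_topology ?I ?TA)" for z
    proof (rule between_avoids_p)
      have u: "snd z \<in> A" using z by auto
      show "snd z \<in> A" by (rule u)
      show gA': "g (emb (snd z)) \<in> A" by (rule gA[OF embA[OF u]])
      have "ang (g (emb (snd z))) (snd z) \<le> 1"
        using Gd[OF embA[OF u], of 0] emb_dist[OF A_A0[OF gA'] A_A0[OF u]] by (simp add: g_def)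
      then show "ang (g (emb (snd z))) (snd z) < pi" using pi_gt3 by simp
      show "0 \<le> fst z" "fst z \<le> 1" using z by auto
    qed
    have c': "continuous_map (prod_topology ?I ?TA) ?TA ?h"
      unfolding mtopology_of_submetric[of X A]
      by (rule continuous_map_into_subtopology) (use c hA in \<open>auto simp: mtopology_of_submetric simp del: in_mball_of\<close>)
    show ?thesis
    proof (subst homotopic_with, simp, intro exI[of _ ?h] conjI ballI c')
      fix u assume "u \<in> topspace ?TA"
      then have u: "u \<in> A" by auto
      then have B: "u \<in> B" "g (emb u) \<in> B" using gA[OF embA[OF u]] by auto
      show "?h (0, u) = (g \<circ> emb) u" using between_ends(1)[OF B(2,1)] by simp
      show "?h (1, u) = id u" using between_ends(2)[OF B(2,1)] by simp
    qed simp
  qed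
  moreover have "homotopic_with (\<lambda>_. True) ?TD ?TD (emb \<circ> g) id"
  proof -
    define H where "H z = (if fst z < 1 then emb (G (snd z, fst z)) else snd z)" for z :: "real \<times> (nat \<Rightarrow> 'a) set"
    let ?T = "prod_topology ?I ?TD"
    have tT: "z \<in> topspace ?T \<longleftrightarrow> 0 \<le> fst z \<and> fst z \<le> 1 \<and> snd z \<in> mspace Dir" for z by (cases z) auto
    have HD: "H z \<in> mspace Dir" if "z \<in> topspace ?T" for z
      using that embA[OF GA] by (auto simp: H_def tT)
    have Hd: "mdist Dir (H z) (snd z) \<le> 1 - fst z" if "z \<in> topspace ?T" for z
      using that Gd by (auto simp: H_def tT)
    have "continuous_map ?T ?TD H"
      unfolding continuous_map_mtopology_iff
    proof (intro conjI ballI)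
      show "H \<in> topspace ?T \<rightarrow> mspace Dir" using HD by blast
      fix z0 assume z0: "z0 \<in> topspace ?T"
      have evT: "eventually (\<lambda>z. z \<in> topspace ?T) (atin ?T z0)" by (rule eventually_atin_topspace)
      show "((\<lambda>z. mdist Dir (H z) (H z0)) \<longlongrightarrow> 0) (atin ?T z0)"
      proof (cases "fst z0 < 1")
        case True
        define V where "V = {0..<1::real} \<times> mspace Dir"
        have "openin ?I {0..<1::real}"
          unfolding openin_open by (rule exI[of _ "{..<1}"]) auto
        then have V: "openin ?T V" unfolding V_def by (simp add: openin_prod_Times_iff openin_topspace[of ?TD, simplified])
        have z0V: "z0 \<in> V" using z0 True by (auto simp: V_def tT)
        have "continuous_map (subtopology ?T V) (prod_topology ?TD (top_of_set {0..<1::real})) (\<lambda>z. (snd z, fst z))"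
        proof (rule continuous_map_pairedI)
          show "continuous_map (subtopology ?T V) ?TD snd"
            by (rule continuous_map_from_subtopology[OF continuous_map_snd])
          have "continuous_map (subtopology ?T V) euclideanreal fst"
            using continuous_map_from_subtopology[OF continuous_map_fst[of ?I ?TD]]
            by (rule continuous_map_into_fulltopology)
          then show "continuous_map (subtopology ?T V) (top_of_set {0..<1::real}) fst"
            by (rule continuous_map_into_subtopology) (auto simp: V_def)
        qed
        from continuous_map_compose[OF continuous_map_compose[OF this G] emb_continuous]
        have "continuous_map (subtopology ?T V) ?TD (\<lambda>z. emb (G (snd z, fst z)))" by (simp add: o_def)
        then have "((\<lambda>z. mdist Dir (emb (G (snd z, fst z))) (emb (G (snd z0, fst z0)))) \<longlongrightarrow> 0) (atin (subtopology ?T V) z0)"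
          unfolding continuous_map_mtopology_iff using z0V z0 by auto
        moreover have "atin (subtopology ?T V) z0 = atin ?T z0"
          by (rule atin_open_subtopology[OF V z0V])
        moreover have "eventually (\<lambda>z. mdist Dir (emb (G (snd z, fst z))) (emb (G (snd z0, fst z0))) = mdist Dir (H z) (H z0)) (atin ?T z0)"
          unfolding eventually_atin
          by (intro disjI2 exI[of _ V] conjI V z0V ballI) (use True in \<open>auto simp: V_def H_def\<close>)
        ultimately show ?thesis using Lim_transform_eventually by fastforce
      next
        case False
        then have f0: "fst z0 = 1" and Hz0: "H z0 = snd z0" using z0 by (auto simp: tT H_def)
        have "continuous_map ?T ?TD snd" by (rule continuous_map_snd)
        then have l1: "((\<lambda>z. mdist Dir (snd z) (snd z0)) \<longlongrightarrow> 0) (atin ?T z0)"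
          unfolding continuous_map_mtopology_iff using z0 by blast
        have "continuous_map ?T euclideanreal fst"
          using continuous_map_fst[of ?I ?TD] by (rule continuous_map_into_fulltopology)
        then have "limitin euclideanreal fst (fst z0) (atin ?T z0)" using z0 by (simp only: continuous_map_atin)
        then have l2: "(fst \<longlongrightarrow> 1) (atin ?T z0)" using f0 by simp
        have "((\<lambda>z. (1 - fst z) + mdist Dir (snd z) (snd z0)) \<longlongrightarrow> (1 - 1) + 0) (atin ?T z0)"
          by (intro tendsto_intros l1 l2)
        then have l3: "((\<lambda>z. (1 - fst z) + mdist Dir (snd z) (snd z0)) \<longlongrightarrow> 0) (atin ?T z0)" by simp
        show ?thesis
        proof (rule tendsto_sandwich[OF _ _ tendsto_const l3])
          show "eventually (\<lambda>z. mdist Dir (H z) (H z0) \<le> (1 - fst z) + mdist Dir (snd z) (snd z0)) (atin ?T z0)"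
            using evT
          proof eventually_elim
            case (elim z)
            have "snd z \<in> mspace Dir" "snd z0 \<in> mspace Dir" using elim z0 by (auto simp: tT)
            from mdist_triangle[OF HD[OF elim] this] show ?case using Hd[OF elim] unfolding Hz0 by linarith
          qed
        qed simp
      qed
    qed
    then show ?thesis
      by (subst homotopic_with, simp, intro exI[of _ H] conjI ballI) (auto simp: H_def g_def)
  qed
  ultimately show ?thesis
    unfolding homotopy_equivalent_space_def mtopology_of_submetric[symmetric]
    using emb_continuous g by blast
qed

end

text \<open>
  By convexity, geodesics between points of a small ball can be chosen in it, and triangles of the
  ball are triangles of \<open>S\<close>.
\<close>

lemma CAT_ball:
  assumes CAT: "CAT \<kappa> (submetric X S)" and S: "mball_of X p R \<subseteq> S" and p: "p \<in> mspace X"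
    and R: "R > 0" "\<bar>\<kappa>\<bar> * (2 * R)\<^sup>2 \<le> 1 / 4"
  shows "CAT \<kappa> (submetric X (mball_of X p R))"
proof -
  interpret convex_ball X p R "\<bar>\<kappa>\<bar>" by (rule convex_ball_CAT[OF assms])
  have geo: "geodesic (submetric X S) x y c" if "geodesic (submetric X B) x y c" for x y c
    using that S unfolding geodesic_submetric by blast
  have tri: "geodesic_triangle (submetric X S) v c" if "geodesic_triangle (submetric X B) v c" for v c
    using that geo unfolding geodesic_triangle_def by blast
  have side: "side_length (submetric X S) v i = side_length (submetric X B) v i" for v i
    by (simp add: side_length_def)
  show ?thesis unfolding CAT_def
  proof (intro conjI ballI allI impI)
    fix x y assume "x \<in> mspace (submetric X B)" "y \<in> mspace (submetric X B)"
    then have "x \<in> B" "y \<in> B" by auto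
    then show "\<exists>c. geodesic (submetric X B) x y c" using geod_ex unfolding geodesic_submetric by (simp del: in_mball_of)
  next
    fix v c v' c' and i j :: nat and s t
    assume A: "geodesic_triangle (submetric X B) v c \<and>
      ereal (\<Sum>i<3. side_length (submetric X B) v i) < 2 * model_diam \<kappa> \<and> comparison_triangle \<kappa> (submetric X B) v v' c'"
      and ij: "i < 3" "j < 3" "s \<in> {0..side_length (submetric X B) v i}" "t \<in> {0..side_length (submetric X B) v j}"
    have "comparison_triangle \<kappa> (submetric X S) v v' c'"
      using A unfolding comparison_triangle_def side by blast
    then have "geodesic_triangle (submetric X S) v c \<and>
      ereal (\<Sum>i<3. side_length (submetric X S) v i) < 2 * model_diam \<kappa> \<and> comparison_triangle \<kappa> (submetric X S) v v' c'"
      using A tri unfolding side by blast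
    then have "\<forall>i<3. \<forall>j<3. \<forall>s\<in>{0..side_length (submetric X S) v i}. \<forall>t\<in>{0..side_length (submetric X S) v j}.
        mdist (submetric X S) (c i s) (c j t) \<le> mdist (model_surface \<kappa>) (c' i s) (c' j t)"
      using CAT unfolding CAT_def by blast
    then show "mdist (submetric X B) (c i s) (c j t) \<le> mdist (model_surface \<kappa>) (c' i s) (c' j t)"
      using ij unfolding side by simp
  qed
qed

lemma ex_small_radius: "\<exists>R>0. R \<le> (r::real) \<and> \<bar>\<kappa>\<bar> * (2 * R)\<^sup>2 \<le> 1 / 4" if "0 < r"
proof -
  define R where "R = min r (min 1 (1 / (16 * (\<bar>\<kappa>\<bar> + 1))))"
  have R: "0 < R" "R \<le> r" "R \<le> 1" "R \<le> 1 / (16 * (\<bar>\<kappa>\<bar> + 1))" using that unfolding R_def by (simp, linarith+)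
  have "\<bar>\<kappa>\<bar> * (2 * R)\<^sup>2 = 4 * (\<bar>\<kappa>\<bar> * R) * R" by (simp add: power2_eq_square)
  also have "\<dots> \<le> 4 * ((\<bar>\<kappa>\<bar> + 1) * (1 / (16 * (\<bar>\<kappa>\<bar> + 1)))) * 1"
    using R by (intro mult_mono) auto
  also have "\<dots> \<le> 1 / 4" by simp
  finally show ?thesis using R by blast
qed

lemma direction_radius_exists:
  assumes "curvature_bounded_above X" "p \<in> mspace X"
  shows "\<exists>r. direction_radius X p r"
proof -
  obtain \<kappa> U where U: "p \<in> mtopology_of X interior_of U" "CAT \<kappa> (submetric X U)"
    using assms unfolding curvature_bounded_above_def by blast
  then obtain V where V: "openin (mtopology_of X) V" "p \<in> V" "V \<subseteq> U" by (auto simp: interior_of_def)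
  then obtain r where r: "r > 0" "mball_of X p r \<subseteq> V"
    using Metric_space.openin_mtopology[OF Metric_space_mspace_mdist, of X V]
    unfolding mtopology_of_def mball_of_def by blast
  obtain R where rad: "0 < R" "R \<le> r" "\<bar>\<kappa>\<bar> * (2 * R)\<^sup>2 \<le> 1 / 4" using ex_small_radius[OF r(1)] by blast
  have "mball_of X p R \<subseteq> mball_of X p r" using rad(2) by auto
  then have sub: "mball_of X p R \<subseteq> U" using r(2) V(3) by blast
  interpret convex_ball X p R "\<bar>\<kappa>\<bar>" by (rule convex_ball_CAT[OF U(2) sub assms(2) rad(1,3)])
  have "CAT \<kappa> (submetric X (mball_of X p R))" by (rule CAT_ball[OF U(2) sub assms(2) rad(1,3)])
  moreover have "\<exists>!c. geodesic X p x c" if "x \<in> mball_of X p R - {p}" for x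
    by (rule geodesic_from_p_unique) (use that in blast)
  ultimately show ?thesis unfolding direction_radius_def using rad(1) by blast
qed

text \<open>
  The radius \<open>R0\<close> that defines the space of directions is an arbitrary choice; the homotopy
  equivalence is obtained for a ball that is small in terms of \<open>R0\<close> and of the curvature bound which
  belongs to it.
\<close>

theorem theoremA:
  fixes X :: "'a metric"
  assumes "curvature_bounded_above X" and "p \<in> mspace X"
  shows "\<exists>\<epsilon>>0. subtopology (mtopology_of X) (mball_of X p \<epsilon> - {p})
           homotopy_equivalent_space mtopology_of (space_of_directions X p)"
proof -
  define R0 where "R0 = (SOME r. direction_radius X p r)"
  have "direction_radius X p R0"
    unfolding R0_def by (rule someI_ex[OF direction_radius_exists[OF assms]])
  then obtain \<kappa> where R0: "R0 > 0" "CAT \<kappa> (submetric X (mball_of X p R0))"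
    and uniq: "\<forall>x\<in>mball_of X p R0 - {p}. \<exists>!c. geodesic X p x c"
    unfolding direction_radius_def by blast
  obtain R where rad: "0 < R" "R \<le> R0" "\<bar>\<kappa>\<bar> * (2 * R)\<^sup>2 \<le> 1 / 4" using ex_small_radius[OF R0(1)] by blast
  have sub: "mball_of X p R \<subseteq> mball_of X p R0" using rad(2) by auto
  interpret convex_ball X p R "\<bar>\<kappa>\<bar>" by (rule convex_ball_CAT[OF R0(2) sub assms(2) rad(1,3)])
  interpret direction_ball X p R "\<bar>\<kappa>\<bar>" R0 by unfold_locales (use rad(2) uniq in blast)+
  show ?thesis
    using punctured_ball_homotopy_equivalent rad(1) unfolding space_of_directions_def R0_def[symmetric] by blast
qed

end
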